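(* Let $(\mathfrak g,[-,-]_{\mathfrak g},(-,-)^{\mathfrak g})$ be a quadratic Lie algebra and $M$ a smooth manifold with an open cover $\{U_i\}$. Let $\tilde C_c$ and $C_c$ be transitive Courant data over $\{U_i\}$, with glued transitive Courant algebroids with connections $(\tilde C,\tilde s,\sigma_{\tilde s})$ and $(C,s,\sigma_s)$. Then a 1-morphism of transitive Courant data from $\tilde C_c$ to $C_c$ gives rise (by gluing its local matrices) to an isomorphism of Courant algebroids $\tilde C\to C$ preserving connections.
   Context: A Courant algebroid is a vector bundle $C\to M$ with anchor $\rho:C\to TM$, nondegenerate symmetric pairing and bracket on sections such that the sections form a Leibniz algebra, $\langle[\![e_1,e_1]\!],e_2\rangle=\tfrac12\rho(e_2)\langle e_1,e_1\rangle$, $\rho(e_1)\langle e_2,e_3\rangle=\langle[\![e_1,e_2]\!],e_3\rangle+\langle e_2,[\![e_1,e_3]\!]\rangle$. It is transitive if $\rho$ is onto; put $\mathcal G=\ker\rho/(\ker\rho)^\perp$. A connection is an isotropic splitting $s:TM\to C$ of $\rho$ together with a splitting $\sigma_s:\mathcal G\to\ker\rho$ of $\ker\rho\to\mathcal G$ with image orthogonal to $s(TM)$. An isomorphism $\mathfrak B:\tilde C\to C$ (bundle isomorphism over $\mathrm{id}_M$ preserving anchor, pairing, bracket) preserves connections if $\mathfrak B\circ\tilde s=s$ and $\mathfrak B\circ\sigma_{\tilde s}=\sigma_s\circ\tau$, where $\tau:\tilde{\mathcal G}\to\mathcal G$ is induced by $\mathfrak B$. Standard transitive Courant algebroid: $\mathbb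 T_{\mathfrak g}U=TU\oplus(U\times\mathfrak g)\oplus T^*U$, anchor the projection, pairing $\tfrac12(\xi(Y)+\eta(X))+(a,b)^{\mathfrak g}$, bracket $[\![X+a+\xi,Y+b+\eta]\!]_S^T=[X,Y]+X(b)-Y(a)+[a,b]_{\mathfrak g}+L_X\eta-\iota_Yd\xi+\mathcal P(a,b)$, $\mathcal P(a,b)(Y)=2(b,Y(a))^{\mathfrak g}$. Groupoid $\mathsf{TC}(U)$: objects $(\theta,B)$, $\theta\in\Omega^1(U,\mathfrak g)$, $B\in\Omega^2(U)$; 1-morphisms $(\tilde\theta,\tilde B)\to(\theta,B)$ are automorphisms of the standard transitive Courant algebroid of the form $\begin{pmatrix}1&0&0\\\phi&\tau&0\\\beta&-2\phi^\star\tau&1\end{pmatrix}$ ($\tau$ a fibrewise orthogonal Lie algebra automorphism, $\phi^\star(a)(X)=(a,\phi(X))^{\mathfrak g}$) with $\theta(X)=\tau\tilde\theta(X)+\phi(X)$, $\iota_X(\tilde B-B)=\beta(X)+(\theta,\theta(X))^{\mathfrak g}-(\tilde\theta,\tilde\theta(X))^{\mathfrak g}-2\phi^\star\tau(\tilde\theta(X))$, $\mathrm{cs}_3(\tilde\theta)-\mathrm{cs}_3(\theta)=d(\tilde B-B)$, where $\mathrm{cs}_3(\theta)=(\theta,d\theta)^{\mathfrak g}+\tfrac13(\theta,[\theta,\theta]_{\mathfrak g})^{\mathfrak g}$. Transitive Courant data over $\{U_i\}$: objects $(\theta_i,B_i)$ of $\mathsf{TC}(U_i)$ and 1-morphisms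 $\Lambda_{ij}:(\theta_j,B_j)\to(\theta_i,B_i)$ in $\mathsf{TC}(U_{ij})$ with $\Lambda_{ij}\Lambda_{jk}=\Lambda_{ik}$. A 1-morphism from $(\tilde\theta_i,\tilde B_i;\tilde\Lambda_{ij})$ to $(\theta_i,B_i;\Lambda_{ij})$ is a family of 1-morphisms $\Lambda_i:(\tilde\theta_i,\tilde B_i)\to(\theta_i,B_i)$ in $\mathsf{TC}(U_i)$ with $\Lambda_{ij}\Lambda_j=\Lambda_i\tilde\Lambda_{ij}$. The glued Courant algebroid $C$ of $(\theta_i,B_i;\Lambda_{ij})$ is obtained from the $\mathbb T_{\mathfrak g}U_i$ by identifying $e\in\mathbb T_{\mathfrak g}U_j$ with $\Lambda_{ij}e\in\mathbb T_{\mathfrak g}U_i$ over $U_{ij}$, with induced structure; its connection is given on $U_i$ by $s_i(X)=X+\theta_i(X)-(\theta_i,\theta_i(X))^{\mathfrak g}-\iota_XB_i$, $\sigma_{s_i}(a)=a-2(\theta_i,a)^{\mathfrak g}$. *)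

theory Defs
  imports "HOL-Analysis.Analysis" "HOL-Library.Function_Algebras"
begin

section \<open>Linear algebra\<close>

text \<open>Functions into a real vector space form a real vector space, with pointwise operations. This
  is used for tangent vectors, which are operators on functions, and for forms.\<close>

instantiation "fun" :: (type, real_vector) real_vector
begin

definition scaleR_fun :: "real \<Rightarrow> ('a \<Rightarrow> 'b) \<Rightarrow> 'a \<Rightarrow> 'b"
  where "scaleR_fun c f = (\<lambda>x. c *\<^sub>R f x)"

instance
  by standard (auto simp: scaleR_fun_def fun_eq_iff scaleR_add_right scaleR_add_left)

end

definition finite_dimensional :: "'a::real_vector itself \<Rightarrow> bool"
  where "finite_dimensional _ \<longleftrightarrow> (\<exists>S :: 'a set. finite S \<and> span S = UNIV)"

text \<open>A linear map on a subspace is represented by its extension by \<open>0\<close>, so that equality of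
  linear maps is equality of functions.\<close>

definition lin_maps :: "'a::real_vector set \<Rightarrow> ('a \<Rightarrow> 'b::real_vector) set"
  where "lin_maps S = {f. (\<forall>x\<in>S. \<forall>y\<in>S. f (x + y) = f x + f y) \<and>
    (\<forall>c. \<forall>x\<in>S. f (c *\<^sub>R x) = c *\<^sub>R f x) \<and> (\<forall>x. x \<notin> S \<longrightarrow> f x = 0)}"

definition quadratic_lie_algebra ::
  "('g::real_vector \<Rightarrow> 'g \<Rightarrow> 'g) \<Rightarrow> ('g \<Rightarrow> 'g \<Rightarrow> real) \<Rightarrow> bool"
  where "quadratic_lie_algebra lb ip \<longleftrightarrow>
    finite_dimensional TYPE('g) \<and>
    bilinear lb \<and> (\<forall>a. lb a a = 0) \<and>
    (\<forall>a b c. lb a (lb b c) + lb b (lb c a) + lb c (lb a b) = 0) \<and>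
    bilinear ip \<and> (\<forall>a b. ip a b = ip b a) \<and> (\<forall>a. (\<forall>b. ip a b = 0) \<longrightarrow> a = 0) \<and>
    (\<forall>a b c. ip (lb a b) c + ip b (lb a c) = 0)"

definition orthogonal_lie_automorphism ::
  "('g::real_vector \<Rightarrow> 'g \<Rightarrow> 'g) \<Rightarrow> ('g \<Rightarrow> 'g \<Rightarrow> real) \<Rightarrow> ('g \<Rightarrow> 'g) \<Rightarrow> bool"
  where "orthogonal_lie_automorphism lb ip t \<longleftrightarrow> linear t \<and> bij t \<and>
    (\<forall>a b. t (lb a b) = lb (t a) (t b)) \<and> (\<forall>a b. ip (t a) (t b) = ip a b)"


section \<open>Smooth manifolds\<close>

primrec Ck_on :: "nat \<Rightarrow> 'e set \<Rightarrow> ('e::real_normed_vector \<Rightarrow> 'f::real_normed_vector) \<Rightarrow> bool" where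
  "Ck_on 0 S f \<longleftrightarrow> continuous_on S f"
| "Ck_on (Suc k) S f \<longleftrightarrow> (\<forall>x\<in>S. f differentiable (at x)) \<and>
     (\<forall>u. Ck_on k S (\<lambda>x. frechet_derivative f (at x) u))"

text \<open>Used only for open \<open>S\<close> in a finite-dimensional space.\<close>

definition Cinf_on :: "'e set \<Rightarrow> ('e::real_normed_vector \<Rightarrow> 'f::real_normed_vector) \<Rightarrow> bool"
  where "Cinf_on S f \<longleftrightarrow> (\<forall>k. Ck_on k S f)"

text \<open>The manifold is the (Hausdorff, second countable) space of all points of type \<open>'m\<close>. Its smooth
  structure is given by an atlas of charts \<open>(V, c)\<close> with values in a normed vector space \<open>'e\<close>. This
  space is only required to be finite-dimensional rather than of class \<open>euclidean_space\<close>, because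
  that class excludes dimension \<open>0\<close>.\<close>

type_synonym ('m, 'e) atlas = "('m set \<times> ('m \<Rightarrow> 'e)) set"

definition smooth_manifold ::
  "('m::{t2_space, second_countable_topology}, 'e::real_normed_vector) atlas \<Rightarrow> bool"
  where "smooth_manifold A \<longleftrightarrow>
    finite_dimensional TYPE('e) \<and> (\<Union>(V, c)\<in>A. V) = UNIV \<and>
    (\<forall>(V, c)\<in>A. open V \<and> open (c ` V) \<and> homeomorphism V (c ` V) c (inv_into V c)) \<and>
    (\<forall>(V, c)\<in>A. \<forall>(V', c')\<in>A. Cinf_on (c ` (V \<inter> V')) (c' \<circ> inv_into V c))"

definition open_cover :: "('i \<Rightarrow> 'm::topological_space set) \<Rightarrow> bool"
  where "open_cover U \<longleftrightarrow> (\<forall>i. open (U i)) \<and> (\<Union>i. U i) = UNIV"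

definition smooth_on ::
  "('m::topological_space, 'e::real_normed_vector) atlas \<Rightarrow> 'm set \<Rightarrow> ('m \<Rightarrow> real) \<Rightarrow> bool"
  where "smooth_on A U f \<longleftrightarrow> (\<forall>(V, c)\<in>A. Cinf_on (c ` (U \<inter> V)) (f \<circ> inv_into V c))"

definition smooth_at ::
  "('m::topological_space, 'e::real_normed_vector) atlas \<Rightarrow> 'm \<Rightarrow> ('m \<Rightarrow> real) \<Rightarrow> bool"
  where "smooth_at A p f \<longleftrightarrow> (\<exists>U. open U \<and> p \<in> U \<and> smooth_on A U f)"

text \<open>Smoothness of a map with values in a finite-dimensional vector space.\<close>

definition smooth_map_on :: "('m::topological_space, 'e::real_normed_vector) atlas \<Rightarrow> 'm set \<Rightarrow>
    ('m \<Rightarrow> 'w::real_vector) \<Rightarrow> bool"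
  where "smooth_map_on A U b \<longleftrightarrow> (\<forall>l :: 'w \<Rightarrow> real. linear l \<longrightarrow> smooth_on A U (l \<circ> b))"


section \<open>Tangent vectors, vector fields and differential forms\<close>

type_synonym 'm tvec = "('m \<Rightarrow> real) \<Rightarrow> real"
type_synonym 'm covec = "'m tvec \<Rightarrow> real"

text \<open>Tangent vectors at \<open>p\<close> are the derivations at \<open>p\<close> of the algebra of germs of smooth functions,
  extended by \<open>0\<close> to functions that are not smooth near \<open>p\<close>.\<close>

definition tangent_space ::
  "('m::topological_space, 'e::real_normed_vector) atlas \<Rightarrow> 'm \<Rightarrow> 'm tvec set"
  where "tangent_space A p = {v.
    (\<forall>f. \<not> smooth_at A p f \<longrightarrow> v f = 0) \<and>
    (\<forall>f g. smooth_at A p f \<and> smooth_at A p g \<and> eventually (\<lambda>q. f q = g q) (nhds p) \<longrightarrow> v f = v g) \<and>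
    (\<forall>f g. smooth_at A p f \<and> smooth_at A p g \<longrightarrow>
      v (\<lambda>q. f q + g q) = v f + v g \<and> v (\<lambda>q. f q * g q) = f p * v g + g p * v f) \<and>
    (\<forall>c f. smooth_at A p f \<longrightarrow> v (\<lambda>q. c * f q) = c * v f)}"

abbreviation cotangent_space ::
  "('m::topological_space, 'e::real_normed_vector) atlas \<Rightarrow> 'm \<Rightarrow> 'm covec set"
  where "cotangent_space A p \<equiv> lin_maps (tangent_space A p)"

definition smooth_vector_field ::
  "('m::topological_space, 'e::real_normed_vector) atlas \<Rightarrow> 'm set \<Rightarrow> ('m \<Rightarrow> 'm tvec) \<Rightarrow> bool"
  where "smooth_vector_field A U X \<longleftrightarrow> (\<forall>p\<in>U. X p \<in> tangent_space A p) \<and>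
    (\<forall>V f. open V \<and> V \<subseteq> U \<and> smooth_on A V f \<longrightarrow> smooth_on A V (\<lambda>p. X p f))"

text \<open>\<open>X\<close> is a vector field that is smooth near \<open>p\<close> and has the value \<open>v\<close> at \<open>p\<close>.\<close>

definition local_extension ::
  "('m::topological_space, 'e::real_normed_vector) atlas \<Rightarrow> 'm \<Rightarrow> 'm tvec \<Rightarrow> ('m \<Rightarrow> 'm tvec) \<Rightarrow> bool"
  where "local_extension A p v X \<longleftrightarrow>
    X p = v \<and> (\<exists>V. open V \<and> p \<in> V \<and> smooth_vector_field A V X)"

definition lie_bracket :: "('m::topological_space, 'e::real_normed_vector) atlas \<Rightarrow>
    ('m \<Rightarrow> 'm tvec) \<Rightarrow> ('m \<Rightarrow> 'm tvec) \<Rightarrow> 'm \<Rightarrow> 'm tvec"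
  where "lie_bracket A X Y p =
    (\<lambda>f. if smooth_at A p f then X p (\<lambda>q. Y q f) - Y p (\<lambda>q. X q f) else 0)"

text \<open>The derivative \<open>v(b)\<close> of a map \<open>b\<close> with values in a finite-dimensional vector space; the
  characterization is \<open>l (v(b)) = v (l \<circ> b)\<close> for all linear functionals \<open>l\<close>.\<close>

definition vderiv :: "'m tvec \<Rightarrow> ('m \<Rightarrow> 'w::real_vector) \<Rightarrow> 'w"
  where "vderiv v b = (THE w. \<forall>l :: 'w \<Rightarrow> real. linear l \<longrightarrow> l w = v (l \<circ> b))"

definition smooth_form1 :: "('m::topological_space, 'e::real_normed_vector) atlas \<Rightarrow> 'm set \<Rightarrow>
    ('m \<Rightarrow> 'm tvec \<Rightarrow> 'w::real_vector) \<Rightarrow> bool"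
  where "smooth_form1 A U \<alpha> \<longleftrightarrow> (\<forall>p\<in>U. \<alpha> p \<in> lin_maps (tangent_space A p)) \<and>
    (\<forall>V X. open V \<and> V \<subseteq> U \<and> smooth_vector_field A V X \<longrightarrow> smooth_map_on A V (\<lambda>p. \<alpha> p (X p)))"

definition smooth_form2 :: "('m::topological_space, 'e::real_normed_vector) atlas \<Rightarrow> 'm set \<Rightarrow>
    ('m \<Rightarrow> 'm tvec \<Rightarrow> 'm covec) \<Rightarrow> bool"
  where "smooth_form2 A U B \<longleftrightarrow>
    (\<forall>p\<in>U. B p \<in> lin_maps (tangent_space A p) \<and> (\<forall>v. B p v \<in> cotangent_space A p) \<and>
      (\<forall>v w. B p v w = - B p w v)) \<and>
    (\<forall>V X Y. open V \<and> V \<subseteq> U \<and> smooth_vector_field A V X \<and> smooth_vector_field A V Y \<longrightarrow>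
      smooth_on A V (\<lambda>p. B p (X p) (Y p)))"

text \<open>Exterior and Lie derivatives. The values at tangent vectors are given by the usual
  invariant formulas, in terms of arbitrary smooth local extensions of these vectors.\<close>

definition ext_d1 :: "('m::topological_space, 'e::real_normed_vector) atlas \<Rightarrow>
    ('m \<Rightarrow> 'm tvec \<Rightarrow> 'w::real_vector) \<Rightarrow> 'm \<Rightarrow> 'm tvec \<Rightarrow> 'm tvec \<Rightarrow> 'w"
  where "ext_d1 A \<alpha> p v w = (if v \<in> tangent_space A p \<and> w \<in> tangent_space A p
    then THE z. \<forall>X Y. local_extension A p v X \<and> local_extension A p w Y \<longrightarrow>
      z = vderiv v (\<lambda>q. \<alpha> q (Y q)) - vderiv w (\<lambda>q. \<alpha> q (X q)) - \<alpha> p (lie_bracket A X Y p)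
    else 0)"

definition ext_d2 :: "('m::topological_space, 'e::real_normed_vector) atlas \<Rightarrow>
    ('m \<Rightarrow> 'm tvec \<Rightarrow> 'm covec) \<Rightarrow> 'm \<Rightarrow> 'm tvec \<Rightarrow> 'm tvec \<Rightarrow> 'm covec"
  where "ext_d2 A B p u v w =
    (if u \<in> tangent_space A p \<and> v \<in> tangent_space A p \<and> w \<in> tangent_space A p
    then THE z. \<forall>X Y Z. local_extension A p u X \<and> local_extension A p v Y \<and> local_extension A p w Z \<longrightarrow>
      z = u (\<lambda>q. B q (Y q) (Z q)) - v (\<lambda>q. B q (X q) (Z q)) + w (\<lambda>q. B q (X q) (Y q))
        - B p (lie_bracket A X Y p) w + B p (lie_bracket A X Z p) v - B p (lie_bracket A Y Z p) u
    else 0)"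

definition lie_derivative :: "('m::topological_space, 'e::real_normed_vector) atlas \<Rightarrow>
    ('m \<Rightarrow> 'm tvec) \<Rightarrow> ('m \<Rightarrow> 'm covec) \<Rightarrow> 'm \<Rightarrow> 'm covec"
  where "lie_derivative A X \<eta> p w = (if w \<in> tangent_space A p
    then THE z. \<forall>Y. local_extension A p w Y \<longrightarrow>
      z = X p (\<lambda>q. \<eta> q (Y q)) - \<eta> p (lie_bracket A X Y p)
    else 0)"


section \<open>Vector bundles and Courant algebroids\<close>

text \<open>The data of a vector bundle with anchor, pairing and bracket. An element of the total space is
  a point \<open>p\<close> together with an element of \<open>fibre p\<close>; the fibres at different points need not be
  disjoint, and bundle maps over the identity take the point as an extra argument.
  \<open>smooth_section V \<sigma>\<close> says that \<open>\<sigma>\<close> is a smooth section over the open set \<open>V\<close>.\<close>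

record ('m, 'c) courant =
  fibre :: "'m \<Rightarrow> 'c set"
  fadd :: "'m \<Rightarrow> 'c \<Rightarrow> 'c \<Rightarrow> 'c"
  fscale :: "'m \<Rightarrow> real \<Rightarrow> 'c \<Rightarrow> 'c"
  smooth_section :: "'m set \<Rightarrow> ('m \<Rightarrow> 'c) \<Rightarrow> bool"
  anchor :: "'m \<Rightarrow> 'c \<Rightarrow> 'm tvec"
  pairing :: "'m \<Rightarrow> 'c \<Rightarrow> 'c \<Rightarrow> real"
  bracket :: "('m \<Rightarrow> 'c) \<Rightarrow> ('m \<Rightarrow> 'c) \<Rightarrow> 'm \<Rightarrow> 'c"

text \<open>\<open>\<Phi>\<close> is a local trivialization \<open>C|\<^bsub>N\<^esub> \<rightarrow> N \<times> \<real>\<^sup>n\<close>, where \<open>\<real>\<^sup>n\<close> is the space of the functions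
  \<open>nat \<Rightarrow> real\<close> that vanish from \<open>n\<close> on. As \<open>\<Phi> q\<close> is bijective and compatible with the operations,
  the vector space axioms hold in the fibres.\<close>

definition local_trivialization ::
  "('m::topological_space, 'e::real_normed_vector) atlas \<Rightarrow> ('m, 'c) courant \<Rightarrow> 'm set \<Rightarrow> nat \<Rightarrow>
    ('m \<Rightarrow> 'c \<Rightarrow> nat \<Rightarrow> real) \<Rightarrow> bool"
  where "local_trivialization A C N n \<Phi> \<longleftrightarrow>
    (\<forall>q\<in>N. bij_betw (\<Phi> q) (fibre C q) {x. \<forall>k\<ge>n. x k = 0} \<and>
      (\<forall>e\<in>fibre C q. \<forall>e'\<in>fibre C q. fadd C q e e' \<in> fibre C q \<and>
        \<Phi> q (fadd C q e e') = \<Phi> q e + \<Phi> q e') \<and>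
      (\<forall>c. \<forall>e\<in>fibre C q. fscale C q c e \<in> fibre C q \<and> \<Phi> q (fscale C q c e) = c *\<^sub>R \<Phi> q e)) \<and>
    (\<forall>V \<sigma>. open V \<and> V \<subseteq> N \<longrightarrow>
      (smooth_section C V \<sigma> \<longleftrightarrow>
        (\<forall>q\<in>V. \<sigma> q \<in> fibre C q) \<and> (\<forall>k<n. smooth_on A V (\<lambda>q. \<Phi> q (\<sigma> q) k))))"

definition vector_bundle ::
  "('m::topological_space, 'e::real_normed_vector) atlas \<Rightarrow> 'm set \<Rightarrow> ('m, 'c) courant \<Rightarrow> bool"
  where "vector_bundle A W C \<longleftrightarrow>
    (\<forall>p\<in>W. \<exists>N n \<Phi>. open N \<and> p \<in> N \<and> N \<subseteq> W \<and> local_trivialization A C N n \<Phi>) \<and>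
    (\<forall>V \<sigma>. open V \<and> V \<subseteq> W \<longrightarrow>
      (smooth_section C V \<sigma> \<longleftrightarrow> (\<forall>p\<in>V. \<exists>N. open N \<and> p \<in> N \<and> N \<subseteq> V \<and> smooth_section C N \<sigma>)))"

text \<open>A Courant algebroid over the open submanifold \<open>W\<close>. The bracket acts on the smooth sections
  over \<open>W\<close>; the values of sections outside of \<open>W\<close> are irrelevant.\<close>

definition courant_algebroid ::
  "('m::topological_space, 'e::real_normed_vector) atlas \<Rightarrow> 'm set \<Rightarrow> ('m, 'c) courant \<Rightarrow> bool"
  where "courant_algebroid A W C \<longleftrightarrow> vector_bundle A W C \<and>
    \<comment> \<open>the anchor is a smooth bundle map to the tangent bundle\<close>
    (\<forall>p\<in>W. \<forall>e\<in>fibre C p. anchor C p e \<in> tangent_space A p \<and>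
      (\<forall>e'\<in>fibre C p. anchor C p (fadd C p e e') = anchor C p e + anchor C p e') \<and>
      (\<forall>c. anchor C p (fscale C p c e) = c *\<^sub>R anchor C p e)) \<and>
    (\<forall>V \<sigma>. open V \<and> V \<subseteq> W \<and> smooth_section C V \<sigma> \<longrightarrow>
      smooth_vector_field A V (\<lambda>p. anchor C p (\<sigma> p))) \<and>
    \<comment> \<open>the pairing is a smooth nondegenerate symmetric bilinear form\<close>
    (\<forall>p\<in>W. \<forall>e\<in>fibre C p. \<forall>e'\<in>fibre C p. pairing C p e e' = pairing C p e' e \<and>
      (\<forall>e''\<in>fibre C p. pairing C p (fadd C p e e') e'' = pairing C p e e'' + pairing C p e' e'') \<and>
      (\<forall>c. pairing C p (fscale C p c e) e' = c * pairing C p e e')) \<and>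
    (\<forall>p\<in>W. \<forall>e\<in>fibre C p. (\<forall>e'\<in>fibre C p. pairing C p e e' = 0) \<longrightarrow> e = fscale C p 0 e) \<and>
    (\<forall>V \<sigma> \<sigma>'. open V \<and> V \<subseteq> W \<and> smooth_section C V \<sigma> \<and> smooth_section C V \<sigma>' \<longrightarrow>
      smooth_on A V (\<lambda>p. pairing C p (\<sigma> p) (\<sigma>' p))) \<and>
    \<comment> \<open>the bracket is an operation on the sections over \<open>W\<close>\<close>
    (\<forall>\<sigma> \<sigma>'. smooth_section C W \<sigma> \<and> smooth_section C W \<sigma>' \<longrightarrow> smooth_section C W (bracket C \<sigma> \<sigma>') \<and>
      (\<forall>\<tau> \<tau>'. (\<forall>p\<in>W. \<tau> p = \<sigma> p \<and> \<tau>' p = \<sigma>' p) \<longrightarrow>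
        (\<forall>p\<in>W. bracket C \<tau> \<tau>' p = bracket C \<sigma> \<sigma>' p))) \<and>
    \<comment> \<open>the sections over \<open>W\<close> are a (left) Leibniz algebra\<close>
    (\<forall>\<sigma> \<sigma>' \<sigma>''. smooth_section C W \<sigma> \<and> smooth_section C W \<sigma>' \<and> smooth_section C W \<sigma>'' \<longrightarrow> (\<forall>p\<in>W.
      bracket C (\<lambda>q. fadd C q (\<sigma> q) (\<sigma>' q)) \<sigma>'' p = fadd C p (bracket C \<sigma> \<sigma>'' p) (bracket C \<sigma>' \<sigma>'' p) \<and>
      bracket C \<sigma> (\<lambda>q. fadd C q (\<sigma>' q) (\<sigma>'' q)) p = fadd C p (bracket C \<sigma> \<sigma>' p) (bracket C \<sigma> \<sigma>'' p) \<and>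
      (\<forall>c. bracket C (\<lambda>q. fscale C q c (\<sigma> q)) \<sigma>' p = fscale C p c (bracket C \<sigma> \<sigma>' p) \<and>
        bracket C \<sigma> (\<lambda>q. fscale C q c (\<sigma>' q)) p = fscale C p c (bracket C \<sigma> \<sigma>' p)) \<and>
      bracket C \<sigma> (bracket C \<sigma>' \<sigma>'') p =
        fadd C p (bracket C (bracket C \<sigma> \<sigma>') \<sigma>'' p) (bracket C \<sigma>' (bracket C \<sigma> \<sigma>'') p))) \<and>
    \<comment> \<open>the two compatibility axioms\<close>
    (\<forall>\<sigma> \<sigma>'. smooth_section C W \<sigma> \<and> smooth_section C W \<sigma>' \<longrightarrow> (\<forall>p\<in>W.
      pairing C p (bracket C \<sigma> \<sigma> p) (\<sigma>' p) =
        1/2 * anchor C p (\<sigma>' p) (\<lambda>q. pairing C q (\<sigma> q) (\<sigma> q)))) \<and>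
    (\<forall>\<sigma> \<sigma>' \<sigma>''. smooth_section C W \<sigma> \<and> smooth_section C W \<sigma>' \<and> smooth_section C W \<sigma>'' \<longrightarrow> (\<forall>p\<in>W.
      anchor C p (\<sigma> p) (\<lambda>q. pairing C q (\<sigma>' q) (\<sigma>'' q)) =
        pairing C p (bracket C \<sigma> \<sigma>' p) (\<sigma>'' p) + pairing C p (\<sigma>' p) (bracket C \<sigma> \<sigma>'' p)))"

definition transitive_courant_algebroid ::
  "('m::topological_space, 'e::real_normed_vector) atlas \<Rightarrow> 'm set \<Rightarrow> ('m, 'c) courant \<Rightarrow> bool"
  where "transitive_courant_algebroid A W C \<longleftrightarrow> courant_algebroid A W C \<and>
    (\<forall>p\<in>W. anchor C p ` fibre C p = tangent_space A p)"

text \<open>A bundle isomorphism over the identity: fibrewise linear and bijective, and smooth in both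
  directions.\<close>

definition bundle_isomorphism ::
  "'m::topological_space set \<Rightarrow> ('m, 'c) courant \<Rightarrow> ('m, 'd) courant \<Rightarrow> ('m \<Rightarrow> 'c \<Rightarrow> 'd) \<Rightarrow> bool"
  where "bundle_isomorphism W C C' F \<longleftrightarrow>
    (\<forall>p\<in>W. bij_betw (F p) (fibre C p) (fibre C' p) \<and>
      (\<forall>e\<in>fibre C p. \<forall>e'\<in>fibre C p. F p (fadd C p e e') = fadd C' p (F p e) (F p e')) \<and>
      (\<forall>c. \<forall>e\<in>fibre C p. F p (fscale C p c e) = fscale C' p c (F p e))) \<and>
    (\<forall>V \<sigma>. open V \<and> V \<subseteq> W \<and> (\<forall>p\<in>V. \<sigma> p \<in> fibre C p) \<longrightarrow>
      (smooth_section C V \<sigma> \<longleftrightarrow> smooth_section C' V (\<lambda>p. F p (\<sigma> p))))"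

definition courant_isomorphism ::
  "('m::topological_space, 'e::real_normed_vector) atlas \<Rightarrow> 'm set \<Rightarrow> ('m, 'c) courant \<Rightarrow>
    ('m, 'd) courant \<Rightarrow> ('m \<Rightarrow> 'c \<Rightarrow> 'd) \<Rightarrow> bool"
  where "courant_isomorphism A W C C' F \<longleftrightarrow>
    courant_algebroid A W C \<and> courant_algebroid A W C' \<and> bundle_isomorphism W C C' F \<and>
    (\<forall>p\<in>W. \<forall>e\<in>fibre C p. anchor C' p (F p e) = anchor C p e) \<and>
    (\<forall>p\<in>W. \<forall>e\<in>fibre C p. \<forall>e'\<in>fibre C p. pairing C' p (F p e) (F p e') = pairing C p e e') \<and>
    (\<forall>\<sigma> \<sigma>'. smooth_section C W \<sigma> \<and> smooth_section C W \<sigma>' \<longrightarrow>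
      (\<forall>p\<in>W. F p (bracket C \<sigma> \<sigma>' p) = bracket C' (\<lambda>q. F q (\<sigma> q)) (\<lambda>q. F q (\<sigma>' q)) p))"


section \<open>Connections on transitive Courant algebroids\<close>

definition anchor_ker :: "('m, 'c) courant \<Rightarrow> 'm \<Rightarrow> 'c set"
  where "anchor_ker C p = {e \<in> fibre C p. anchor C p e = 0}"

definition anchor_ker_perp :: "('m, 'c) courant \<Rightarrow> 'm \<Rightarrow> 'c set"
  where "anchor_ker_perp C p = {e \<in> fibre C p. \<forall>k\<in>anchor_ker C p. pairing C p e k = 0}"

text \<open>The projection \<open>ker \<rho> \<rightarrow> \<G> = ker \<rho> / (ker \<rho>)\<^sup>\<bottom>\<close> and the fibres of \<open>\<G>\<close>, whose elements are
  cosets.\<close>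

definition quot_proj :: "('m, 'c) courant \<Rightarrow> 'm \<Rightarrow> 'c \<Rightarrow> 'c set"
  where "quot_proj C p e = {fadd C p e k | k. k \<in> anchor_ker_perp C p}"

definition quot_fibre :: "('m, 'c) courant \<Rightarrow> 'm \<Rightarrow> 'c set set"
  where "quot_fibre C p = quot_proj C p ` anchor_ker C p"

text \<open>A connection \<open>(s, \<sigma>)\<close>. Smooth sections of \<open>\<G>\<close> are locally the projections of smooth sections
  of \<open>ker \<rho>\<close>, so a bundle map on \<open>\<G>\<close> is smooth if its composition with the projection is smooth.\<close>

definition courant_connection ::
  "('m::topological_space, 'e::real_normed_vector) atlas \<Rightarrow> 'm set \<Rightarrow> ('m, 'c) courant \<Rightarrow>
    ('m \<Rightarrow> 'm tvec \<Rightarrow> 'c) \<Rightarrow> ('m \<Rightarrow> 'c set \<Rightarrow> 'c) \<Rightarrow> bool"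
  where "courant_connection A W C s \<sigma> \<longleftrightarrow> transitive_courant_algebroid A W C \<and>
    \<comment> \<open>\<open>s\<close> is a smooth isotropic splitting of the anchor\<close>
    (\<forall>p\<in>W. \<forall>v\<in>tangent_space A p. s p v \<in> fibre C p \<and> anchor C p (s p v) = v \<and>
      (\<forall>w\<in>tangent_space A p. s p (v + w) = fadd C p (s p v) (s p w) \<and> pairing C p (s p v) (s p w) = 0) \<and>
      (\<forall>c. s p (c *\<^sub>R v) = fscale C p c (s p v))) \<and>
    (\<forall>V X. open V \<and> V \<subseteq> W \<and> smooth_vector_field A V X \<longrightarrow> smooth_section C V (\<lambda>p. s p (X p))) \<and>
    \<comment> \<open>\<open>\<sigma>\<close> is a smooth splitting of the projection, with image orthogonal to the image of \<open>s\<close>\<close>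
    (\<forall>p\<in>W. \<forall>K\<in>quot_fibre C p. \<sigma> p K \<in> anchor_ker C p \<and> quot_proj C p (\<sigma> p K) = K \<and>
      (\<forall>v\<in>tangent_space A p. pairing C p (\<sigma> p K) (s p v) = 0)) \<and>
    (\<forall>p\<in>W. \<forall>e\<in>anchor_ker C p.
      (\<forall>e'\<in>anchor_ker C p. \<sigma> p (quot_proj C p (fadd C p e e')) =
        fadd C p (\<sigma> p (quot_proj C p e)) (\<sigma> p (quot_proj C p e'))) \<and>
      (\<forall>c. \<sigma> p (quot_proj C p (fscale C p c e)) = fscale C p c (\<sigma> p (quot_proj C p e)))) \<and>
    (\<forall>V e. open V \<and> V \<subseteq> W \<and> smooth_section C V e \<and> (\<forall>p\<in>V. e p \<in> anchor_ker C p) \<longrightarrow>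
      smooth_section C V (\<lambda>p. \<sigma> p (quot_proj C p (e p))))"

text \<open>The map \<open>\<G> \<rightarrow> \<G>'\<close> induced by \<open>F\<close> takes a coset \<open>K\<close> to the coset \<open>F p ` K\<close>.\<close>

definition connection_preserving_isomorphism ::
  "('m::topological_space, 'e::real_normed_vector) atlas \<Rightarrow> 'm set \<Rightarrow>
    ('m, 'c) courant \<Rightarrow> ('m \<Rightarrow> 'm tvec \<Rightarrow> 'c) \<Rightarrow> ('m \<Rightarrow> 'c set \<Rightarrow> 'c) \<Rightarrow>
    ('m, 'd) courant \<Rightarrow> ('m \<Rightarrow> 'm tvec \<Rightarrow> 'd) \<Rightarrow> ('m \<Rightarrow> 'd set \<Rightarrow> 'd) \<Rightarrow>
    ('m \<Rightarrow> 'c \<Rightarrow> 'd) \<Rightarrow> bool"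
  where "connection_preserving_isomorphism A W C s \<sigma> C' s' \<sigma>' F \<longleftrightarrow>
    courant_connection A W C s \<sigma> \<and> courant_connection A W C' s' \<sigma>' \<and>
    courant_isomorphism A W C C' F \<and>
    (\<forall>p\<in>W. \<forall>v\<in>tangent_space A p. F p (s p v) = s' p v) \<and>
    (\<forall>p\<in>W. \<forall>K\<in>quot_fibre C p. F p (\<sigma> p K) = \<sigma>' p (F p ` K))"


section \<open>The standard transitive Courant algebroid\<close>

type_synonym ('m, 'g) std = "'m tvec \<times> 'g \<times> 'm covec"

definition std_fibre :: "('m::topological_space, 'e::real_normed_vector) atlas \<Rightarrow> 'm \<Rightarrow>
    ('m, 'g::real_vector) std set"
  where "std_fibre A p = tangent_space A p \<times> UNIV \<times> cotangent_space A p"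

definition std_pairing :: "('g::real_vector \<Rightarrow> 'g \<Rightarrow> real) \<Rightarrow> ('m, 'g) std \<Rightarrow> ('m, 'g) std \<Rightarrow> real"
  where "std_pairing ip = (\<lambda>(v, a, \<xi>) (w, b, \<eta>). 1/2 * (\<xi> w + \<eta> v) + ip a b)"

definition std_bracket :: "('m::topological_space, 'e::real_normed_vector) atlas \<Rightarrow>
    ('g::real_vector \<Rightarrow> 'g \<Rightarrow> 'g) \<Rightarrow> ('g \<Rightarrow> 'g \<Rightarrow> real) \<Rightarrow>
    ('m \<Rightarrow> ('m, 'g) std) \<Rightarrow> ('m \<Rightarrow> ('m, 'g) std) \<Rightarrow> 'm \<Rightarrow> ('m, 'g) std"
  where "std_bracket A lb ip e e' p =
    (let X = (\<lambda>q. fst (e q)); a = (\<lambda>q. fst (snd (e q))); \<xi> = (\<lambda>q. snd (snd (e q)));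
         Y = (\<lambda>q. fst (e' q)); b = (\<lambda>q. fst (snd (e' q))); \<eta> = (\<lambda>q. snd (snd (e' q)));
         P = (\<lambda>w. if w \<in> tangent_space A p then 2 * ip (b p) (vderiv w a) else 0)
     in (lie_bracket A X Y p,
         vderiv (X p) b - vderiv (Y p) a + lb (a p) (b p),
         lie_derivative A X \<eta> p - ext_d1 A \<xi> p (Y p) + P))"

text \<open>All operations are local, so the same record describes \<open>\<bbbT>\<^sub>\<gg>U\<close> for every open \<open>U\<close>; the base
  is the parameter \<open>W\<close> of the predicates above.\<close>

definition std_courant :: "('m::topological_space, 'e::real_normed_vector) atlas \<Rightarrow>
    ('g::real_vector \<Rightarrow> 'g \<Rightarrow> 'g) \<Rightarrow> ('g \<Rightarrow> 'g \<Rightarrow> real) \<Rightarrow> ('m, ('m, 'g) std) courant"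
  where "std_courant A lb ip = \<lparr>
    fibre = std_fibre A,
    fadd = (\<lambda>p e e'. e + e'),
    fscale = (\<lambda>p c e. c *\<^sub>R e),
    smooth_section = (\<lambda>V e. smooth_vector_field A V (\<lambda>p. fst (e p)) \<and>
      smooth_map_on A V (\<lambda>p. fst (snd (e p))) \<and> smooth_form1 A V (\<lambda>p. snd (snd (e p)))),
    anchor = (\<lambda>p e. fst e),
    pairing = (\<lambda>p. std_pairing ip),
    bracket = std_bracket A lb ip \<rparr>"


section \<open>The groupoids of transitive Courant data\<close>

text \<open>The value \<open>[\<theta>, \<theta>](v, w)\<close> of the \<open>\<gg>\<close>-valued 2-form and the Chern-Simons form; the pairing of
  a 1-form with a 2-form is the wedge product (without normalization factors) combined with \<open>ip\<close>.\<close>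

definition bracket_form ::
  "('g::real_vector \<Rightarrow> 'g \<Rightarrow> 'g) \<Rightarrow> ('m tvec \<Rightarrow> 'g) \<Rightarrow> 'm tvec \<Rightarrow> 'm tvec \<Rightarrow> 'g"
  where "bracket_form lb \<theta> v w = lb (\<theta> v) (\<theta> w) - lb (\<theta> w) (\<theta> v)"

definition wedge12 :: "('g \<Rightarrow> 'g \<Rightarrow> real) \<Rightarrow> ('m tvec \<Rightarrow> 'g) \<Rightarrow> ('m tvec \<Rightarrow> 'm tvec \<Rightarrow> 'g) \<Rightarrow>
    'm tvec \<Rightarrow> 'm tvec \<Rightarrow> 'm covec"
  where "wedge12 ip \<alpha> \<omega> u v w = ip (\<alpha> u) (\<omega> v w) + ip (\<alpha> v) (\<omega> w u) + ip (\<alpha> w) (\<omega> u v)"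

definition cs3 :: "('m::topological_space, 'e::real_normed_vector) atlas \<Rightarrow>
    ('g::real_vector \<Rightarrow> 'g \<Rightarrow> 'g) \<Rightarrow> ('g \<Rightarrow> 'g \<Rightarrow> real) \<Rightarrow> ('m \<Rightarrow> 'm tvec \<Rightarrow> 'g) \<Rightarrow>
    'm \<Rightarrow> 'm tvec \<Rightarrow> 'm tvec \<Rightarrow> 'm covec"
  where "cs3 A lb ip \<theta> p u v w = wedge12 ip (\<theta> p) (ext_d1 A \<theta> p) u v w
    + 1/3 * wedge12 ip (\<theta> p) (bracket_form lb (\<theta> p)) u v w"

type_synonym ('m, 'g) tc_object = "('m \<Rightarrow> 'm tvec \<Rightarrow> 'g) \<times> ('m \<Rightarrow> 'm tvec \<Rightarrow> 'm covec)"

definition tc_object :: "('m::topological_space, 'e::real_normed_vector) atlas \<Rightarrow> 'm set \<Rightarrow>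
    ('m, 'g::real_vector) tc_object \<Rightarrow> bool"
  where "tc_object A U = (\<lambda>(\<theta>, B). smooth_form1 A U \<theta> \<and> smooth_form2 A U B)"

text \<open>The covector \<open>\<phi>\<^sup>\<star>(a)\<close>, for \<open>\<phi>\<close> with values in \<open>\<gg>\<close>.\<close>

definition dual_form :: "('g \<Rightarrow> 'g \<Rightarrow> real) \<Rightarrow> ('m tvec \<Rightarrow> 'g) \<Rightarrow> 'g \<Rightarrow> 'm covec"
  where "dual_form ip \<phi> a = (\<lambda>v. ip a (\<phi> v))"

text \<open>A 1-morphism \<open>(\<theta>', B') \<rightarrow> (\<theta>, B)\<close>. Smoothness of the matrix entries \<open>\<phi>\<close>, \<open>\<tau>\<close>, \<open>\<beta>\<close> amounts to
  smoothness of the bundle map \<open>\<Lambda>\<close>.\<close>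

definition tc_morphism :: "('m::topological_space, 'e::real_normed_vector) atlas \<Rightarrow>
    ('g::real_vector \<Rightarrow> 'g \<Rightarrow> 'g) \<Rightarrow> ('g \<Rightarrow> 'g \<Rightarrow> real) \<Rightarrow> 'm set \<Rightarrow>
    ('m, 'g) tc_object \<Rightarrow> ('m, 'g) tc_object \<Rightarrow>
    ('m \<Rightarrow> ('m, 'g) std \<Rightarrow> ('m, 'g) std) \<Rightarrow> bool"
  where "tc_morphism A lb ip U = (\<lambda>(\<theta>', B') (\<theta>, B) \<Lambda>.
    courant_isomorphism A U (std_courant A lb ip) (std_courant A lb ip) \<Lambda> \<and>
    (\<exists>\<phi> \<tau> \<beta>. \<forall>p\<in>U.
      \<phi> p \<in> lin_maps (tangent_space A p) \<and>
      orthogonal_lie_automorphism lb ip (\<tau> p) \<and>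
      \<beta> p \<in> lin_maps (tangent_space A p) \<and> (\<forall>v. \<beta> p v \<in> cotangent_space A p) \<and>
      (\<forall>(v, a, \<xi>)\<in>std_fibre A p. \<Lambda> p (v, a, \<xi>) =
        (v, \<phi> p v + \<tau> p a, \<beta> p v - 2 *\<^sub>R dual_form ip (\<phi> p) (\<tau> p a) + \<xi>)) \<and>
      (\<forall>v\<in>tangent_space A p.
        \<theta> p v = \<tau> p (\<theta>' p v) + \<phi> p v \<and>
        B' p v - B p v = \<beta> p v + dual_form ip (\<theta> p) (\<theta> p v) - dual_form ip (\<theta>' p) (\<theta>' p v)
          - 2 *\<^sub>R dual_form ip (\<phi> p) (\<tau> p (\<theta>' p v))) \<and>
      (\<forall>u\<in>tangent_space A p. \<forall>v\<in>tangent_space A p. \<forall>w\<in>tangent_space A p.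
        cs3 A lb ip \<theta>' p u v w - cs3 A lb ip \<theta> p u v w = ext_d2 A (B' - B) p u v w)))"

record ('i, 'm, 'g) tc_data =
  obj :: "'i \<Rightarrow> ('m, 'g) tc_object"
  trans_map :: "'i \<Rightarrow> 'i \<Rightarrow> 'm \<Rightarrow> ('m, 'g) std \<Rightarrow> ('m, 'g) std"

definition transitive_courant_data :: "('m::topological_space, 'e::real_normed_vector) atlas \<Rightarrow>
    ('g::real_vector \<Rightarrow> 'g \<Rightarrow> 'g) \<Rightarrow> ('g \<Rightarrow> 'g \<Rightarrow> real) \<Rightarrow> ('i \<Rightarrow> 'm set) \<Rightarrow>
    ('i, 'm, 'g) tc_data \<Rightarrow> bool"
  where "transitive_courant_data A lb ip U D \<longleftrightarrow>
    (\<forall>i. tc_object A (U i) (obj D i)) \<and>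
    (\<forall>i j. tc_morphism A lb ip (U i \<inter> U j) (obj D j) (obj D i) (trans_map D i j)) \<and>
    (\<forall>i j k. \<forall>p\<in>U i \<inter> U j \<inter> U k. \<forall>e\<in>std_fibre A p.
      trans_map D i j p (trans_map D j k p e) = trans_map D i k p e)"

definition tc_data_morphism :: "('m::topological_space, 'e::real_normed_vector) atlas \<Rightarrow>
    ('g::real_vector \<Rightarrow> 'g \<Rightarrow> 'g) \<Rightarrow> ('g \<Rightarrow> 'g \<Rightarrow> real) \<Rightarrow> ('i \<Rightarrow> 'm set) \<Rightarrow>
    ('i, 'm, 'g) tc_data \<Rightarrow> ('i, 'm, 'g) tc_data \<Rightarrow>
    ('i \<Rightarrow> 'm \<Rightarrow> ('m, 'g) std \<Rightarrow> ('m, 'g) std) \<Rightarrow> bool"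
  where "tc_data_morphism A lb ip U D' D \<Lambda> \<longleftrightarrow>
    (\<forall>i. tc_morphism A lb ip (U i) (obj D' i) (obj D i) (\<Lambda> i)) \<and>
    (\<forall>i j. \<forall>p\<in>U i \<inter> U j. \<forall>e\<in>std_fibre A p.
      trans_map D i j p (\<Lambda> j p e) = \<Lambda> i p (trans_map D' i j p e))"


section \<open>The glued Courant algebroid and its connection\<close>

text \<open>The total space is the quotient of the disjoint union of the \<open>\<bbbT>\<^sub>\<gg>U\<^sub>i\<close>, whose elements are triples
  \<open>(i, p, e)\<close>, by the relation that identifies \<open>(j, p, e)\<close> with \<open>(i, p, \<Lambda>\<^sub>i\<^sub>j e)\<close>.\<close>

definition glue_rel :: "('m::topological_space, 'e::real_normed_vector) atlas \<Rightarrow> ('i \<Rightarrow> 'm set) \<Rightarrow>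
    ('i, 'm, 'g::real_vector) tc_data \<Rightarrow> (('i \<times> 'm \<times> ('m, 'g) std) \<times> ('i \<times> 'm \<times> ('m, 'g) std)) set"
  where "glue_rel A U D = {((j, p, e), (i, p, trans_map D i j p e)) | i j p e.
    p \<in> U i \<inter> U j \<and> e \<in> std_fibre A p}"

definition glue_class :: "('m::topological_space, 'e::real_normed_vector) atlas \<Rightarrow> ('i \<Rightarrow> 'm set) \<Rightarrow>
    ('i, 'm, 'g::real_vector) tc_data \<Rightarrow> 'i \<Rightarrow> 'm \<Rightarrow> ('m, 'g) std \<Rightarrow> ('i \<times> 'm \<times> ('m, 'g) std) set"
  where "glue_class A U D i p e = glue_rel A U D `` {(i, p, e)}"

text \<open>The representative over \<open>U\<^sub>i\<close> of a class at \<open>p \<in> U\<^sub>i\<close>.\<close>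

definition glue_rep :: "'i \<Rightarrow> 'm \<Rightarrow> ('i \<times> 'm \<times> ('m, 'g) std) set \<Rightarrow> ('m, 'g) std"
  where "glue_rep i p c = (THE e. (i, p, e) \<in> c)"

text \<open>The induced structure is computed over any member of the cover that contains the point.\<close>

definition some_index :: "('i \<Rightarrow> 'm set) \<Rightarrow> 'm \<Rightarrow> 'i"
  where "some_index U p = (SOME i. p \<in> U i)"

definition glued_courant :: "('m::topological_space, 'e::real_normed_vector) atlas \<Rightarrow>
    ('g::real_vector \<Rightarrow> 'g \<Rightarrow> 'g) \<Rightarrow> ('g \<Rightarrow> 'g \<Rightarrow> real) \<Rightarrow> ('i \<Rightarrow> 'm set) \<Rightarrow>
    ('i, 'm, 'g) tc_data \<Rightarrow> ('m, ('i \<times> 'm \<times> ('m, 'g) std) set) courant"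
  where "glued_courant A lb ip U D = \<lparr>
    fibre = (\<lambda>p. {glue_class A U D i p e | i e. p \<in> U i \<and> e \<in> std_fibre A p}),
    fadd = (\<lambda>p c c'. let i = some_index U p in
      glue_class A U D i p (glue_rep i p c + glue_rep i p c')),
    fscale = (\<lambda>p r c. let i = some_index U p in glue_class A U D i p (r *\<^sub>R glue_rep i p c)),
    smooth_section = (\<lambda>V \<sigma>.
      (\<forall>p\<in>V. \<exists>i e. p \<in> U i \<and> e \<in> std_fibre A p \<and> \<sigma> p = glue_class A U D i p e) \<and>
      (\<forall>i. smooth_section (std_courant A lb ip) (V \<inter> U i) (\<lambda>p. glue_rep i p (\<sigma> p)))),
    anchor = (\<lambda>p c. let i = some_index U p in anchor (std_courant A lb ip) p (glue_rep i p c)),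
    pairing = (\<lambda>p c c'. let i = some_index U p in
      pairing (std_courant A lb ip) p (glue_rep i p c) (glue_rep i p c')),
    bracket = (\<lambda>\<sigma> \<sigma>' p. let i = some_index U p in glue_class A U D i p
      (bracket (std_courant A lb ip) (\<lambda>q. glue_rep i q (\<sigma> q)) (\<lambda>q. glue_rep i q (\<sigma>' q)) p)) \<rparr>"

definition glued_splitting :: "('m::topological_space, 'e::real_normed_vector) atlas \<Rightarrow>
    ('g::real_vector \<Rightarrow> 'g \<Rightarrow> real) \<Rightarrow> ('i \<Rightarrow> 'm set) \<Rightarrow> ('i, 'm, 'g) tc_data \<Rightarrow>
    'm \<Rightarrow> 'm tvec \<Rightarrow> ('i \<times> 'm \<times> ('m, 'g) std) set"
  where "glued_splitting A ip U D p v = (let i = some_index U p; (\<theta>, B) = obj D i in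
    glue_class A U D i p (v, \<theta> p v, - dual_form ip (\<theta> p) (\<theta> p v) - B p v))"

text \<open>Over \<open>U\<^sub>i\<close>, an element of \<open>\<gg>\<close> is identified with the coset \<open>K\<close> of \<open>(0, a, 0)\<close> in \<open>\<G>\<close>.\<close>

definition glued_ker_splitting :: "('m::topological_space, 'e::real_normed_vector) atlas \<Rightarrow>
    ('g::real_vector \<Rightarrow> 'g \<Rightarrow> real) \<Rightarrow> ('i \<Rightarrow> 'm set) \<Rightarrow> ('i, 'm, 'g) tc_data \<Rightarrow>
    'm \<Rightarrow> ('i \<times> 'm \<times> ('m, 'g) std) set set \<Rightarrow> ('i \<times> 'm \<times> ('m, 'g) std) set"
  where "glued_ker_splitting A ip U D p K = (let i = some_index U p; (\<theta>, B) = obj D i;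
      a = (THE a. glue_class A U D i p (0, a, 0) \<in> K)
    in glue_class A U D i p (0, a, - 2 *\<^sub>R dual_form ip (\<theta> p) a))"

end

theory Submission
  imports Defs
begin

text \<open>Over \<open>U\<^sub>i\<close> the local representatives identify a glued Courant algebroid with the standard one.
  Every axiom can be checked on the restrictions of global sections to a member of the cover; the
  transition maps preserve the structure, so the result does not depend on the member. In the same
  way the local matrices \<open>\<Lambda>\<^sub>i\<close> define a global map, because \<open>\<Lambda>\<^sub>i\<^sub>j \<Lambda>\<^sub>j = \<Lambda>\<^sub>i \<Lambda>'\<^sub>i\<^sub>j\<close>. The first two defining equations of a
  1-morphism \<open>(\<theta>', B') \<rightarrow> (\<theta>, B)\<close> say precisely that its matrix takes the local splittings given
  by \<open>(\<theta>', B')\<close> to those given by \<open>(\<theta>, B)\<close>. Applied to the transition maps this shows that the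
  local connections glue; applied to \<open>\<Lambda>\<^sub>i\<close> it shows that the isomorphism preserves them.\<close>

section \<open>Smooth functions\<close>

text \<open>Lie brackets, Lie derivatives and exterior derivatives are never expanded. A 1-morphism
  is by definition an isomorphism of Courant algebroids over its open set, so the cocycle over
  \<open>U i \<inter> U i\<close> already supplies all axioms of the standard algebroid over
  \<open>U i\<close>. The work lies in transport along charts. The obstacle is the bracket: the
  glued operations are defined through an index chosen separately at each point, while a bracket
  depends on sections near the point. Two chart expressions of a bracket are therefore compared over
  the whole overlap, where the transition map relates the representatives and the bracket is local.
  Only global sections enter the axioms over the whole manifold, and these restrict to every
  \<open>U i\<close>, so local sections never have to be extended. For the connection the remaining
  point is that, in a chart, the orthogonal complement of the kernel of the anchor is the cotangent
  part. Nondegeneracy of the two pairings yields this, and it identifies the quotient bundle with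
  \<open>U i\<close> times the Lie algebra.\<close>

lemma Ck_on_subset: "Ck_on k S f \<Longrightarrow> T \<subseteq> S \<Longrightarrow> Ck_on k T f"
  by (induction k arbitrary: f) (auto intro: continuous_on_subset)

lemma frechet_derivative_cong_open:
  assumes "open S" "x \<in> S" "\<And>y. y \<in> S \<Longrightarrow> f y = g y" "f differentiable (at x)"
  shows "g differentiable (at x)" "frechet_derivative g (at x) = frechet_derivative f (at x)"
proof -
  have "(g has_derivative frechet_derivative f (at x)) (at x)"
    using has_derivative_transform_within_open[OF _ assms(1,2,3)] assms(4)
    by (simp add: frechet_derivative_works)
  then show "g differentiable (at x)" "frechet_derivative g (at x) = frechet_derivative f (at x)"
    by (auto simp: differentiable_def dest: frechet_derivative_at)
qed

lemma Ck_on_cong: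
  assumes "open S"
  shows "Ck_on k S f \<Longrightarrow> (\<And>x. x \<in> S \<Longrightarrow> f x = g x) \<Longrightarrow> Ck_on k S g"
proof (induction k arbitrary: f g)
  case 0
  then show ?case by (simp cong: continuous_on_cong)
next
  case (Suc k)
  have *: "g differentiable (at x)" "frechet_derivative g (at x) = frechet_derivative f (at x)"
    if "x \<in> S" for x
    using frechet_derivative_cong_open[OF assms that Suc.prems(2)] Suc.prems(1) that by auto
  have "Ck_on k S (\<lambda>x. frechet_derivative g (at x) u)" for u
    by (rule Suc.IH[of "\<lambda>x. frechet_derivative f (at x) u"]) (use Suc.prems(1) * in auto)
  then show ?case
    using * by simp
qed

text \<open>Differentiability at a point and the derivative there refer to full neighbourhoods of
  the point, so locality passes from a function to its directional derivatives in the
  induction.\<close>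

lemma Ck_on_local:
  "(\<And>x. x \<in> S \<Longrightarrow> \<exists>T. open T \<and> x \<in> T \<and> Ck_on k T f) \<Longrightarrow> Ck_on k S f"
proof (induction k arbitrary: f)
  case 0
  then show ?case
    by (metis Ck_on.simps(1) continuous_at_imp_continuous_on continuous_on_eq_continuous_at)
next
  case (Suc k)
  have "Ck_on k S (\<lambda>x. frechet_derivative f (at x) u)" for u
    by (rule Suc.IH) (metis Ck_on.simps(2) Suc.prems)
  moreover have "f differentiable (at x)" if "x \<in> S" for x
    using Suc.prems[OF that] by auto
  ultimately show ?case
    by simp
qed

lemma Ck_on_const: "Ck_on k S (\<lambda>x. c)"
  by (induction k arbitrary: c) auto

text \<open>The sum rule identifies the derivatives only at points of \<open>S\<close>. Hence the
  induction hypothesis is transferred by \<open>Ck_on_cong\<close>, for which \<open>S\<close> is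
  open.\<close>

lemma Ck_on_add:
  assumes "open S"
  shows "Ck_on k S f \<Longrightarrow> Ck_on k S g \<Longrightarrow> Ck_on k S (\<lambda>x. f x + g x)"
proof (induction k arbitrary: f g)
  case 0
  then show ?case by (simp add: continuous_on_add)
next
  case (Suc k)
  have *: "f differentiable (at x)" "g differentiable (at x)" if "x \<in> S" for x
    using Suc.prems that by auto
  have **: "frechet_derivative f (at x) u + frechet_derivative g (at x) u
      = frechet_derivative (\<lambda>x. f x + g x) (at x) u" if "x \<in> S" for x u
    using frechet_derivative_at[OF has_derivative_add[OF *[OF that, unfolded frechet_derivative_works]]]
    by metis
  have "Ck_on k S (\<lambda>x. frechet_derivative (\<lambda>x. f x + g x) (at x) u)" for u
    by (rule Ck_on_cong[OF assms Suc.IH **]) (use Suc.prems in auto)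
  then show ?case
    using * by simp
qed

lemma Ck_on_scaleR:
  assumes "open S"
  shows "Ck_on k S f \<Longrightarrow> Ck_on k S (\<lambda>x. c *\<^sub>R f x)"
proof (induction k arbitrary: f)
  case 0
  then show ?case by (simp add: continuous_on_scaleR)
next
  case (Suc k)
  have *: "f differentiable (at x)" if "x \<in> S" for x
    using Suc.prems that by auto
  have **: "c *\<^sub>R frechet_derivative f (at x) u = frechet_derivative (\<lambda>x. c *\<^sub>R f x) (at x) u"
    if "x \<in> S" for x u
    using frechet_derivative_at[OF has_derivative_scaleR_right[OF
          *[OF that, unfolded frechet_derivative_works]]]
    by metis
  have "Ck_on k S (\<lambda>x. frechet_derivative (\<lambda>x. c *\<^sub>R f x) (at x) u)" for u
    by (rule Ck_on_cong[OF assms Suc.IH **]) (use Suc.prems in auto)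
  then show ?case
    using * by (simp add: differentiable_scaleR)
qed

text \<open>Smoothness over \<open>U\<close> is tested on this image, and the rules for
  \<open>Ck_on\<close> are stated on open sets. The chart is an open map onto its image, which is
  itself open in the model space.\<close>

lemma chart_image_open:
  assumes "smooth_manifold A" "(V, c) \<in> A" "open U"
  shows "open (c ` (U \<inter> V))"
proof -
  have *: "open V" "open (c ` V)" "homeomorphism V (c ` V) c (inv_into V c)"
    using assms(1,2) by (auto simp: smooth_manifold_def)
  have "openin (top_of_set V) (U \<inter> V)"
    using assms(3) by (auto simp: openin_open)
  then have "openin (top_of_set (c ` V)) (c ` (U \<inter> V))"
    using homeomorphism_imp_open_map[OF *(3)] by blast
  then show ?thesis
    using *(2) by (metis openin_open_trans)
qed

lemma chart_inverse_image:
  assumes "smooth_manifold A" "(V, c) \<in> A" "x \<in> c ` (U \<inter> V)"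
  shows "inv_into V c x \<in> U"
proof -
  have "homeomorphism V (c ` V) c (inv_into V c)"
    using assms(1,2) by (auto simp: smooth_manifold_def)
  then show ?thesis
    using assms(3) by (auto simp: homeomorphism_def)
qed

section \<open>Smooth functions, vector fields and forms over open subsets of the manifold\<close>

lemma smooth_on_subset: "smooth_on A U f \<Longrightarrow> V \<subseteq> U \<Longrightarrow> smooth_on A V f"
  unfolding smooth_on_def Cinf_on_def
  by (auto 0 3 intro: Ck_on_subset[of _ "c ` (U \<inter> W)" _ "c ` (V \<inter> W)" for c W])

lemma smooth_on_const: "smooth_on A U (\<lambda>p. c)"
  by (auto simp: smooth_on_def Cinf_on_def comp_def Ck_on_const)

context
  fixes A :: "('m::{t2_space, second_countable_topology}, 'e::real_normed_vector) atlas"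
  assumes smooth_manifold: "smooth_manifold A"
begin

lemma smooth_on_cong:
  assumes "open U" "smooth_on A U f" "\<And>p. p \<in> U \<Longrightarrow> f p = g p"
  shows "smooth_on A U g"
  unfolding smooth_on_def Cinf_on_def
proof clarify
  fix V c k assume Vc: "(V, c) \<in> A"
  show "Ck_on k (c ` (U \<inter> V)) (g \<circ> inv_into V c)"
  proof (rule Ck_on_cong[OF chart_image_open[OF smooth_manifold Vc assms(1)]])
    show "Ck_on k (c ` (U \<inter> V)) (f \<circ> inv_into V c)"
      using assms(2) Vc by (auto simp: smooth_on_def Cinf_on_def)
    show "(f \<circ> inv_into V c) x = (g \<circ> inv_into V c) x" if "x \<in> c ` (U \<inter> V)" for x
      using chart_inverse_image[OF smooth_manifold Vc that] assms(3) by simp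
  qed
qed

lemma smooth_on_add:
  assumes "open U" "smooth_on A U f" "smooth_on A U g"
  shows "smooth_on A U (\<lambda>p. f p + g p)"
  unfolding smooth_on_def Cinf_on_def comp_def
proof clarify
  fix V c k assume Vc: "(V, c) \<in> A"
  show "Ck_on k (c ` (U \<inter> V)) (\<lambda>x. f (inv_into V c x) + g (inv_into V c x))"
    by (rule Ck_on_add[OF chart_image_open[OF smooth_manifold Vc assms(1)]])
      (use assms(2,3) Vc in \<open>auto simp: smooth_on_def Cinf_on_def comp_def\<close>)
qed

lemma smooth_on_mult_const:
  assumes "open U" "smooth_on A U f"
  shows "smooth_on A U (\<lambda>p. c * f p)"
  unfolding smooth_on_def Cinf_on_def comp_def
proof clarify
  fix V h k assume Vh: "(V, h) \<in> A"
  show "Ck_on k (h ` (U \<inter> V)) (\<lambda>x. c * f (inv_into V h x))"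
    using Ck_on_scaleR[OF chart_image_open[OF smooth_manifold Vh assms(1)],
        of k "\<lambda>x. f (inv_into V h x)" c] assms(2) Vh
    by (auto simp: smooth_on_def Cinf_on_def comp_def)
qed

lemma smooth_on_local:
  assumes "\<And>p. p \<in> U \<Longrightarrow> \<exists>N. open N \<and> p \<in> N \<and> smooth_on A N f"
  shows "smooth_on A U f"
  unfolding smooth_on_def Cinf_on_def
proof clarify
  fix V c k assume Vc: "(V, c) \<in> A"
  show "Ck_on k (c ` (U \<inter> V)) (f \<circ> inv_into V c)"
  proof (rule Ck_on_local)
    fix x assume "x \<in> c ` (U \<inter> V)"
    then obtain p where p: "p \<in> U" "p \<in> V" "x = c p" by blast
    then obtain N where N: "open N" "p \<in> N" "smooth_on A N f"
      using assms by blast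
    have "Ck_on k (c ` (N \<inter> V)) (f \<circ> inv_into V c)"
      using N(3) Vc by (auto simp: smooth_on_def Cinf_on_def)
    then show "\<exists>T. open T \<and> x \<in> T \<and> Ck_on k T (f \<circ> inv_into V c)"
      using chart_image_open[OF smooth_manifold Vc N(1)] N(2) p by blast
  qed
qed

text \<open>A linear functional on the reals is multiplication by its value at 1. This is how
  ordinary covector fields enter \<open>smooth_form1\<close>, which is phrased for values in an
  arbitrary vector space.\<close>

lemma smooth_map_on_realI:
  fixes f :: "'m \<Rightarrow> real"
  assumes "open U" "smooth_on A U f"
  shows "smooth_map_on A U f"
  unfolding smooth_map_on_def
proof (intro allI impI)
  fix l :: "real \<Rightarrow> real" assume "linear l"
  have "(l \<circ> f) = (\<lambda>p. l 1 * f p)"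
  proof (rule ext)
    fix p
    show "(l \<circ> f) p = l 1 * f p"
      using linear_scale[OF \<open>linear l\<close>, of "f p" 1] by (simp add: mult.commute[of "l 1"])
  qed
  then show "smooth_on A U (l \<circ> f)"
    using smooth_on_mult_const[OF assms, of "l 1"] by simp
qed

lemma smooth_map_on_cong:
  fixes f g :: "'m \<Rightarrow> 'b::real_vector"
  assumes "open U" "smooth_map_on A U f" "\<And>p. p \<in> U \<Longrightarrow> f p = g p"
  shows "smooth_map_on A U g"
  unfolding smooth_map_on_def
proof (intro allI impI)
  fix l :: "'b \<Rightarrow> real" assume "linear l"
  then show "smooth_on A U (l \<circ> g)"
    using smooth_on_cong[OF assms(1), of "l \<circ> f" "l \<circ> g"] assms(2,3)
    by (simp add: smooth_map_on_def)
qed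

lemma smooth_vector_field_cong:
  assumes "smooth_vector_field A U X" "\<And>p. p \<in> U \<Longrightarrow> X p = Y p"
  shows "smooth_vector_field A U Y"
  unfolding smooth_vector_field_def
proof (intro conjI ballI allI impI)
  show "Y p \<in> tangent_space A p" if "p \<in> U" for p
    using assms that by (metis smooth_vector_field_def)
next
  fix V f assume V: "open V \<and> V \<subseteq> U \<and> smooth_on A V f"
  then have "smooth_on A V (\<lambda>p. X p f)"
    using assms(1) by (auto simp: smooth_vector_field_def)
  then show "smooth_on A V (\<lambda>p. Y p f)"
    by (rule smooth_on_cong[rotated]) (use V assms(2) in auto)
qed

lemma smooth_form1_cong:
  assumes "smooth_form1 A U \<alpha>" "\<And>p. p \<in> U \<Longrightarrow> \<alpha> p = \<beta> p"
  shows "smooth_form1 A U \<beta>"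
  unfolding smooth_form1_def
proof (intro conjI ballI allI impI)
  show "\<beta> p \<in> lin_maps (tangent_space A p)" if "p \<in> U" for p
    using assms that by (metis smooth_form1_def)
next
  fix V X assume V: "open V \<and> V \<subseteq> U \<and> smooth_vector_field A V X"
  then have "smooth_map_on A V (\<lambda>p. \<alpha> p (X p))"
    using assms(1) by (auto simp: smooth_form1_def)
  then show "smooth_map_on A V (\<lambda>p. \<beta> p (X p))"
    by (rule smooth_map_on_cong[rotated]) (use V assms(2) in auto)
qed

lemma smooth_vector_field_local:
  assumes "\<And>p. p \<in> U \<Longrightarrow> \<exists>N. open N \<and> p \<in> N \<and> smooth_vector_field A N X"
  shows "smooth_vector_field A U X"
  unfolding smooth_vector_field_def
proof (intro conjI ballI allI impI)
  show "X p \<in> tangent_space A p" if "p \<in> U" for p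
    using assms[OF that] by (auto simp: smooth_vector_field_def)
next
  fix V f assume V: "open V \<and> V \<subseteq> U \<and> smooth_on A V f"
  show "smooth_on A V (\<lambda>p. X p f)"
  proof (rule smooth_on_local)
    fix p assume p: "p \<in> V"
    then obtain N where N: "open N" "p \<in> N" "smooth_vector_field A N X"
      using assms V by blast
    then have "smooth_on A (N \<inter> V) (\<lambda>p. X p f)"
      using V smooth_on_subset[of A V f "N \<inter> V"]
      by (simp add: smooth_vector_field_def open_Int)
    then show "\<exists>N. open N \<and> p \<in> N \<and> smooth_on A N (\<lambda>p. X p f)"
      using N V p by blast
  qed
qed

end

lemma smooth_map_on_subset: "smooth_map_on A U f \<Longrightarrow> V \<subseteq> U \<Longrightarrow> smooth_map_on A V f"
  unfolding smooth_map_on_def by (blast intro: smooth_on_subset)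

lemma smooth_vector_field_subset:
  "smooth_vector_field A U X \<Longrightarrow> V \<subseteq> U \<Longrightarrow> smooth_vector_field A V X"
  unfolding smooth_vector_field_def by (meson subsetD order_trans)

lemma smooth_form1_subset: "smooth_form1 A U \<alpha> \<Longrightarrow> V \<subseteq> U \<Longrightarrow> smooth_form1 A V \<alpha>"
  unfolding smooth_form1_def by (meson subsetD order_trans)

section \<open>Tangent and cotangent spaces\<close>

lemma zero_in_tangent_space: "0 \<in> tangent_space A p"
  by (auto simp: tangent_space_def)

lemma tangent_space_add:
  "v \<in> tangent_space A p \<Longrightarrow> w \<in> tangent_space A p \<Longrightarrow> v + w \<in> tangent_space A p"
proof -
  assume v: "v \<in> tangent_space A p" and w: "w \<in> tangent_space A p"
  note vs = v[unfolded tangent_space_def mem_Collect_eq]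
  note ws = w[unfolded tangent_space_def mem_Collect_eq]
  show ?thesis
    unfolding tangent_space_def mem_Collect_eq plus_fun_def
  proof (intro conjI)
    show "\<forall>f. \<not> smooth_at A p f \<longrightarrow> v f + w f = 0"
      using vs[THEN conjunct1] ws[THEN conjunct1] by simp
    show "\<forall>f g. smooth_at A p f \<and> smooth_at A p g \<and> (\<forall>\<^sub>F q in nhds p. f q = g q) \<longrightarrow>
        v f + w f = v g + w g"
      using vs[THEN conjunct2, THEN conjunct1] ws[THEN conjunct2, THEN conjunct1] by metis
  qed (use vs[THEN conjunct2, THEN conjunct2] ws[THEN conjunct2, THEN conjunct2] in
      \<open>simp_all add: algebra_simps\<close>)
qed

lemma tangent_space_scaleR: "v \<in> tangent_space A p \<Longrightarrow> c *\<^sub>R v \<in> tangent_space A p"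
proof -
  assume v: "v \<in> tangent_space A p"
  note vs = v[unfolded tangent_space_def mem_Collect_eq]
  show ?thesis
    unfolding tangent_space_def mem_Collect_eq scaleR_fun_def
  proof (intro conjI)
    show "\<forall>f. \<not> smooth_at A p f \<longrightarrow> c *\<^sub>R v f = 0"
      using vs[THEN conjunct1] by simp
    show "\<forall>f g. smooth_at A p f \<and> smooth_at A p g \<and> (\<forall>\<^sub>F q in nhds p. f q = g q) \<longrightarrow>
        c *\<^sub>R v f = c *\<^sub>R v g"
      using vs[THEN conjunct2, THEN conjunct1] by metis
  qed (use vs[THEN conjunct2, THEN conjunct2] in \<open>simp_all add: algebra_simps\<close>)
qed

text \<open>The germ condition on derivations. It is needed because a function on the manifold and
  its expression in a chart agree only over that chart.\<close>

lemma tangent_vector_local: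
  assumes "v \<in> tangent_space A p" "open N" "p \<in> N" "smooth_on A N f" "smooth_on A N g"
    and "\<And>q. q \<in> N \<Longrightarrow> f q = g q"
  shows "v f = v g"
proof -
  have "eventually (\<lambda>q. f q = g q) (nhds p)"
    using assms(2,3,6) eventually_nhds by blast
  moreover have "smooth_at A p f" "smooth_at A p g"
    using assms(2-5) by (auto simp: smooth_at_def)
  ultimately show ?thesis
    using assms(1) unfolding tangent_space_def by blast
qed

lemma lin_maps_zero: "0 \<in> lin_maps S"
  by (simp add: lin_maps_def)

lemma lin_maps_add: "f \<in> lin_maps S \<Longrightarrow> g \<in> lin_maps S \<Longrightarrow> f + g \<in> lin_maps S"
  by (simp add: lin_maps_def scaleR_add_right)

lemma lin_maps_scaleR: "f \<in> lin_maps S \<Longrightarrow> c *\<^sub>R f \<in> lin_maps S"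
  by (simp add: lin_maps_def scaleR_fun_def scaleR_add_right)

lemma lin_maps_uminus: "f \<in> lin_maps S \<Longrightarrow> - f \<in> lin_maps S"
  by (simp add: lin_maps_def)

lemma lin_maps_diff: "f \<in> lin_maps S \<Longrightarrow> g \<in> lin_maps S \<Longrightarrow> f - g \<in> lin_maps S"
  by (simp add: lin_maps_def scaleR_diff_right)

text \<open>If 0 lies in \<open>S\<close> this is linearity; otherwise it is the convention that
  elements of \<open>lin_maps S\<close> vanish outside \<open>S\<close>.\<close>

lemma lin_maps_at_zero: "f \<in> lin_maps S \<Longrightarrow> f 0 = 0"
  unfolding lin_maps_def by (cases "0 \<in> S") (fastforce dest: bspec[of S _ 0])+

lemma dual_form_lin_maps:
  assumes "bilinear ip" "\<phi> \<in> lin_maps S"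
  shows "dual_form ip \<phi> a \<in> lin_maps S"
  using assms by (simp add: lin_maps_def dual_form_def bilinear_radd bilinear_rmul bilinear_rzero)

lemma dual_form_add: "bilinear ip \<Longrightarrow> dual_form ip \<phi> (a + b) = dual_form ip \<phi> a + dual_form ip \<phi> b"
  by (simp add: dual_form_def bilinear_ladd fun_eq_iff)

lemma dual_form_scaleR: "bilinear ip \<Longrightarrow> dual_form ip \<phi> (c *\<^sub>R a) = c *\<^sub>R dual_form ip \<phi> a"
  by (simp add: dual_form_def bilinear_lmul fun_eq_iff scaleR_fun_def)

lemma smooth_vector_field_zero: "smooth_vector_field A U (\<lambda>p. 0)"
  by (simp add: smooth_vector_field_def zero_in_tangent_space smooth_on_const)

lemma smooth_form1_zero: "smooth_form1 A U (\<lambda>p. 0 :: _ \<Rightarrow> _::real_vector)"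
  by (auto simp: smooth_form1_def lin_maps_zero smooth_map_on_def comp_def smooth_on_const)

section \<open>Courant algebroids glued from local models\<close>

lemma courant_algebroid_bundle: "courant_algebroid A W C \<Longrightarrow> vector_bundle A W C"
  by (simp add: courant_algebroid_def)

lemma courant_algebroid_anchor:
  assumes "courant_algebroid A W C" "p \<in> W" "e \<in> fibre C p"
  shows "anchor C p e \<in> tangent_space A p"
    and "e' \<in> fibre C p \<Longrightarrow> anchor C p (fadd C p e e') = anchor C p e + anchor C p e'"
    and "anchor C p (fscale C p c e) = c *\<^sub>R anchor C p e"
  using assms by (simp_all add: courant_algebroid_def)

lemma courant_algebroid_anchor_smooth:
  assumes "courant_algebroid A W C" "open V" "V \<subseteq> W" "smooth_section C V \<sigma>"
  shows "smooth_vector_field A V (\<lambda>p. anchor C p (\<sigma> p))"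
  using assms by (simp add: courant_algebroid_def)

lemma courant_algebroid_pairing:
  assumes "courant_algebroid A W C" "p \<in> W" "e \<in> fibre C p" "e' \<in> fibre C p"
  shows "pairing C p e e' = pairing C p e' e"
    and "e'' \<in> fibre C p \<Longrightarrow> pairing C p (fadd C p e e') e'' = pairing C p e e'' + pairing C p e' e''"
    and "pairing C p (fscale C p c e) e' = c * pairing C p e e'"
  using assms(1)[unfolded courant_algebroid_def, THEN conjunct2, THEN conjunct2, THEN conjunct2,
      THEN conjunct1,
      THEN bspec, OF assms(2), THEN bspec, OF assms(3), THEN bspec, OF assms(4)]
  by blast+

lemma courant_algebroid_nondegenerate:
  assumes "courant_algebroid A W C" "p \<in> W" "e \<in> fibre C p"
    and "\<And>e'. e' \<in> fibre C p \<Longrightarrow> pairing C p e e' = 0"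
  shows "e = fscale C p 0 e"
  using assms(1)[unfolded courant_algebroid_def, THEN conjunct2, THEN conjunct2, THEN conjunct2,
      THEN conjunct2, THEN conjunct1,
      THEN bspec, OF assms(2), THEN bspec, OF assms(3)] assms(4)
  by blast

lemma courant_algebroid_pairing_smooth:
  assumes "courant_algebroid A W C" "open V" "V \<subseteq> W" "smooth_section C V \<sigma>" "smooth_section C V \<sigma>'"
  shows "smooth_on A V (\<lambda>p. pairing C p (\<sigma> p) (\<sigma>' p))"
  using assms by (simp add: courant_algebroid_def)

lemma courant_algebroid_bracket_smooth:
  assumes "courant_algebroid A W C" "smooth_section C W \<sigma>" "smooth_section C W \<sigma>'"
  shows "smooth_section C W (bracket C \<sigma> \<sigma>')"
  using assms by (simp add: courant_algebroid_def)

text \<open>The locality of the bracket. Since one record describes the standard algebroid over all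
  open sets, this can be used with \<open>W\<close> an overlap of two charts, and there it compares
  brackets computed from sections that agree only on the overlap.\<close>

lemma courant_algebroid_bracket_cong:
  assumes "courant_algebroid A W C" "smooth_section C W \<sigma>" "smooth_section C W \<sigma>'"
    and "\<And>q. q \<in> W \<Longrightarrow> \<tau> q = \<sigma> q" "\<And>q. q \<in> W \<Longrightarrow> \<tau>' q = \<sigma>' q" "p \<in> W"
  shows "bracket C \<tau> \<tau>' p = bracket C \<sigma> \<sigma>' p"
  using assms unfolding courant_algebroid_def by (elim conjE) metis

lemma courant_algebroid_bracket_bilinear:
  assumes "courant_algebroid A W C" "p \<in> W"
    and "smooth_section C W \<sigma>" "smooth_section C W \<sigma>'" "smooth_section C W \<sigma>''"
  shows "bracket C (\<lambda>q. fadd C q (\<sigma> q) (\<sigma>' q)) \<sigma>'' p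
      = fadd C p (bracket C \<sigma> \<sigma>'' p) (bracket C \<sigma>' \<sigma>'' p)"
    and "bracket C \<sigma> (\<lambda>q. fadd C q (\<sigma>' q) (\<sigma>'' q)) p
      = fadd C p (bracket C \<sigma> \<sigma>' p) (bracket C \<sigma> \<sigma>'' p)"
    and "bracket C (\<lambda>q. fscale C q c (\<sigma> q)) \<sigma>' p = fscale C p c (bracket C \<sigma> \<sigma>' p)"
    and "bracket C \<sigma> (\<lambda>q. fscale C q c (\<sigma>' q)) p = fscale C p c (bracket C \<sigma> \<sigma>' p)"
    and "bracket C \<sigma> (bracket C \<sigma>' \<sigma>'') p
      = fadd C p (bracket C (bracket C \<sigma> \<sigma>') \<sigma>'' p) (bracket C \<sigma>' (bracket C \<sigma> \<sigma>'') p)"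
  using assms(1)[unfolded courant_algebroid_def, THEN conjunct2, THEN conjunct2, THEN conjunct2,
      THEN conjunct2, THEN conjunct2, THEN conjunct2, THEN conjunct2, THEN conjunct1,
      THEN spec, THEN spec, THEN spec, THEN mp, OF conjI[OF assms(3) conjI[OF assms(4,5)]],
      THEN bspec, OF assms(2)]
  by blast+

lemma courant_algebroid_bracket_pairing:
  assumes "courant_algebroid A W C" "p \<in> W"
    and "smooth_section C W \<sigma>" "smooth_section C W \<sigma>'"
  shows "pairing C p (bracket C \<sigma> \<sigma> p) (\<sigma>' p)
      = 1/2 * anchor C p (\<sigma>' p) (\<lambda>q. pairing C q (\<sigma> q) (\<sigma> q))"
    and "smooth_section C W \<sigma>'' \<Longrightarrow> anchor C p (\<sigma> p) (\<lambda>q. pairing C q (\<sigma>' q) (\<sigma>'' q))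
      = pairing C p (bracket C \<sigma> \<sigma>' p) (\<sigma>'' p) + pairing C p (\<sigma>' p) (bracket C \<sigma> \<sigma>'' p)"
proof -
  show "pairing C p (bracket C \<sigma> \<sigma> p) (\<sigma>' p)
      = 1/2 * anchor C p (\<sigma>' p) (\<lambda>q. pairing C q (\<sigma> q) (\<sigma> q))"
    by (rule assms(1)[unfolded courant_algebroid_def, THEN conjunct2, THEN conjunct2,
        THEN conjunct2, THEN conjunct2, THEN conjunct2, THEN conjunct2, THEN conjunct2,
        THEN conjunct2, THEN conjunct1,
          THEN spec, THEN spec, THEN mp, OF conjI[OF assms(3,4)], THEN bspec, OF assms(2)])
next
  assume "smooth_section C W \<sigma>''"
  then show "anchor C p (\<sigma> p) (\<lambda>q. pairing C q (\<sigma>' q) (\<sigma>'' q))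
      = pairing C p (bracket C \<sigma> \<sigma>' p) (\<sigma>'' p) + pairing C p (\<sigma>' p) (bracket C \<sigma> \<sigma>'' p)"
    using assms(1)[unfolded courant_algebroid_def, THEN conjunct2, THEN conjunct2,
        THEN conjunct2, THEN conjunct2, THEN conjunct2, THEN conjunct2, THEN conjunct2,
        THEN conjunct2, THEN conjunct2,
        THEN spec, THEN spec, THEN spec, THEN mp, OF conjI[OF assms(3) conjI[OF assms(4)]],
        THEN bspec, OF _ assms(2)]
    by blast
qed

text \<open>An axiomatization of "glued from a model" without matrices or equivalence classes:
  \<open>R i p\<close> is the chart from the fibre of \<open>G\<close> to the fibre of the model.
  One model \<open>C\<close> serves all indices because its operations do not mention the base.
  \<open>section_single\<close> expresses the smoothness of the coordinate changes, which do not
  occur otherwise. The bracket assumptions concern global sections only, as do the axioms to be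
  proved.\<close>

locale courant_gluing =
  fixes A :: "('m::{t2_space, second_countable_topology}, 'e::real_normed_vector) atlas"
    and U :: "'i \<Rightarrow> 'm set"
    and C :: "('m, 'c) courant"
    and G :: "('m, 'd) courant"
    and R :: "'i \<Rightarrow> 'm \<Rightarrow> 'd \<Rightarrow> 'c"
  assumes manifold: "smooth_manifold A"
    and cover: "open_cover U"
    and model: "\<And>i. courant_algebroid A (U i) C"
    and model_restrict: "\<And>V V' \<sigma>. smooth_section C V \<sigma> \<Longrightarrow> V' \<subseteq> V \<Longrightarrow> smooth_section C V' \<sigma>"
    and model_cong: "\<And>V \<sigma> \<sigma>'. open V \<Longrightarrow> smooth_section C V \<sigma> \<Longrightarrow>
      (\<And>p. p \<in> V \<Longrightarrow> \<sigma> p = \<sigma>' p) \<Longrightarrow> smooth_section C V \<sigma>'"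
    and bij: "\<And>i p. p \<in> U i \<Longrightarrow> bij_betw (R i p) (fibre G p) (fibre C p)"
    and add: "\<And>p c c'. c \<in> fibre G p \<Longrightarrow> c' \<in> fibre G p \<Longrightarrow> fadd G p c c' \<in> fibre G p"
    and scale: "\<And>p r c. c \<in> fibre G p \<Longrightarrow> fscale G p r c \<in> fibre G p"
    and R_add: "\<And>i p c c'. p \<in> U i \<Longrightarrow> c \<in> fibre G p \<Longrightarrow> c' \<in> fibre G p \<Longrightarrow>
      R i p (fadd G p c c') = fadd C p (R i p c) (R i p c')"
    and R_scale: "\<And>i p r c. p \<in> U i \<Longrightarrow> c \<in> fibre G p \<Longrightarrow>
      R i p (fscale G p r c) = fscale C p r (R i p c)"
    and section_iff: "\<And>V \<sigma>. smooth_section G V \<sigma> \<longleftrightarrow> (\<forall>p\<in>V. \<sigma> p \<in> fibre G p) \<and>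
      (\<forall>i. smooth_section C (V \<inter> U i) (\<lambda>p. R i p (\<sigma> p)))"
    and section_single: "\<And>i V \<sigma>. open V \<Longrightarrow> V \<subseteq> U i \<Longrightarrow> (\<And>p. p \<in> V \<Longrightarrow> \<sigma> p \<in> fibre G p) \<Longrightarrow>
      smooth_section C V (\<lambda>p. R i p (\<sigma> p)) \<Longrightarrow> smooth_section G V \<sigma>"
    and R_anchor: "\<And>i p c. p \<in> U i \<Longrightarrow> c \<in> fibre G p \<Longrightarrow> anchor C p (R i p c) = anchor G p c"
    and R_pairing: "\<And>i p c c'. p \<in> U i \<Longrightarrow> c \<in> fibre G p \<Longrightarrow> c' \<in> fibre G p \<Longrightarrow>
      pairing C p (R i p c) (R i p c') = pairing G p c c'"
    and bracket_fibre: "\<And>\<sigma> \<sigma>' p. smooth_section G UNIV \<sigma> \<Longrightarrow> smooth_section G UNIV \<sigma>' \<Longrightarrow>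
      bracket G \<sigma> \<sigma>' p \<in> fibre G p"
    and R_bracket: "\<And>i \<sigma> \<sigma>' p. smooth_section G UNIV \<sigma> \<Longrightarrow> smooth_section G UNIV \<sigma>' \<Longrightarrow>
      p \<in> U i \<Longrightarrow> R i p (bracket G \<sigma> \<sigma>' p) = bracket C (\<lambda>q. R i q (\<sigma> q)) (\<lambda>q. R i q (\<sigma>' q)) p"
begin

lemma open_U: "open (U i)"
  using cover by (simp add: open_cover_def)

lemma covered: obtains i where "p \<in> U i"
  using cover unfolding open_cover_def by blast

lemma R_fibre: "p \<in> U i \<Longrightarrow> c \<in> fibre G p \<Longrightarrow> R i p c \<in> fibre C p"
  using bij bij_betwE by blast

lemma R_surj:
  assumes "p \<in> U i" "e \<in> fibre C p"
  obtains c where "c \<in> fibre G p" "R i p c = e"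
proof -
  have "e \<in> R i p ` fibre G p"
    using bij[OF assms(1)] assms(2) by (simp add: bij_betw_def)
  then show ?thesis
    using that by blast
qed

lemma R_cancel: "p \<in> U i \<Longrightarrow> c \<in> fibre G p \<Longrightarrow> c' \<in> fibre G p \<Longrightarrow> R i p c = R i p c' \<Longrightarrow> c = c'"
  using bij unfolding bij_betw_def by (blast dest: inj_onD)

lemma section_fibre: "smooth_section G V \<sigma> \<Longrightarrow> p \<in> V \<Longrightarrow> \<sigma> p \<in> fibre G p"
  by (simp add: section_iff)

lemma section_R: "smooth_section G V \<sigma> \<Longrightarrow> smooth_section C (V \<inter> U i) (\<lambda>p. R i p (\<sigma> p))"
  by (simp add: section_iff)

lemma section_R_UNIV: "smooth_section G UNIV \<sigma> \<Longrightarrow> smooth_section C (U i) (\<lambda>p. R i p (\<sigma> p))"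
  using section_R[of UNIV] by simp

lemma model_sheaf:
  assumes "open V" "V \<subseteq> U i" "\<And>p. p \<in> V \<Longrightarrow> \<exists>N. open N \<and> p \<in> N \<and> N \<subseteq> V \<and> smooth_section C N \<sigma>"
  shows "smooth_section C V \<sigma>"
  using courant_algebroid_bundle[OF model[of i], unfolded vector_bundle_def, THEN conjunct2,
      THEN spec, THEN spec, THEN mp, OF conjI[OF assms(1,2)], THEN iffD2] assms(3)
  by blast

text \<open>A trivialization of the model inside \<open>U i\<close>, composed with
  \<open>R i\<close>, trivializes \<open>G\<close>. Its description of smooth sections refers to the
  single chart \<open>i\<close>, and \<open>section_single\<close> turns this into smoothness in all
  charts. The sheaf condition is inherited from the model chart by chart.\<close>

lemma glued_vector_bundle: "vector_bundle A UNIV G"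
  unfolding vector_bundle_def
proof (intro conjI ballI allI impI)
  fix p :: 'm
  obtain i where i: "p \<in> U i" by (rule covered)
  obtain N n \<Phi> where N: "open N" "p \<in> N" "N \<subseteq> U i" and \<Phi>: "local_trivialization A C N n \<Phi>"
    using courant_algebroid_bundle[OF model[of i]] i unfolding vector_bundle_def by blast
  have fibre: "bij_betw (\<Phi> q) (fibre C q) {x. \<forall>k\<ge>n. x k = 0}"
    "e \<in> fibre C q \<Longrightarrow> e' \<in> fibre C q \<Longrightarrow> \<Phi> q (fadd C q e e') = \<Phi> q e + \<Phi> q e'"
    "e \<in> fibre C q \<Longrightarrow> \<Phi> q (fscale C q c e) = c *\<^sub>R \<Phi> q e" if "q \<in> N" for q e e' c
    using \<Phi> that unfolding local_trivialization_def by blast+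
  have "local_trivialization A G N n (\<lambda>q c. \<Phi> q (R i q c))"
    unfolding local_trivialization_def
  proof (intro conjI ballI allI impI)
    fix q assume q: "q \<in> N"
    then have qi: "q \<in> U i" using N by blast
    show "bij_betw (\<lambda>c. \<Phi> q (R i q c)) (fibre G q) {x. \<forall>k\<ge>n. x k = 0}"
      using bij_betw_trans[OF bij[OF qi] fibre(1)[OF q]] by (simp add: comp_def)
    fix e e' assume e: "e \<in> fibre G q"
    show "fscale G q c e \<in> fibre G q" for c
      using scale e .
    show "\<Phi> q (R i q (fscale G q c e)) = c *\<^sub>R \<Phi> q (R i q e)" for c
      using R_scale[OF qi e] fibre(3)[OF q R_fibre[OF qi e]] by simp
    assume e': "e' \<in> fibre G q"
    show "fadd G q e e' \<in> fibre G q"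
      using add e e' .
    show "\<Phi> q (R i q (fadd G q e e')) = \<Phi> q (R i q e) + \<Phi> q (R i q e')"
      using R_add[OF qi e e'] fibre(2)[OF q R_fibre[OF qi e] R_fibre[OF qi e']] by simp
  next
    fix V and \<sigma> assume V: "open V \<and> V \<subseteq> N"
    then have sec: "smooth_section C V \<sigma>' \<longleftrightarrow>
        (\<forall>q\<in>V. \<sigma>' q \<in> fibre C q) \<and> (\<forall>k<n. smooth_on A V (\<lambda>q. \<Phi> q (\<sigma>' q) k))" for \<sigma>'
      using \<Phi> unfolding local_trivialization_def by blast
    have VU: "V \<subseteq> U i" "V \<inter> U i = V" using V N by blast+
    show "smooth_section G V \<sigma> \<longleftrightarrow>
        (\<forall>q\<in>V. \<sigma> q \<in> fibre G q) \<and> (\<forall>k<n. smooth_on A V (\<lambda>q. \<Phi> q (R i q (\<sigma> q)) k))"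
    proof (intro iffI conjI ballI)
      assume "smooth_section G V \<sigma>"
      then show "\<sigma> q \<in> fibre G q" if "q \<in> V" for q
        using that by (rule section_fibre)
      show "\<forall>k<n. smooth_on A V (\<lambda>q. \<Phi> q (R i q (\<sigma> q)) k)"
        using section_R[OF \<open>smooth_section G V \<sigma>\<close>, of i] sec VU(2) by auto
    next
      assume *: "(\<forall>q\<in>V. \<sigma> q \<in> fibre G q) \<and> (\<forall>k<n. smooth_on A V (\<lambda>q. \<Phi> q (R i q (\<sigma> q)) k))"
      then have "smooth_section C V (\<lambda>q. R i q (\<sigma> q))"
        using sec R_fibre VU(1) by blast
      then show "smooth_section G V \<sigma>"
        using section_single[of V i \<sigma>] V VU(1) * by blast
    qed
  qed
  then show "\<exists>N n \<Phi>. open N \<and> p \<in> N \<and> N \<subseteq> UNIV \<and> local_trivialization A G N n \<Phi>"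
    using N by blast
next
  fix V \<sigma> assume V: "open V \<and> V \<subseteq> (UNIV :: 'm set)"
  show "smooth_section G V \<sigma> \<longleftrightarrow>
      (\<forall>p\<in>V. \<exists>N. open N \<and> p \<in> N \<and> N \<subseteq> V \<and> smooth_section G N \<sigma>)" (is "_ \<longleftrightarrow> ?loc")
  proof
    show "smooth_section G V \<sigma> \<Longrightarrow> ?loc"
      using V by blast
    assume loc: ?loc
    have "smooth_section C (V \<inter> U i) (\<lambda>p. R i p (\<sigma> p))" for i
    proof (rule model_sheaf)
      fix p assume p: "p \<in> V \<inter> U i"
      then obtain N where N: "open N" "p \<in> N" "N \<subseteq> V" "smooth_section G N \<sigma>"
        using loc by blast
      show "\<exists>N. open N \<and> p \<in> N \<and> N \<subseteq> V \<inter> U i \<and> smooth_section C N (\<lambda>p. R i p (\<sigma> p))"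
        by (rule exI[of _ "N \<inter> U i"]) (use N p open_U section_R[OF N(4), of i] in auto)
    qed (use V open_U in auto)
    moreover have "\<forall>p\<in>V. \<sigma> p \<in> fibre G p"
      using loc section_fibre by blast
    ultimately show "smooth_section G V \<sigma>"
      by (simp add: section_iff)
  qed
qed

lemma glued_anchor_smooth:
  assumes "open V" "smooth_section G V \<sigma>"
  shows "smooth_vector_field A V (\<lambda>p. anchor G p (\<sigma> p))"
proof (rule smooth_vector_field_local[OF manifold])
  fix p assume p: "p \<in> V"
  obtain i where i: "p \<in> U i" by (rule covered)
  have "smooth_vector_field A (V \<inter> U i) (\<lambda>q. anchor C q (R i q (\<sigma> q)))"
    using courant_algebroid_anchor_smooth[OF model _ _ section_R[OF assms(2), of i]] assms(1) open_U
    by blast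
  then have "smooth_vector_field A (V \<inter> U i) (\<lambda>q. anchor G q (\<sigma> q))"
    by (rule smooth_vector_field_cong[OF manifold])
      (use R_anchor section_fibre[OF assms(2)] in auto)
  then show "\<exists>N. open N \<and> p \<in> N \<and> smooth_vector_field A N (\<lambda>q. anchor G q (\<sigma> q))"
    using p i assms(1) open_U by blast
qed

lemma pairing_smooth_on_chart:
  assumes "open V" "smooth_section G V \<sigma>" "smooth_section G V \<sigma>'"
  shows "smooth_on A (V \<inter> U i) (\<lambda>q. pairing C q (R i q (\<sigma> q)) (R i q (\<sigma>' q)))"
    and "smooth_on A (V \<inter> U i) (\<lambda>q. pairing G q (\<sigma> q) (\<sigma>' q))"
proof -
  show *: "smooth_on A (V \<inter> U i) (\<lambda>q. pairing C q (R i q (\<sigma> q)) (R i q (\<sigma>' q)))"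
    using courant_algebroid_pairing_smooth[OF model _ _ section_R[OF assms(2), of i]
        section_R[OF assms(3), of i]] assms(1) open_U
    by blast
  show "smooth_on A (V \<inter> U i) (\<lambda>q. pairing G q (\<sigma> q) (\<sigma>' q))"
    by (rule smooth_on_cong[OF manifold _ *])
      (use R_pairing section_fibre[OF assms(2)] section_fibre[OF assms(3)] assms(1) open_U in auto)
qed

lemma glued_pairing_smooth:
  assumes "open V" "smooth_section G V \<sigma>" "smooth_section G V \<sigma>'"
  shows "smooth_on A V (\<lambda>p. pairing G p (\<sigma> p) (\<sigma>' p))"
proof (rule smooth_on_local[OF manifold])
  fix p assume p: "p \<in> V"
  obtain i where i: "p \<in> U i" by (rule covered)
  show "\<exists>N. open N \<and> p \<in> N \<and> smooth_on A N (\<lambda>p. pairing G p (\<sigma> p) (\<sigma>' p))"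
    by (rule exI[of _ "V \<inter> U i"])
      (use p i assms(1) open_U pairing_smooth_on_chart(2)[OF assms] in auto)
qed

text \<open>The two functions being differentiated agree only over \<open>U i\<close>. The anchor of
  \<open>c\<close> is a tangent vector at \<open>p\<close>, so it sees only the germ, once both
  functions are known to be smooth near \<open>p\<close>.\<close>

lemma anchor_pairing_chart:
  assumes "smooth_section G UNIV \<sigma>" "smooth_section G UNIV \<sigma>'" "p \<in> U i" "c \<in> fibre G p"
  shows "anchor G p c (\<lambda>q. pairing G q (\<sigma> q) (\<sigma>' q))
    = anchor C p (R i p c) (\<lambda>q. pairing C q (R i q (\<sigma> q)) (R i q (\<sigma>' q)))"
  unfolding R_anchor[OF assms(3,4)]
proof (rule tangent_vector_local[of "anchor G p c" A p "U i"])
  show "anchor G p c \<in> tangent_space A p"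
    using courant_algebroid_anchor(1)[OF model assms(3) R_fibre[OF assms(3,4)]]
    by (simp add: R_anchor assms)
qed (use assms open_U pairing_smooth_on_chart[of UNIV \<sigma> \<sigma>' i] section_fibre R_pairing in auto)

text \<open>Closure of smooth sections under the operations is not among the bundle axioms; it
  follows from linearity of the coordinates in a local trivialization. It is required for the
  bilinearity of the glued bracket, where sums and multiples of sections appear as arguments of the
  bracket.\<close>

lemma model_linear_combination:
  assumes V: "open V" "V \<subseteq> U i" and \<sigma>: "smooth_section C V \<sigma>" and \<sigma>': "smooth_section C V \<sigma>'"
  shows "smooth_section C V (\<lambda>q. fadd C q (\<sigma> q) (\<sigma>' q))"
    and "smooth_section C V (\<lambda>q. fscale C q r (\<sigma> q))"
proof -
  have *: "\<exists>N. open N \<and> p \<in> N \<and> N \<subseteq> V \<and> smooth_section C N (\<lambda>q. fadd C q (\<sigma> q) (\<sigma>' q)) \<and>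
      smooth_section C N (\<lambda>q. fscale C q r (\<sigma> q))" if p: "p \<in> V" for p
  proof -
    obtain N n \<Phi> where N: "open N" "p \<in> N" "N \<subseteq> U i" and \<Phi>: "local_trivialization A C N n \<Phi>"
      using courant_algebroid_bundle[OF model[of i]] p V unfolding vector_bundle_def by blast
    let ?N = "N \<inter> V"
    have op: "open ?N" using N V by blast
    have sec: "smooth_section C ?N \<tau> \<longleftrightarrow>
        (\<forall>q\<in>?N. \<tau> q \<in> fibre C q) \<and> (\<forall>k<n. smooth_on A ?N (\<lambda>q. \<Phi> q (\<tau> q) k))" for \<tau>
      using \<Phi> op unfolding local_trivialization_def by blast
    have s: "\<sigma> q \<in> fibre C q" "\<sigma>' q \<in> fibre C q" if "q \<in> ?N" for q
      using sec[of \<sigma>] sec[of \<sigma>'] that model_restrict[OF \<sigma>, of ?N] model_restrict[OF \<sigma>', of ?N]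
      by auto
    have sm: "smooth_on A ?N (\<lambda>q. \<Phi> q (\<sigma> q) k)" "smooth_on A ?N (\<lambda>q. \<Phi> q (\<sigma>' q) k)" if "k < n" for k
      using sec[of \<sigma>] sec[of \<sigma>'] that model_restrict[OF \<sigma>, of ?N] model_restrict[OF \<sigma>', of ?N]
      by auto
    have fib: "fadd C q e e' \<in> fibre C q" "\<Phi> q (fadd C q e e') = \<Phi> q e + \<Phi> q e'"
      "fscale C q r e \<in> fibre C q" "\<Phi> q (fscale C q r e) = r *\<^sub>R \<Phi> q e"
      if "q \<in> ?N" "e \<in> fibre C q" "e' \<in> fibre C q" for q e e'
      using \<Phi> that unfolding local_trivialization_def by blast+
    have "smooth_on A ?N (\<lambda>q. \<Phi> q (fadd C q (\<sigma> q) (\<sigma>' q)) k)" if "k < n" for k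
      by (rule smooth_on_cong[OF manifold op smooth_on_add[OF manifold op sm[OF that]]])
        (use s fib(2) in simp)
    moreover have "smooth_on A ?N (\<lambda>q. \<Phi> q (fscale C q r (\<sigma> q)) k)" if "k < n" for k
      by (rule smooth_on_cong[OF manifold op smooth_on_mult_const[OF manifold op sm(1)[OF that], of r]])
        (use fib(4)[OF _ s(1) s(2)] in \<open>simp add: scaleR_fun_def\<close>)
    ultimately have "smooth_section C ?N (\<lambda>q. fadd C q (\<sigma> q) (\<sigma>' q))"
        "smooth_section C ?N (\<lambda>q. fscale C q r (\<sigma> q))"
      unfolding sec using fib(1,3)[OF _ s(1) s(2)] by blast+
    then show ?thesis
      using op N(2) p by (intro exI[of _ ?N]) simp
  qed
  show "smooth_section C V (\<lambda>q. fadd C q (\<sigma> q) (\<sigma>' q))"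
    by (rule model_sheaf[OF V]; drule *; elim exE conjE; intro exI conjI; assumption)
  show "smooth_section C V (\<lambda>q. fscale C q r (\<sigma> q))"
    by (rule model_sheaf[OF V]; drule *; elim exE conjE; intro exI conjI; assumption)
qed

lemma glued_linear_combination:
  assumes \<sigma>: "smooth_section G V \<sigma>" and \<sigma>': "smooth_section G V \<sigma>'" and V: "open V"
  shows "smooth_section G V (\<lambda>q. fadd G q (\<sigma> q) (\<sigma>' q))"
    and "smooth_section G V (\<lambda>q. fscale G q r (\<sigma> q))"
proof -
  note fibs = section_fibre[OF \<sigma>] section_fibre[OF \<sigma>']
  have V_U: "open (V \<inter> U i)" "V \<inter> U i \<subseteq> U i" for i
    using V open_U by auto
  note comb = model_linear_combination[OF V_U section_R[OF \<sigma>] section_R[OF \<sigma>']]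
  show "smooth_section G V (\<lambda>q. fadd G q (\<sigma> q) (\<sigma>' q))"
    unfolding section_iff
  proof (intro conjI ballI allI)
    show "smooth_section C (V \<inter> U i) (\<lambda>p. R i p (fadd G p (\<sigma> p) (\<sigma>' p)))" for i
      by (rule model_cong[OF V_U(1) comb(1)]) (use fibs R_add in auto)
  qed (use fibs add in auto)
  show "smooth_section G V (\<lambda>q. fscale G q r (\<sigma> q))"
    unfolding section_iff
  proof (intro conjI ballI allI)
    show "smooth_section C (V \<inter> U i) (\<lambda>p. R i p (fscale G p r (\<sigma> p)))" for i
      by (rule model_cong[OF V_U(1) comb(2)]) (use fibs R_scale in auto)
  qed (use fibs scale in auto)
qed

lemma glued_bracket_smooth:
  assumes \<sigma>: "smooth_section G UNIV \<sigma>" and \<sigma>': "smooth_section G UNIV \<sigma>'"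
  shows "smooth_section G UNIV (bracket G \<sigma> \<sigma>')"
  unfolding section_iff
proof (intro conjI ballI allI)
  show "smooth_section C (UNIV \<inter> U i) (\<lambda>p. R i p (bracket G \<sigma> \<sigma>' p))" for i
    using model_cong[OF open_U courant_algebroid_bracket_smooth[OF model section_R_UNIV[OF \<sigma>]
          section_R_UNIV[OF \<sigma>']]] R_bracket[OF \<sigma> \<sigma>', of _ i]
    by simp
qed (rule bracket_fibre[OF \<sigma> \<sigma>'])

text \<open>The working form of \<open>R_bracket\<close>: the chart expressions of the arguments may
  be replaced by any model sections that coincide with them over \<open>U i\<close>, for example a
  sum of sections by the sum of their chart expressions.\<close>

lemma R_bracket_cong:
  assumes "smooth_section G UNIV \<sigma>" "smooth_section G UNIV \<sigma>'" "p \<in> U i"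
    and "smooth_section C (U i) \<tau>" "smooth_section C (U i) \<tau>'"
    and "\<And>q. q \<in> U i \<Longrightarrow> R i q (\<sigma> q) = \<tau> q" "\<And>q. q \<in> U i \<Longrightarrow> R i q (\<sigma>' q) = \<tau>' q"
  shows "R i p (bracket G \<sigma> \<sigma>' p) = bracket C \<tau> \<tau>' p"
  using R_bracket[OF assms(1-3)] courant_algebroid_bracket_cong[OF model assms(4-7,3)] by simp

text \<open>Identities in a fibre of \<open>G\<close> are tested after applying
  \<open>R i p\<close>, which is injective; scalar identities are rewritten through
  \<open>R_anchor\<close> and \<open>R_pairing\<close>. In both cases the corresponding axiom of the
  model over \<open>U i\<close> remains.\<close>

lemma glued_courant_algebroid: "courant_algebroid A UNIV G"
  unfolding courant_algebroid_def
proof (intro conjI allI ballI impI; (elim conjE)?)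
  show "vector_bundle A UNIV G"
    by (rule glued_vector_bundle)
next
  fix p :: 'm and e assume e: "e \<in> fibre G p"
  obtain i where i: "p \<in> U i" by (rule covered)
  note R = R_fibre[OF i] and anchor = courant_algebroid_anchor[OF model i R]
    and pairing = courant_algebroid_pairing[OF model i R R] and RR = R_anchor[OF i, symmetric]
    R_pairing[OF i, symmetric] R_add[OF i] R_scale[OF i] and [simp] = add scale
  show "anchor G p e \<in> tangent_space A p"
    using anchor(1)[OF e] e by (simp add: RR)
  show "anchor G p (fscale G p c e) = c *\<^sub>R anchor G p e" for c
    using anchor(3)[OF e] e by (simp add: RR)
  \<comment> \<open>The zero of a fibre is expressed as 0 times an element. Surjectivity of
    \<open>R i p\<close> makes the hypothesis on \<open>G\<close> available for every vector of the
    model fibre.\<close>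
  show "e = fscale G p 0 e" if e0: "\<forall>e'\<in>fibre G p. pairing G p e e' = 0"
  proof (rule R_cancel[OF i e])
    show "R i p e = R i p (fscale G p 0 e)"
      unfolding R_scale[OF i e]
    proof (rule courant_algebroid_nondegenerate[OF model i R[OF e]])
      fix e' assume "e' \<in> fibre C p"
      then obtain c where "c \<in> fibre G p" "R i p c = e'"
        using R_surj[OF i] by blast
      then show "pairing C p (R i p e) e' = 0"
        using R_pairing[OF i e, of c] e0 by simp
    qed
  qed (use e in simp)
  fix e' assume e': "e' \<in> fibre G p"
  show "anchor G p (fadd G p e e') = anchor G p e + anchor G p e'"
    using anchor(2)[OF e R[OF e']] e e' by (simp add: RR)
  show "pairing G p e e' = pairing G p e' e"
    using pairing(1)[OF e e'] e e' by (simp add: RR)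
  show "pairing G p (fscale G p c e) e' = c * pairing G p e e'" for c
    using pairing(3)[OF e e'] e e' by (simp add: RR)
  show "pairing G p (fadd G p e e') e'' = pairing G p e e'' + pairing G p e' e''"
    if e'': "e'' \<in> fibre G p" for e''
    using pairing(2)[OF e e' R[OF e'']] e e' e'' by (simp add: RR)
next
  fix \<sigma> \<sigma>' p assume \<sigma>: "smooth_section G UNIV \<sigma>" and \<sigma>': "smooth_section G UNIV \<sigma>'"
  show "smooth_section G UNIV (bracket G \<sigma> \<sigma>')"
    by (rule glued_bracket_smooth[OF \<sigma> \<sigma>'])
  \<comment> \<open>The base is the whole manifold, so sections that agree over it are equal as
    functions.\<close>
  show "bracket G \<tau> \<tau>' p = bracket G \<sigma> \<sigma>' p" if "\<forall>q\<in>UNIV. \<tau> q = \<sigma> q \<and> \<tau>' q = \<sigma>' q" for \<tau> \<tau>'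
    using that by (metis UNIV_I ext)
  obtain i where i: "p \<in> U i" by (rule covered)
  note f = section_fibre[OF _ UNIV_I] and s = section_R_UNIV and b = glued_bracket_smooth
  note bil = courant_algebroid_bracket_bilinear[OF model i s s s]
  note lin = model_linear_combination[OF open_U order_refl s s]
  note glin = glued_linear_combination[OF _ _ open_UNIV]
  note [simp] = bracket_fibre
  show "bracket G (\<lambda>q. fscale G q c (\<sigma> q)) \<sigma>' p = fscale G p c (bracket G \<sigma> \<sigma>' p)" for c
  proof (rule R_cancel[OF i])
    have "R i p (bracket G (\<lambda>q. fscale G q c (\<sigma> q)) \<sigma>' p) =
        bracket C (\<lambda>q. fscale C q c (R i q (\<sigma> q))) (\<lambda>q. R i q (\<sigma>' q)) p"
      by (rule R_bracket_cong[OF glin(2)[OF \<sigma> \<sigma>] \<sigma>' i lin(2)[OF \<sigma> \<sigma>] s[OF \<sigma>']])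
        (use R_scale f[OF \<sigma>] in auto)
    then show "R i p (bracket G (\<lambda>q. fscale G q c (\<sigma> q)) \<sigma>' p) = R i p (fscale G p c (bracket G \<sigma> \<sigma>' p))"
      using bil(3)[OF \<sigma> \<sigma>' \<sigma>'] R_scale[OF i bracket_fibre[OF \<sigma> \<sigma>']] R_bracket[OF \<sigma> \<sigma>' i] by simp
  qed (use scale glin(2)[OF \<sigma> \<sigma>] \<sigma> \<sigma>' in auto)
  show "bracket G \<sigma> (\<lambda>q. fscale G q c (\<sigma>' q)) p = fscale G p c (bracket G \<sigma> \<sigma>' p)" for c
  proof (rule R_cancel[OF i])
    have "R i p (bracket G \<sigma> (\<lambda>q. fscale G q c (\<sigma>' q)) p) =
        bracket C (\<lambda>q. R i q (\<sigma> q)) (\<lambda>q. fscale C q c (R i q (\<sigma>' q))) p"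
      by (rule R_bracket_cong[OF \<sigma> glin(2)[OF \<sigma>' \<sigma>'] i s[OF \<sigma>] lin(2)[OF \<sigma>' \<sigma>']])
        (use R_scale f[OF \<sigma>'] in auto)
    then show "R i p (bracket G \<sigma> (\<lambda>q. fscale G q c (\<sigma>' q)) p) = R i p (fscale G p c (bracket G \<sigma> \<sigma>' p))"
      using bil(4)[OF \<sigma> \<sigma>' \<sigma>'] R_scale[OF i bracket_fibre[OF \<sigma> \<sigma>']] R_bracket[OF \<sigma> \<sigma>' i] by simp
  qed (use scale glin(2)[OF \<sigma>' \<sigma>'] \<sigma> \<sigma>' in auto)
  show "pairing G p (bracket G \<sigma> \<sigma> p) (\<sigma>' p)
      = 1/2 * anchor G p (\<sigma>' p) (\<lambda>q. pairing G q (\<sigma> q) (\<sigma> q))"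
    using courant_algebroid_bracket_pairing(1)[OF model i s[OF \<sigma>] s[OF \<sigma>']]
      anchor_pairing_chart[OF \<sigma> \<sigma> i f[OF \<sigma>']] R_bracket[OF \<sigma> \<sigma> i]
      R_pairing[OF i bracket_fibre[OF \<sigma> \<sigma>] f[OF \<sigma>']]
    by simp
  fix \<sigma>'' assume \<sigma>'': "smooth_section G UNIV \<sigma>''"
  show "anchor G p (\<sigma> p) (\<lambda>q. pairing G q (\<sigma>' q) (\<sigma>'' q))
      = pairing G p (bracket G \<sigma> \<sigma>' p) (\<sigma>'' p) + pairing G p (\<sigma>' p) (bracket G \<sigma> \<sigma>'' p)"
    using courant_algebroid_bracket_pairing(2)[OF model i s[OF \<sigma>] s[OF \<sigma>'] s[OF \<sigma>'']]
      anchor_pairing_chart[OF \<sigma>' \<sigma>'' i f[OF \<sigma>]] R_bracket[OF \<sigma> \<sigma>' i] R_bracket[OF \<sigma> \<sigma>'' i]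
      R_pairing[OF i bracket_fibre[OF \<sigma> \<sigma>'] f[OF \<sigma>'']]
      R_pairing[OF i f[OF \<sigma>'] bracket_fibre[OF \<sigma> \<sigma>'']]
    by simp
  show "bracket G (\<lambda>q. fadd G q (\<sigma> q) (\<sigma>' q)) \<sigma>'' p
      = fadd G p (bracket G \<sigma> \<sigma>'' p) (bracket G \<sigma>' \<sigma>'' p)"
  proof (rule R_cancel[OF i])
    have "R i p (bracket G (\<lambda>q. fadd G q (\<sigma> q) (\<sigma>' q)) \<sigma>'' p) =
        bracket C (\<lambda>q. fadd C q (R i q (\<sigma> q)) (R i q (\<sigma>' q))) (\<lambda>q. R i q (\<sigma>'' q)) p"
      by (rule R_bracket_cong[OF glin(1)[OF \<sigma> \<sigma>'] \<sigma>'' i lin(1)[OF \<sigma> \<sigma>'] s[OF \<sigma>'']])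
        (use R_add f[OF \<sigma>] f[OF \<sigma>'] in auto)
    then show "R i p (bracket G (\<lambda>q. fadd G q (\<sigma> q) (\<sigma>' q)) \<sigma>'' p) =
        R i p (fadd G p (bracket G \<sigma> \<sigma>'' p) (bracket G \<sigma>' \<sigma>'' p))"
      using bil(1)[OF \<sigma> \<sigma>' \<sigma>''] R_add[OF i bracket_fibre[OF \<sigma> \<sigma>''] bracket_fibre[OF \<sigma>' \<sigma>'']]
        R_bracket[OF \<sigma> \<sigma>'' i] R_bracket[OF \<sigma>' \<sigma>'' i]
      by simp
  qed (use add glin(1)[OF \<sigma> \<sigma>'] \<sigma> \<sigma>' \<sigma>'' in auto)
  show "bracket G \<sigma> (\<lambda>q. fadd G q (\<sigma>' q) (\<sigma>'' q)) p
      = fadd G p (bracket G \<sigma> \<sigma>' p) (bracket G \<sigma> \<sigma>'' p)"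
  proof (rule R_cancel[OF i])
    have "R i p (bracket G \<sigma> (\<lambda>q. fadd G q (\<sigma>' q) (\<sigma>'' q)) p) =
        bracket C (\<lambda>q. R i q (\<sigma> q)) (\<lambda>q. fadd C q (R i q (\<sigma>' q)) (R i q (\<sigma>'' q))) p"
      by (rule R_bracket_cong[OF \<sigma> glin(1)[OF \<sigma>' \<sigma>''] i s[OF \<sigma>] lin(1)[OF \<sigma>' \<sigma>'']])
        (use R_add f[OF \<sigma>'] f[OF \<sigma>''] in auto)
    then show "R i p (bracket G \<sigma> (\<lambda>q. fadd G q (\<sigma>' q) (\<sigma>'' q)) p) =
        R i p (fadd G p (bracket G \<sigma> \<sigma>' p) (bracket G \<sigma> \<sigma>'' p))"
      using bil(2)[OF \<sigma> \<sigma>' \<sigma>''] R_add[OF i bracket_fibre[OF \<sigma> \<sigma>'] bracket_fibre[OF \<sigma> \<sigma>'']]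
        R_bracket[OF \<sigma> \<sigma>' i] R_bracket[OF \<sigma> \<sigma>'' i]
      by simp
  qed (use add glin(1)[OF \<sigma>' \<sigma>''] \<sigma> \<sigma>' \<sigma>'' in auto)
  show "bracket G \<sigma> (bracket G \<sigma>' \<sigma>'') p
      = fadd G p (bracket G (bracket G \<sigma> \<sigma>') \<sigma>'' p) (bracket G \<sigma>' (bracket G \<sigma> \<sigma>'') p)"
  proof (rule R_cancel[OF i])
    \<comment> \<open>The inner brackets are smooth sections again, of \<open>G\<close> globally and
      of the model over \<open>U i\<close>, so the outer brackets can be evaluated in the same
      chart.\<close>
    note cb = courant_algebroid_bracket_smooth[OF model s s]
    have "R i p (bracket G \<sigma> (bracket G \<sigma>' \<sigma>'') p) = bracket C (\<lambda>q. R i q (\<sigma> q))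
        (bracket C (\<lambda>q. R i q (\<sigma>' q)) (\<lambda>q. R i q (\<sigma>'' q))) p"
      by (rule R_bracket_cong[OF \<sigma> b[OF \<sigma>' \<sigma>''] i s[OF \<sigma>] cb[OF \<sigma>' \<sigma>'']])
        (use R_bracket[OF \<sigma>' \<sigma>''] in auto)
    moreover have "R i p (bracket G (bracket G \<sigma> \<sigma>') \<sigma>'' p) =
        bracket C (bracket C (\<lambda>q. R i q (\<sigma> q)) (\<lambda>q. R i q (\<sigma>' q))) (\<lambda>q. R i q (\<sigma>'' q)) p"
      by (rule R_bracket_cong[OF b[OF \<sigma> \<sigma>'] \<sigma>'' i cb[OF \<sigma> \<sigma>'] s[OF \<sigma>'']])
        (use R_bracket[OF \<sigma> \<sigma>'] in auto)
    moreover have "R i p (bracket G \<sigma>' (bracket G \<sigma> \<sigma>'') p) = bracket C (\<lambda>q. R i q (\<sigma>' q))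
        (bracket C (\<lambda>q. R i q (\<sigma> q)) (\<lambda>q. R i q (\<sigma>'' q))) p"
      by (rule R_bracket_cong[OF \<sigma>' b[OF \<sigma> \<sigma>''] i s[OF \<sigma>'] cb[OF \<sigma> \<sigma>'']])
        (use R_bracket[OF \<sigma> \<sigma>''] in auto)
    ultimately show "R i p (bracket G \<sigma> (bracket G \<sigma>' \<sigma>'') p) = R i p (fadd G p
        (bracket G (bracket G \<sigma> \<sigma>') \<sigma>'' p) (bracket G \<sigma>' (bracket G \<sigma> \<sigma>'') p))"
      using bil(5)[OF \<sigma> \<sigma>' \<sigma>''] R_add[OF i bracket_fibre[OF b[OF \<sigma> \<sigma>'] \<sigma>''] bracket_fibre[OF \<sigma>' b[OF \<sigma> \<sigma>'']]]
      by simp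
  qed (use add b \<sigma> \<sigma>' \<sigma>'' in auto)
qed (use glued_anchor_smooth glued_pairing_smooth in auto)

end

text \<open>Both algebroids are glued from the same model over the same cover, and in every chart
  \<open>F\<close> is the automorphism \<open>\<Lambda> i\<close> of the model. Each property of
  \<open>F\<close> is thus conjugated by the charts to the same property of
  \<open>\<Lambda> i\<close>.\<close>

lemma courant_gluing_isomorphism:
  assumes G: "courant_gluing A U C G R" and G': "courant_gluing A U C G' R'"
    and \<Lambda>: "\<And>i. courant_isomorphism A (U i) C C (\<Lambda> i)"
    and F_fibre: "\<And>p c. c \<in> fibre G' p \<Longrightarrow> F p c \<in> fibre G p"
    and F: "\<And>i p c. p \<in> U i \<Longrightarrow> c \<in> fibre G' p \<Longrightarrow> R i p (F p c) = \<Lambda> i p (R' i p c)"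
  shows "courant_isomorphism A UNIV G' G F"
proof -
  interpret G: courant_gluing A U C G R by fact
  interpret G': courant_gluing A U C G' R' by fact
  have bundle_iso: "bundle_isomorphism (U i) C C (\<Lambda> i)"
    and L_anchor: "p \<in> U i \<Longrightarrow> e \<in> fibre C p \<Longrightarrow> anchor C p (\<Lambda> i p e) = anchor C p e"
    and L_pairing: "p \<in> U i \<Longrightarrow> e \<in> fibre C p \<Longrightarrow> e' \<in> fibre C p \<Longrightarrow>
      pairing C p (\<Lambda> i p e) (\<Lambda> i p e') = pairing C p e e'"
    and L_bracket: "smooth_section C (U i) \<sigma> \<Longrightarrow> smooth_section C (U i) \<sigma>' \<Longrightarrow> p \<in> U i \<Longrightarrow>
      \<Lambda> i p (bracket C \<sigma> \<sigma>' p) = bracket C (\<lambda>q. \<Lambda> i q (\<sigma> q)) (\<lambda>q. \<Lambda> i q (\<sigma>' q)) p"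
    for i p e e' \<sigma> \<sigma>'
    using \<Lambda>[of i] unfolding courant_isomorphism_def by blast+
  have L_bij: "p \<in> U i \<Longrightarrow> bij_betw (\<Lambda> i p) (fibre C p) (fibre C p)"
    and L_add: "p \<in> U i \<Longrightarrow> e \<in> fibre C p \<Longrightarrow> e' \<in> fibre C p \<Longrightarrow>
      \<Lambda> i p (fadd C p e e') = fadd C p (\<Lambda> i p e) (\<Lambda> i p e')"
    and L_scale: "p \<in> U i \<Longrightarrow> e \<in> fibre C p \<Longrightarrow> \<Lambda> i p (fscale C p r e) = fscale C p r (\<Lambda> i p e)"
    and L_smooth: "open V \<Longrightarrow> V \<subseteq> U i \<Longrightarrow> (\<And>p. p \<in> V \<Longrightarrow> \<sigma> p \<in> fibre C p) \<Longrightarrow>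
      smooth_section C V \<sigma> \<longleftrightarrow> smooth_section C V (\<lambda>p. \<Lambda> i p (\<sigma> p))"
    for i p e e' r V \<sigma>
    using bundle_iso[of i] unfolding bundle_isomorphism_def by blast+
  \<comment> \<open>In a chart \<open>F p\<close> becomes \<open>\<Lambda> i p\<close> after
    \<open>R' i p\<close>, a composition of bijections. Cancelling the bijection
    \<open>R i p\<close> leaves \<open>F p\<close> bijective.\<close>
  have F_bij: "bij_betw (F p) (fibre G' p) (fibre G p)" for p
  proof -
    obtain i where i: "p \<in> U i" by (rule G.covered)
    have "bij_betw (\<Lambda> i p \<circ> R' i p) (fibre G' p) (fibre C p)"
      by (rule bij_betw_trans[OF G'.bij[OF i] L_bij[OF i]])
    then have *: "bij_betw (R i p \<circ> F p) (fibre G' p) (fibre C p)"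
      by (subst bij_betw_cong[of _ _ "\<Lambda> i p \<circ> R' i p"]) (simp_all add: F[OF i])
    show ?thesis
      by (rule bij_betw_comp_iff2[THEN iffD2, OF G.bij[OF i] _ *]) (use F_fibre in blast)
  qed
  have F_smooth: "smooth_section G' V \<sigma> \<longleftrightarrow> smooth_section G V (\<lambda>p. F p (\<sigma> p))"
    if V: "open V" and \<sigma>: "\<forall>p\<in>V. \<sigma> p \<in> fibre G' p" for V \<sigma>
  proof -
    have VU: "open (V \<inter> U i)" for i
      using V G.open_U by blast
    \<comment> \<open>Since \<open>L_smooth\<close> is an equivalence, smoothness of
      \<open>F\<close> and of its inverse are obtained together.\<close>
    have "smooth_section C (V \<inter> U i) (\<lambda>p. R' i p (\<sigma> p)) \<longleftrightarrow>
        smooth_section C (V \<inter> U i) (\<lambda>p. R i p (F p (\<sigma> p)))" for i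
    proof -
      have "smooth_section C (V \<inter> U i) (\<lambda>p. R' i p (\<sigma> p)) \<longleftrightarrow>
          smooth_section C (V \<inter> U i) (\<lambda>p. \<Lambda> i p (R' i p (\<sigma> p)))"
        by (rule L_smooth) (use VU \<sigma> G'.R_fibre in auto)
      also have "\<dots> \<longleftrightarrow> smooth_section C (V \<inter> U i) (\<lambda>p. R i p (F p (\<sigma> p)))"
        by (intro iffI; erule G.model_cong[OF VU]) (use F \<sigma> in auto)
      finally show ?thesis .
    qed
    then show ?thesis
      using \<sigma> F_fibre by (auto simp: G.section_iff G'.section_iff)
  qed
  show ?thesis
    unfolding courant_isomorphism_def bundle_isomorphism_def
  proof (intro conjI ballI allI impI)
    show "courant_algebroid A UNIV G'" "courant_algebroid A UNIV G"
      by (rule G'.glued_courant_algebroid G.glued_courant_algebroid)+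
    show "smooth_section G' V \<sigma> \<longleftrightarrow> smooth_section G V (\<lambda>p. F p (\<sigma> p))"
      if "open V \<and> V \<subseteq> UNIV \<and> (\<forall>p\<in>V. \<sigma> p \<in> fibre G' p)" for V \<sigma>
      using F_smooth that by blast
    fix p
    obtain i where i: "p \<in> U i" by (rule G.covered)
    show "bij_betw (F p) (fibre G' p) (fibre G p)"
      by (rule F_bij)
    show "F p (bracket G' \<sigma> \<sigma>' p) = bracket G (\<lambda>q. F q (\<sigma> q)) (\<lambda>q. F q (\<sigma>' q)) p"
      if "smooth_section G' UNIV \<sigma> \<and> smooth_section G' UNIV \<sigma>'" for \<sigma> \<sigma>'
    proof (rule G.R_cancel[OF i])
      have s: "smooth_section G' UNIV \<sigma>" "smooth_section G' UNIV \<sigma>'"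
        using that by auto
      \<comment> \<open>The right-hand bracket can be evaluated in a chart only for global smooth
        sections of \<open>G\<close>.\<close>
      have Fs: "smooth_section G UNIV (\<lambda>q. F q (\<sigma> q))" "smooth_section G UNIV (\<lambda>q. F q (\<sigma>' q))"
        using F_smooth[OF open_UNIV, THEN iffD1] G'.section_fibre[OF s(1)] G'.section_fibre[OF s(2)] s
        by blast+
      have L: "smooth_section C (U i) (\<lambda>q. \<Lambda> i q (R' i q (\<tau> q)))"
        if "smooth_section G' UNIV \<tau>" for \<tau>
        using L_smooth[of "U i" i "\<lambda>q. R' i q (\<tau> q)"] G'.section_R_UNIV[OF that, of i] G.open_U
          G'.R_fibre G'.section_fibre[OF that]
        by auto
      show "F p (bracket G' \<sigma> \<sigma>' p) \<in> fibre G p"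
        using F_fibre G'.bracket_fibre s by blast
      show "bracket G (\<lambda>q. F q (\<sigma> q)) (\<lambda>q. F q (\<sigma>' q)) p \<in> fibre G p"
        using G.bracket_fibre Fs by blast
      have "R i p (F p (bracket G' \<sigma> \<sigma>' p)) = \<Lambda> i p (bracket C (\<lambda>q. R' i q (\<sigma> q)) (\<lambda>q. R' i q (\<sigma>' q)) p)"
        using F[OF i G'.bracket_fibre[OF s]] G'.R_bracket[OF s i] by simp
      also have "\<dots> = bracket C (\<lambda>q. \<Lambda> i q (R' i q (\<sigma> q))) (\<lambda>q. \<Lambda> i q (R' i q (\<sigma>' q))) p"
        by (rule L_bracket[OF G'.section_R_UNIV[OF s(1)] G'.section_R_UNIV[OF s(2)] i])
      also have "\<dots> = R i p (bracket G (\<lambda>q. F q (\<sigma> q)) (\<lambda>q. F q (\<sigma>' q)) p)"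
        by (rule G.R_bracket_cong[OF Fs i L[OF s(1)] L[OF s(2)], symmetric])
          (use F G'.section_fibre s in auto)
      finally show "R i p (F p (bracket G' \<sigma> \<sigma>' p))
          = R i p (bracket G (\<lambda>q. F q (\<sigma> q)) (\<lambda>q. F q (\<sigma>' q)) p)" .
    qed
    fix e assume e: "e \<in> fibre G' p"
    note Fe = F_fibre[OF e] and Re = G'.R_fibre[OF i e]
    show "anchor G p (F p e) = anchor G' p e"
      using G.R_anchor[OF i Fe] G'.R_anchor[OF i e] F[OF i e] L_anchor[OF i Re] by simp
    show "F p (fscale G' p c e) = fscale G p c (F p e)" for c
    proof (rule G.R_cancel[OF i])
      show "R i p (F p (fscale G' p c e)) = R i p (fscale G p c (F p e))"
        using F[OF i G'.scale[OF e]] G'.R_scale[OF i e] G.R_scale[OF i Fe] F[OF i e] L_scale[OF i Re]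
        by simp
    qed (use F_fibre G'.scale G.scale e in auto)
    fix e' assume e': "e' \<in> fibre G' p"
    note Fe' = F_fibre[OF e'] and Re' = G'.R_fibre[OF i e']
    show "pairing G p (F p e) (F p e') = pairing G' p e e'"
      using G.R_pairing[OF i Fe Fe'] G'.R_pairing[OF i e e'] F[OF i e] F[OF i e'] L_pairing[OF i Re Re']
      by simp
    show "F p (fadd G' p e e') = fadd G p (F p e) (F p e')"
    proof (rule G.R_cancel[OF i])
      show "R i p (F p (fadd G' p e e')) = R i p (fadd G p (F p e) (F p e'))"
        using F[OF i G'.add[OF e e']] G'.R_add[OF i e e'] G.R_add[OF i Fe Fe'] F[OF i e] F[OF i e']
          L_add[OF i Re Re']
        by simp
    qed (use F_fibre G'.add G.add e e' in auto)
  qed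
qed

section \<open>The standard transitive Courant algebroid\<close>

lemma std_courant_simps [simp]:
  "fibre (std_courant A lb ip) = std_fibre A"
  "fadd (std_courant A lb ip) = (\<lambda>p e e'. e + e')"
  "fscale (std_courant A lb ip) = (\<lambda>p c e. c *\<^sub>R e)"
  "anchor (std_courant A lb ip) = (\<lambda>p e. fst e)"
  "pairing (std_courant A lb ip) = (\<lambda>p. std_pairing ip)"
  by (simp_all add: std_courant_def)

lemma std_section_iff: "smooth_section (std_courant A lb ip) V e \<longleftrightarrow>
    smooth_vector_field A V (\<lambda>p. fst (e p)) \<and> smooth_map_on A V (\<lambda>p. fst (snd (e p))) \<and>
    smooth_form1 A V (\<lambda>p. snd (snd (e p)))"
  by (simp add: std_courant_def)

lemma std_fibre_iff: "(v, a, \<xi>) \<in> std_fibre A p \<longleftrightarrow> v \<in> tangent_space A p \<and> \<xi> \<in> cotangent_space A p"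
  by (simp add: std_fibre_def)

lemma std_section_fibre: "smooth_section (std_courant A lb ip) V e \<Longrightarrow> p \<in> V \<Longrightarrow> e p \<in> std_fibre A p"
  by (auto simp: std_section_iff std_fibre_def mem_Times_iff smooth_vector_field_def smooth_form1_def)

lemma std_section_subset:
  "smooth_section (std_courant A lb ip) V e \<Longrightarrow> V' \<subseteq> V \<Longrightarrow> smooth_section (std_courant A lb ip) V' e"
  by (auto simp: std_section_iff intro: smooth_vector_field_subset smooth_map_on_subset
      smooth_form1_subset)

lemma std_section_cong:
  assumes "smooth_manifold A" "open V" "smooth_section (std_courant A lb ip) V e"
    and "\<And>p. p \<in> V \<Longrightarrow> e p = e' p"
  shows "smooth_section (std_courant A lb ip) V e'"
  unfolding std_section_iff
proof (intro conjI)
  show "smooth_vector_field A V (\<lambda>p. fst (e' p))"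
    by (rule smooth_vector_field_cong[OF assms(1), of _ "\<lambda>p. fst (e p)"])
      (use assms(3,4) in \<open>simp_all add: std_section_iff\<close>)
  show "smooth_map_on A V (\<lambda>p. fst (snd (e' p)))"
    by (rule smooth_map_on_cong[OF assms(1,2), of "\<lambda>p. fst (snd (e p))"])
      (use assms(3,4) in \<open>simp_all add: std_section_iff\<close>)
  show "smooth_form1 A V (\<lambda>p. snd (snd (e' p)))"
    by (rule smooth_form1_cong[OF assms(1), of _ "\<lambda>p. snd (snd (e p))"])
      (use assms(3,4) in \<open>simp_all add: std_section_iff\<close>)
qed

lemma std_fibre_add: "e \<in> std_fibre A p \<Longrightarrow> e' \<in> std_fibre A p \<Longrightarrow> e + e' \<in> std_fibre A p"
  by (auto simp: std_fibre_def tangent_space_add lin_maps_add)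

lemma std_fibre_scaleR: "e \<in> std_fibre A p \<Longrightarrow> c *\<^sub>R e \<in> std_fibre A p"
  by (auto simp: std_fibre_def tangent_space_scaleR lin_maps_scaleR)

text \<open>Covectors vanish at 0, so on the kernel of the anchor only the pairing of the Lie
  algebra components survives.\<close>

lemma std_pairing_kernel:
  assumes "\<xi> \<in> lin_maps S" "\<eta> \<in> lin_maps S"
  shows "std_pairing ip (0, a, \<xi>) (0, b, \<eta>) = ip a b"
  by (simp add: std_pairing_def lin_maps_at_zero[OF assms(1)] lin_maps_at_zero[OF assms(2)])

text \<open>The maps are regarded as sections \<open>(0, a, 0)\<close> and \<open>(0, b, 0)\<close>
  of the standard algebroid, whose pairing is smooth. This replaces a choice of basis of the Lie
  algebra and a product rule for smooth functions.\<close>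

lemma smooth_on_ip:
  assumes "courant_algebroid A W (std_courant A lb ip)" "open V" "V \<subseteq> W"
    and "smooth_map_on A V a" "smooth_map_on A V b"
  shows "smooth_on A V (\<lambda>p. ip (a p) (b p))"
proof -
  have *: "smooth_section (std_courant A lb ip) V (\<lambda>p. (0, a p, 0))"
    if "smooth_map_on A V a" for a
    using that by (simp add: std_section_iff smooth_vector_field_zero smooth_form1_zero)
  show ?thesis
    using courant_algebroid_pairing_smooth[OF assms(1-3) *[OF assms(4)] *[OF assms(5)]]
    by (simp add: std_pairing_kernel[OF lin_maps_zero lin_maps_zero])
qed

section \<open>The connection over one member of the cover\<close>

definition local_splitting ::
  "('g \<Rightarrow> 'g \<Rightarrow> real) \<Rightarrow> ('m, 'g) tc_object \<Rightarrow> 'm \<Rightarrow> 'm tvec \<Rightarrow> ('m, 'g) std"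
  where "local_splitting ip =
    (\<lambda>(\<theta>, B) p v. (v, \<theta> p v, - dual_form ip (\<theta> p) (\<theta> p v) - B p v))"

text \<open>The argument is an element of the Lie algebra instead of a coset: over a chart the two
  are identified, and in this form the map depends on the object alone, not on the gluing.\<close>

definition local_ker_splitting ::
  "('g \<Rightarrow> 'g \<Rightarrow> real) \<Rightarrow> ('m, 'g) tc_object \<Rightarrow> 'm \<Rightarrow> 'g \<Rightarrow> ('m, 'g) std"
  where "local_ker_splitting ip = (\<lambda>(\<theta>, B) p a. (0, a, - 2 *\<^sub>R dual_form ip (\<theta> p) a))"

lemma tc_object_forms:
  assumes ob: "tc_object A W ob" and p: "p \<in> W"
  shows "fst ob p \<in> lin_maps (tangent_space A p)" "snd ob p \<in> lin_maps (tangent_space A p)"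
    and "snd ob p v \<in> cotangent_space A p" "snd ob p v w = - snd ob p w v"
proof -
  have "smooth_form1 A W (fst ob)" and B: "smooth_form2 A W (snd ob)"
    using ob by (simp_all add: tc_object_def split_beta)
  then show "fst ob p \<in> lin_maps (tangent_space A p)"
    using p unfolding smooth_form1_def by blast
  from B have "snd ob p \<in> lin_maps (tangent_space A p) \<and>
      (\<forall>v. snd ob p v \<in> cotangent_space A p) \<and> (\<forall>v w. snd ob p v w = - snd ob p w v)"
    unfolding smooth_form2_def by (rule conjunct1[THEN bspec, OF _ p])
  then show "snd ob p \<in> lin_maps (tangent_space A p)"
    and "snd ob p v \<in> cotangent_space A p" "snd ob p v w = - snd ob p w v"
    by blast+
qed

lemma local_ker_splitting_linear:
  assumes bilinear: "bilinear ip"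
  shows "local_ker_splitting ip ob p (a + b)
      = local_ker_splitting ip ob p a + local_ker_splitting ip ob p b"
    and "local_ker_splitting ip ob p (c *\<^sub>R a) = c *\<^sub>R local_ker_splitting ip ob p a"
  by (auto simp: local_ker_splitting_def dual_form_add[OF bilinear] dual_form_scaleR[OF bilinear]
      scaleR_add_right split: prod.splits)

text \<open>The covector parts contribute one half of -2 times the inner product of the two values
  of \<open>\<theta>\<close>, which cancels the Lie algebra part. The \<open>B\<close> terms cancel
  by skew-symmetry. This is why the splitting contains a term quadratic in
  \<open>\<theta>\<close>.\<close>

lemma local_splitting_isotropic:
  assumes ob: "tc_object A W ob" and symmetric: "\<And>a b. ip a b = ip b a" and p: "p \<in> W"
  shows "std_pairing ip (local_splitting ip ob p v) (local_splitting ip ob p w) = 0"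
  using tc_object_forms(4)[OF ob p, of v w] symmetric[of "fst ob p w" "fst ob p v"]
  by (auto simp: std_pairing_def local_splitting_def dual_form_def split: prod.splits)

context
  fixes A :: "('m::{t2_space, second_countable_topology}, 'e::real_normed_vector) atlas"
    and lb :: "'g::real_vector \<Rightarrow> 'g \<Rightarrow> 'g"
    and ip :: "'g \<Rightarrow> 'g \<Rightarrow> real"
    and W :: "'m set"
    and ob :: "('m, 'g) tc_object"
  assumes bilinear: "bilinear ip"
    and ob: "tc_object A W ob"
begin

lemma local_splitting_fibre:
  assumes "p \<in> W" "v \<in> tangent_space A p"
  shows "local_splitting ip ob p v \<in> std_fibre A p"
  using assms tc_object_forms[OF ob assms(1)]
  by (auto simp: local_splitting_def std_fibre_iff split: prod.splits
      intro!: lin_maps_diff lin_maps_uminus dual_form_lin_maps bilinear)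

lemma local_ker_splitting_fibre:
  assumes "p \<in> W"
  shows "local_ker_splitting ip ob p a \<in> std_fibre A p"
  using assms tc_object_forms[OF ob assms(1)]
  by (auto simp: local_ker_splitting_def std_fibre_iff zero_in_tangent_space split: prod.splits
      intro!: lin_maps_uminus lin_maps_scaleR dual_form_lin_maps bilinear)

lemma local_splitting_linear:
  assumes "p \<in> W" "v \<in> tangent_space A p" "w \<in> tangent_space A p"
  shows "local_splitting ip ob p (v + w) = local_splitting ip ob p v + local_splitting ip ob p w"
    and "local_splitting ip ob p (c *\<^sub>R v) = c *\<^sub>R local_splitting ip ob p v"
proof -
  obtain \<theta> B where obD: "ob = (\<theta>, B)" by fastforce
  have "\<theta> p (v + w) = \<theta> p v + \<theta> p w" "B p (v + w) = B p v + B p w"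
    "\<theta> p (c *\<^sub>R v) = c *\<^sub>R \<theta> p v" "B p (c *\<^sub>R v) = c *\<^sub>R B p v"
    using tc_object_forms(1,2)[OF ob assms(1)] assms(2,3) by (simp_all add: obD lin_maps_def)
  then show "local_splitting ip ob p (v + w) = local_splitting ip ob p v + local_splitting ip ob p w"
    and "local_splitting ip ob p (c *\<^sub>R v) = c *\<^sub>R local_splitting ip ob p v"
    by (simp_all add: local_splitting_def obD dual_form_add[OF bilinear] dual_form_scaleR[OF bilinear]
        scaleR_diff_right)
qed

text \<open>The factor -2 in the kernel splitting compensates the 1/2 in the pairing, so the
  covector term cancels the inner product of \<open>a\<close> with \<open>\<theta> p v\<close>. The
  other covector is evaluated at 0.\<close>

lemma local_splittings_orthogonal:
  assumes "p \<in> W" "v \<in> tangent_space A p"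
  shows "std_pairing ip (local_ker_splitting ip ob p a) (local_splitting ip ob p v) = 0"
proof -
  obtain \<theta> B where obD: "ob = (\<theta>, B)" by fastforce
  have "- dual_form ip (\<theta> p) (\<theta> p v) - B p v \<in> cotangent_space A p"
    using local_splitting_fibre[OF assms] by (simp add: obD local_splitting_def std_fibre_iff)
  from lin_maps_at_zero[OF this] show ?thesis
    by (simp add: std_pairing_def local_splitting_def local_ker_splitting_def dual_form_def obD
        scaleR_fun_def)
qed

lemma local_splitting_smooth:
  assumes manifold: "smooth_manifold A" and C: "courant_algebroid A W (std_courant A lb ip)"
    and V: "open V" "V \<subseteq> W" and X: "smooth_vector_field A V X"
  shows "smooth_section (std_courant A lb ip) V (\<lambda>p. local_splitting ip ob p (X p))"
proof -
  obtain \<theta> B where obD: "ob = (\<theta>, B)" by fastforce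
  have \<theta>: "smooth_form1 A W \<theta>" and B: "smooth_form2 A W B"
    using ob by (simp_all add: tc_object_def obD)
  have \<theta>X: "smooth_map_on A V' (\<lambda>p. \<theta> p (X p))" if "open V'" "V' \<subseteq> V" "smooth_vector_field A V' X"
    for V' X
    using \<theta> that V unfolding smooth_form1_def by (meson order_trans)
  have "smooth_form1 A V (\<lambda>p. - dual_form ip (\<theta> p) (\<theta> p (X p)) - B p (X p))"
    unfolding smooth_form1_def
  proof (intro conjI ballI allI impI)
    show "- dual_form ip (\<theta> p) (\<theta> p (X p)) - B p (X p) \<in> cotangent_space A p" if "p \<in> V" for p
      using local_splitting_fibre[of p "X p"] X V that
      by (auto simp: obD local_splitting_def std_fibre_iff smooth_vector_field_def)
    fix V' Y assume V': "open V' \<and> V' \<subseteq> V \<and> smooth_vector_field A V' Y"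
    then have op: "open V'" "V' \<subseteq> W" using V by auto
    have X': "smooth_vector_field A V' X"
      using smooth_vector_field_subset[OF X] V' by blast
    have 1: "smooth_on A V' (\<lambda>p. ip (\<theta> p (X p)) (\<theta> p (Y p)))"
      by (rule smooth_on_ip[OF C op]) (use \<theta>X V' X' in blast)+
    have 2: "smooth_on A V' (\<lambda>p. B p (X p) (Y p))"
      using B op X' V' unfolding smooth_form2_def by blast
    \<comment> \<open>The coefficients -1 are written out so that the rules for sums and constant
      multiples apply.\<close>
    have "smooth_on A V' (\<lambda>p. - 1 * ip (\<theta> p (X p)) (\<theta> p (Y p)) + - 1 * B p (X p) (Y p))"
      by (intro smooth_on_add[OF manifold] smooth_on_mult_const[OF manifold] 1 2 op(1))
    then show "smooth_map_on A V' (\<lambda>p. (- dual_form ip (\<theta> p) (\<theta> p (X p)) - B p (X p)) (Y p))"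
      by (intro smooth_map_on_realI[OF manifold op(1)]) (simp add: dual_form_def)
  qed
  then show ?thesis
    using X \<theta>X[OF V(1) order_refl X] by (simp add: std_section_iff local_splitting_def obD)
qed

lemma local_ker_splitting_smooth:
  assumes manifold: "smooth_manifold A" and C: "courant_algebroid A W (std_courant A lb ip)"
    and V: "open V" "V \<subseteq> W" and a: "smooth_map_on A V a"
  shows "smooth_section (std_courant A lb ip) V (\<lambda>p. local_ker_splitting ip ob p (a p))"
proof -
  obtain \<theta> B where obD: "ob = (\<theta>, B)" by fastforce
  have \<theta>: "smooth_form1 A W \<theta>"
    using ob by (simp add: tc_object_def obD)
  have "smooth_form1 A V (\<lambda>p. - 2 *\<^sub>R dual_form ip (\<theta> p) (a p))"
    unfolding smooth_form1_def
  proof (intro conjI ballI allI impI)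
    show "- 2 *\<^sub>R dual_form ip (\<theta> p) (a p) \<in> cotangent_space A p" if "p \<in> V" for p
      using local_ker_splitting_fibre[of p "a p"] V that
      by (auto simp: obD local_ker_splitting_def std_fibre_iff)
    fix V' Y assume V': "open V' \<and> V' \<subseteq> V \<and> smooth_vector_field A V' Y"
    then have op: "open V'" "V' \<subseteq> W" using V by auto
    have "smooth_map_on A V' (\<lambda>p. \<theta> p (Y p))"
      using \<theta> V' op unfolding smooth_form1_def by blast
    then have "smooth_on A V' (\<lambda>p. ip (a p) (\<theta> p (Y p)))"
      using smooth_on_ip[OF C op] smooth_map_on_subset[OF a] V' by blast
    then have "smooth_on A V' (\<lambda>p. - 2 * ip (a p) (\<theta> p (Y p)))"
      by (rule smooth_on_mult_const[OF manifold op(1)])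
    then show "smooth_map_on A V' (\<lambda>p. (- 2 *\<^sub>R dual_form ip (\<theta> p) (a p)) (Y p))"
      by (intro smooth_map_on_realI[OF manifold op(1)]) (simp add: dual_form_def scaleR_fun_def)
  qed
  then show ?thesis
    using a by (simp add: std_section_iff local_ker_splitting_def obD smooth_vector_field_zero)
qed

end

section \<open>The action of 1-morphisms on the local splittings\<close>

lemma tc_morphism_isomorphism:
  "tc_morphism A lb ip W ob' ob L \<Longrightarrow>
    courant_isomorphism A W (std_courant A lb ip) (std_courant A lb ip) L"
  by (auto simp: tc_morphism_def split: prod.splits)

lemma tc_morphism_local_splitting:
  assumes "tc_morphism A lb ip W ob' ob L" "p \<in> W" "v \<in> tangent_space A p"
    and "local_splitting ip ob' p v \<in> std_fibre A p"
  shows "L p (local_splitting ip ob' p v) = local_splitting ip ob p v"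
proof -
  obtain \<theta> B \<theta>' B' where obs: "ob = (\<theta>, B)" "ob' = (\<theta>', B')" by fastforce
  obtain \<phi> \<tau> \<beta> where L: "\<forall>(v, a, \<xi>)\<in>std_fibre A p. L p (v, a, \<xi>) =
        (v, \<phi> p v + \<tau> p a, \<beta> p v - 2 *\<^sub>R dual_form ip (\<phi> p) (\<tau> p a) + \<xi>)"
    and \<theta>: "\<theta> p v = \<tau> p (\<theta>' p v) + \<phi> p v"
    and B: "B' p v - B p v = \<beta> p v + dual_form ip (\<theta> p) (\<theta> p v) - dual_form ip (\<theta>' p) (\<theta>' p v)
          - 2 *\<^sub>R dual_form ip (\<phi> p) (\<tau> p (\<theta>' p v))"
    using assms(1-3) unfolding tc_morphism_def obs by auto
  \<comment> \<open>Solved for \<open>B p v\<close>, so that in the covector component of the target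
    splitting the term quadratic in \<open>\<theta>\<close> cancels and exactly the matrix applied
    to the source splitting remains.\<close>
  have "B p v = B' p v - (\<beta> p v + dual_form ip (\<theta> p) (\<theta> p v) - dual_form ip (\<theta>' p) (\<theta>' p v)
          - 2 *\<^sub>R dual_form ip (\<phi> p) (\<tau> p (\<theta>' p v)))"
    using B by (simp add: algebra_simps)
  moreover have "L p (local_splitting ip ob' p v) = (v, \<phi> p v + \<tau> p (\<theta>' p v),
      \<beta> p v - 2 *\<^sub>R dual_form ip (\<phi> p) (\<tau> p (\<theta>' p v)) + (- dual_form ip (\<theta>' p) (\<theta>' p v) - B' p v))"
    using L assms(4) by (auto simp: local_splitting_def obs)
  ultimately show ?thesis
    by (simp add: local_splitting_def obs \<theta> add.commute)
qed

text \<open>Here \<open>b\<close> is \<open>\<tau> p a\<close> and \<open>\<zeta>\<close> is the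
  covector -2 times \<open>dual_form ip (\<phi> p) (\<tau> p a)\<close>. Orthogonality of
  \<open>\<tau> p\<close> turns the inner product of \<open>\<tau> p a\<close> with
  \<open>\<tau> p (\<theta>' p v)\<close> into that of \<open>a\<close> with
  \<open>\<theta>' p v\<close>, which matches the two kernel splittings. Both values are left
  abstract: later it only matters that all covectors are shifted by the same \<open>\<zeta>\<close>,
  so that cosets go to cosets.\<close>

lemma tc_morphism_local_ker_splitting:
  assumes "tc_morphism A lb ip W ob' ob L" "p \<in> W" and bilinear: "bilinear ip"
    and forms: "fst ob p \<in> lin_maps (tangent_space A p)" "fst ob' p \<in> lin_maps (tangent_space A p)"
  obtains b \<zeta> where "\<zeta> \<in> cotangent_space A p"
    and "\<And>\<eta>. \<eta> \<in> cotangent_space A p \<Longrightarrow> L p (0, a, \<eta>) = (0, b, \<zeta> + \<eta>)"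
    and "L p (local_ker_splitting ip ob' p a) = local_ker_splitting ip ob p b"
proof -
  obtain \<theta> B \<theta>' B' where obs: "ob = (\<theta>, B)" "ob' = (\<theta>', B')" by fastforce
  obtain \<phi> \<tau> \<beta> where \<phi>: "\<phi> p \<in> lin_maps (tangent_space A p)"
    and \<tau>: "orthogonal_lie_automorphism lb ip (\<tau> p)"
    and \<beta>: "\<beta> p \<in> lin_maps (tangent_space A p)"
    and L: "\<forall>(v, a, \<xi>)\<in>std_fibre A p. L p (v, a, \<xi>) =
        (v, \<phi> p v + \<tau> p a, \<beta> p v - 2 *\<^sub>R dual_form ip (\<phi> p) (\<tau> p a) + \<xi>)"
    and \<theta>: "\<And>v. v \<in> tangent_space A p \<Longrightarrow> \<theta> p v = \<tau> p (\<theta>' p v) + \<phi> p v"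
    using assms(1,2) unfolding tc_morphism_def obs by auto
  let ?\<zeta> = "- 2 *\<^sub>R dual_form ip (\<phi> p) (\<tau> p a)"
  have L_ker: "L p (0, a, \<eta>) = (0, \<tau> p a, ?\<zeta> + \<eta>)" if "\<eta> \<in> cotangent_space A p" for \<eta>
    using L[THEN bspec, OF std_fibre_iff[THEN iffD2, OF conjI[OF zero_in_tangent_space that]]]
      lin_maps_at_zero[OF \<phi>] lin_maps_at_zero[OF \<beta>]
    by simp
  have "dual_form ip (\<theta> p) (\<tau> p a) v = dual_form ip (\<phi> p) (\<tau> p a) v + dual_form ip (\<theta>' p) a v" for v
  proof (cases "v \<in> tangent_space A p")
    case True
    then show ?thesis
      using \<tau> by (simp add: \<theta> dual_form_def bilinear_radd[OF bilinear] orthogonal_lie_automorphism_def)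
  next
    \<comment> \<open>Equality of covectors is equality of functions, so vectors outside the tangent
      space have to be treated too; there all three forms vanish by convention.\<close>
    case False
    then have "\<theta> p v = 0" "\<theta>' p v = 0" "\<phi> p v = 0"
      using forms \<phi> by (auto simp: lin_maps_def obs)
    then show ?thesis
      by (simp add: dual_form_def bilinear_rzero[OF bilinear])
  qed
  then have *: "dual_form ip (\<theta> p) (\<tau> p a) = dual_form ip (\<phi> p) (\<tau> p a) + dual_form ip (\<theta>' p) a"
    by (simp add: fun_eq_iff)
  have cot: "- 2 *\<^sub>R dual_form ip \<psi> b \<in> cotangent_space A p" if "\<psi> \<in> lin_maps (tangent_space A p)" for \<psi> b
    by (intro lin_maps_scaleR dual_form_lin_maps bilinear that)
  have "L p (local_ker_splitting ip ob' p a) = local_ker_splitting ip ob p (\<tau> p a)"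
    using L_ker[OF cot[OF forms(2)], of a]
    by (simp add: local_ker_splitting_def obs * scaleR_add_right)
  then show ?thesis
    using that[OF cot[OF \<phi>] L_ker] by blast
qed

section \<open>The glued Courant algebroid\<close>

text \<open>A setting for one family of transitive Courant data, interpreted later for the source
  and for the target of the 1-morphism.\<close>

locale glued_data =
  fixes A :: "('m::{t2_space, second_countable_topology}, 'e::real_normed_vector) atlas"
    and lb :: "'g::real_vector \<Rightarrow> 'g \<Rightarrow> 'g"
    and ip :: "'g \<Rightarrow> 'g \<Rightarrow> real"
    and U :: "'i \<Rightarrow> 'm set"
    and D :: "('i, 'm, 'g) tc_data"
  assumes quadratic: "quadratic_lie_algebra lb ip"
    and manifold: "smooth_manifold A"
    and cover: "open_cover U"
    and data: "transitive_courant_data A lb ip U D"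
begin

abbreviation "C \<equiv> std_courant A lb ip"
abbreviation "G \<equiv> glued_courant A lb ip U D"
abbreviation "T \<equiv> trans_map D"
abbreviation "cls \<equiv> glue_class A U D"

lemma open_U: "open (U i)"
  using cover by (simp add: open_cover_def)

lemma some_index: "p \<in> U (some_index U p)"
proof -
  have "\<exists>i. p \<in> U i"
    using cover unfolding open_cover_def by blast
  then show ?thesis
    unfolding some_index_def by (rule someI_ex)
qed

lemma ip_bilinear: "bilinear ip"
  and ip_symmetric: "ip a b = ip b a"
  and ip_nondegenerate: "(\<And>b. ip a b = 0) \<Longrightarrow> a = 0"
  using quadratic by (simp_all add: quadratic_lie_algebra_def)

lemma object: "tc_object A (U i) (obj D i)"
  using data by (simp add: transitive_courant_data_def)

lemma transition: "tc_morphism A lb ip (U i \<inter> U j) (obj D j) (obj D i) (T i j)"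
  using data by (simp add: transitive_courant_data_def)

lemma transition_iso: "courant_isomorphism A (U i \<inter> U j) C C (T i j)"
  using transition by (rule tc_morphism_isomorphism)

text \<open>An isomorphism of Courant algebroids includes the axioms for its source. The transition
  map from \<open>U i\<close> to itself provides them over \<open>U i\<close>.\<close>

lemma std_courant_algebroid: "courant_algebroid A (U i) C"
  using transition_iso[of i i] by (simp add: courant_isomorphism_def)

lemma transition_bundle: "bundle_isomorphism (U i \<inter> U j) C C (T i j)"
  using transition_iso by (simp add: courant_isomorphism_def)

lemma transition_bij:
  assumes "p \<in> U i" "p \<in> U j"
  shows "bij_betw (T i j p) (std_fibre A p) (std_fibre A p)"
  using transition_bundle[of i j] assms by (simp add: bundle_isomorphism_def)

lemma transition_fibre:
  assumes "p \<in> U i" "p \<in> U j" "e \<in> std_fibre A p"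
  shows "T i j p e \<in> std_fibre A p"
  using transition_bij[OF assms(1,2)] assms(3) bij_betwE by blast

lemma transition_linear:
  assumes "p \<in> U i" "p \<in> U j" "e \<in> std_fibre A p"
  shows "e' \<in> std_fibre A p \<Longrightarrow> T i j p (e + e') = T i j p e + T i j p e'"
    and "T i j p (c *\<^sub>R e) = c *\<^sub>R T i j p e"
  using transition_bundle[of i j] assms by (simp_all add: bundle_isomorphism_def)

lemma transition_anchor:
  assumes "p \<in> U i" "p \<in> U j" "e \<in> std_fibre A p"
  shows "fst (T i j p e) = fst e"
  using transition_iso[of i j] assms by (simp add: courant_isomorphism_def)

lemma transition_pairing:
  assumes "p \<in> U i" "p \<in> U j" "e \<in> std_fibre A p" "e' \<in> std_fibre A p"
  shows "std_pairing ip (T i j p e) (T i j p e') = std_pairing ip e e'"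
  using transition_iso[of i j] assms by (simp add: courant_isomorphism_def)

lemma transition_smooth:
  assumes "open V" "V \<subseteq> U i" "V \<subseteq> U j" "smooth_section C V e"
  shows "smooth_section C V (\<lambda>p. T i j p (e p))"
proof -
  have "smooth_section C V e \<longleftrightarrow> smooth_section C V (\<lambda>p. T i j p (e p))"
    by (rule transition_bundle[of i j, unfolded bundle_isomorphism_def, THEN conjunct2,
          THEN spec, THEN spec, THEN mp])
      (use assms std_section_fibre[OF assms(4)] in auto)
  then show ?thesis
    using assms(4) by simp
qed

lemma transition_bracket:
  assumes "smooth_section C (U i \<inter> U j) e" "smooth_section C (U i \<inter> U j) e'" "p \<in> U i \<inter> U j"
  shows "T i j p (bracket C e e' p) = bracket C (\<lambda>q. T i j q (e q)) (\<lambda>q. T i j q (e' q)) p"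
  using transition_iso[of i j] assms unfolding courant_isomorphism_def by blast

lemma transition_transition:
  assumes "p \<in> U i" "p \<in> U j" "p \<in> U k" "e \<in> std_fibre A p"
  shows "T i j p (T j k p e) = T i k p e"
  using data assms by (simp add: transitive_courant_data_def)

text \<open>By the cocycle condition this map is idempotent, and an injective idempotent map is the
  identity.\<close>

lemma transition_self:
  assumes "p \<in> U i" "e \<in> std_fibre A p"
  shows "T i i p e = e"
proof -
  have "T i i p (T i i p e) = T i i p e"
    by (rule transition_transition[OF assms(1,1,1,2)])
  then show ?thesis
    using transition_bij[OF assms(1,1)] transition_fibre[OF assms(1,1,2)] assms(2)
    unfolding bij_betw_def by (blast dest: inj_onD)
qed

section \<open>Classes and their representatives in the charts\<close>

lemma cls_eq:
  assumes "p \<in> U i" "e \<in> std_fibre A p"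
  shows "cls i p e = {(k, p, T k i p e) | k. p \<in> U k}"
  unfolding glue_class_def glue_rel_def Image_singleton using assms by blast

text \<open>A class lists the images of one element in all charts through \<open>p\<close>; by the
  cocycle condition, starting from another member of the list produces the same list. Thus the image
  of a single triple under \<open>glue_rel\<close> is a full equivalence class.\<close>

lemma cls_transition:
  assumes "p \<in> U i" "p \<in> U k" "e \<in> std_fibre A p"
  shows "cls k p (T k i p e) = cls i p e"
  unfolding cls_eq[OF assms(1,3)] cls_eq[OF assms(2) transition_fibre[OF assms(2,1,3)]]
  using transition_transition[OF _ assms(2,1,3)] by auto

text \<open>A class contains exactly one triple over each \<open>U k\<close> through
  \<open>p\<close>, so the definite description in \<open>glue_rep\<close> has a value.\<close>

lemma rep_cls:
  assumes "p \<in> U i" "p \<in> U k" "e \<in> std_fibre A p"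
  shows "glue_rep k p (cls i p e) = T k i p e"
  unfolding glue_rep_def cls_eq[OF assms(1,3)] using assms(2) by auto

lemma rep_cls_self:
  assumes "p \<in> U i" "e \<in> std_fibre A p"
  shows "glue_rep i p (cls i p e) = e"
  using rep_cls[OF assms(1,1,2)] transition_self[OF assms] by simp

lemma glued_fibre:
  assumes "p \<in> U i"
  shows "fibre G p = cls i p ` std_fibre A p"
proof -
  have "cls j p e \<in> cls i p ` std_fibre A p" if "p \<in> U j" "e \<in> std_fibre A p" for j e
    using cls_transition[OF that(1) assms that(2)] transition_fibre[OF assms that]
    by (metis imageI)
  then show ?thesis
    using assms by (auto simp: glued_courant_def)
qed

lemma cls_fibre: "p \<in> U i \<Longrightarrow> e \<in> std_fibre A p \<Longrightarrow> cls i p e \<in> fibre G p"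
  using glued_fibre by blast

lemma fibre_cases:
  assumes "p \<in> U i" "c \<in> fibre G p"
  obtains e where "e \<in> std_fibre A p" "c = cls i p e"
  using assms glued_fibre[OF assms(1)] by blast

lemma rep_fibre: "p \<in> U i \<Longrightarrow> c \<in> fibre G p \<Longrightarrow> glue_rep i p c \<in> std_fibre A p"
  by (metis fibre_cases rep_cls_self)

lemma cls_rep: "p \<in> U i \<Longrightarrow> c \<in> fibre G p \<Longrightarrow> cls i p (glue_rep i p c) = c"
  by (metis fibre_cases rep_cls_self)

lemma transition_rep:
  assumes "p \<in> U i" "p \<in> U j" "c \<in> fibre G p"
  shows "T j i p (glue_rep i p c) = glue_rep j p c"
  using rep_cls[OF assms(1,2) rep_fibre[OF assms(1,3)]] cls_rep[OF assms(1,3)] by simp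

lemma rep_bij: "p \<in> U i \<Longrightarrow> bij_betw (glue_rep i p) (fibre G p) (std_fibre A p)"
  by (rule bij_betw_byWitness[of _ "cls i p"]) (auto simp: cls_rep rep_cls_self rep_fibre cls_fibre)

lemma glued_section_iff: "smooth_section G V \<sigma> \<longleftrightarrow>
    (\<forall>p\<in>V. \<sigma> p \<in> fibre G p) \<and> (\<forall>i. smooth_section C (V \<inter> U i) (\<lambda>p. glue_rep i p (\<sigma> p)))"
  by (simp add: glued_courant_def) blast

text \<open>The record adds representatives over the chosen index. Rewriting the resulting class in
  chart \<open>i\<close> and using linearity of the transition map frees the formula from that
  choice; the other fibrewise operations are treated in the same way.\<close>

lemma glued_add:
  assumes "p \<in> U i" "c \<in> fibre G p" "c' \<in> fibre G p"
  shows "fadd G p c c' = cls i p (glue_rep i p c + glue_rep i p c')"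
proof -
  let ?j = "some_index U p"
  note j = some_index[of p]
  note r = rep_fibre[OF j]
  have "fadd G p c c' = cls ?j p (glue_rep ?j p c + glue_rep ?j p c')"
    by (simp add: glued_courant_def Let_def)
  also have "\<dots> = cls i p (T i ?j p (glue_rep ?j p c + glue_rep ?j p c'))"
    by (rule cls_transition[OF j assms(1) std_fibre_add[OF r[OF assms(2)] r[OF assms(3)]], symmetric])
  finally show ?thesis
    using transition_linear(1)[OF assms(1) j r[OF assms(2)] r[OF assms(3)]]
      transition_rep[OF j assms(1)] assms(2,3)
    by simp
qed

lemma glued_scale:
  assumes "p \<in> U i" "c \<in> fibre G p"
  shows "fscale G p x c = cls i p (x *\<^sub>R glue_rep i p c)"
proof -
  let ?j = "some_index U p"
  note j = some_index[of p]
  note r = rep_fibre[OF j]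
  have "fscale G p x c = cls ?j p (x *\<^sub>R glue_rep ?j p c)"
    by (simp add: glued_courant_def Let_def)
  also have "\<dots> = cls i p (T i ?j p (x *\<^sub>R glue_rep ?j p c))"
    by (rule cls_transition[OF j assms(1) std_fibre_scaleR[OF r[OF assms(2)]], symmetric])
  finally show ?thesis
    using transition_linear(2)[OF assms(1) j r[OF assms(2)]] transition_rep[OF j assms(1)] assms(2)
    by simp
qed

lemma glued_anchor:
  assumes "p \<in> U i" "c \<in> fibre G p"
  shows "anchor G p c = fst (glue_rep i p c)"
proof -
  note j = some_index[of p]
  show ?thesis
    using transition_anchor[OF assms(1) j rep_fibre[OF j assms(2)]] transition_rep[OF j assms]
    by (simp add: glued_courant_def Let_def)
qed

lemma glued_pairing:
  assumes "p \<in> U i" "c \<in> fibre G p" "c' \<in> fibre G p"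
  shows "pairing G p c c' = std_pairing ip (glue_rep i p c) (glue_rep i p c')"
proof -
  note j = some_index[of p]
  show ?thesis
    using transition_pairing[OF assms(1) j rep_fibre[OF j assms(2)] rep_fibre[OF j assms(3)]]
      transition_rep[OF j assms(1)] assms(2,3)
    by (simp add: glued_courant_def Let_def)
qed

text \<open>The index is chosen at \<open>p\<close> and then kept fixed for the representatives at
  all nearby points, so the bracket in the record is one of sections over a single
  \<open>U ?j\<close>. The transition map preserves brackets of sections over
  \<open>U i \<inter> U ?j\<close>, which contains \<open>p\<close>.\<close>

lemma glued_bracket:
  assumes \<sigma>: "smooth_section G UNIV \<sigma>" and \<sigma>': "smooth_section G UNIV \<sigma>'" and i: "p \<in> U i"
  shows "bracket G \<sigma> \<sigma>' p \<in> fibre G p"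
    and "glue_rep i p (bracket G \<sigma> \<sigma>' p)
      = bracket C (\<lambda>q. glue_rep i q (\<sigma> q)) (\<lambda>q. glue_rep i q (\<sigma>' q)) p"
proof -
  let ?j = "some_index U p"
  note j = some_index[of p]
  let ?R = "\<lambda>k \<sigma> q. glue_rep k q (\<sigma> q)"
  have s: "smooth_section C (U k) (?R k \<tau>)" if "smooth_section G UNIV \<tau>" for k \<tau>
  proof -
    have "smooth_section C (UNIV \<inter> U k) (?R k \<tau>)"
      using that unfolding glued_section_iff by blast
    then show ?thesis by simp
  qed
  have s': "smooth_section C (U i \<inter> U ?j) (?R k \<tau>)"
    if "smooth_section G UNIV \<tau>" "k = i \<or> k = ?j" for k \<tau>
    using s[OF that(1)] that(2) by (blast intro: std_section_subset)
  have fib: "\<tau> q \<in> fibre G q" if "smooth_section G UNIV \<tau>" for \<tau> q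
    using that by (simp add: glued_section_iff)
  have br: "bracket C (?R ?j \<sigma>) (?R ?j \<sigma>') p \<in> std_fibre A p"
    by (rule std_section_fibre[OF courant_algebroid_bracket_smooth[OF std_courant_algebroid
            s[OF \<sigma>] s[OF \<sigma>']] j])
  have eq: "bracket G \<sigma> \<sigma>' p = cls ?j p (bracket C (?R ?j \<sigma>) (?R ?j \<sigma>') p)"
    by (simp add: glued_courant_def Let_def)
  show "bracket G \<sigma> \<sigma>' p \<in> fibre G p"
    unfolding eq by (rule cls_fibre[OF j br])
  have "glue_rep i p (bracket G \<sigma> \<sigma>' p) = T i ?j p (bracket C (?R ?j \<sigma>) (?R ?j \<sigma>') p)"
    unfolding eq by (rule rep_cls[OF j i br])
  also have "\<dots> = bracket C (\<lambda>q. T i ?j q (?R ?j \<sigma> q)) (\<lambda>q. T i ?j q (?R ?j \<sigma>' q)) p"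
    by (rule transition_bracket) (use s' \<sigma> \<sigma>' i j in auto)
  \<comment> \<open>The transition map takes one family of representatives to the other only on the
    overlap, hence the congruence of the bracket over \<open>U i \<inter> U ?j\<close>.\<close>
  also have "\<dots> = bracket C (?R i \<sigma>) (?R i \<sigma>') p"
  proof (rule courant_algebroid_bracket_cong[of A "U i \<inter> U ?j"])
    show "courant_algebroid A (U i \<inter> U ?j) C"
      using transition_iso by (simp add: courant_isomorphism_def)
  qed (use s' \<sigma> \<sigma>' i j transition_rep fib in auto)
  finally show "glue_rep i p (bracket G \<sigma> \<sigma>' p) = bracket C (?R i \<sigma>) (?R i \<sigma>') p" .
qed

sublocale courant_gluing A U C G glue_rep
proof
  fix V i \<sigma>
  assume V: "open V" "V \<subseteq> U i" and \<sigma>: "\<And>p. p \<in> V \<Longrightarrow> \<sigma> p \<in> fibre G p"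
    and s: "smooth_section C V (\<lambda>p. glue_rep i p (\<sigma> p))"
  \<comment> \<open>In another chart the representative arises by applying \<open>T j i\<close>,
    which preserves smooth sections over \<open>V \<inter> U j\<close>.\<close>
  have "smooth_section C (V \<inter> U j) (\<lambda>p. glue_rep j p (\<sigma> p))" for j
  proof -
    have op: "open (V \<inter> U j)"
      using V open_U by blast
    have "smooth_section C (V \<inter> U j) (\<lambda>p. T j i p (glue_rep i p (\<sigma> p)))"
      by (rule transition_smooth[OF op]) (use V std_section_subset[OF s] in auto)
    then show ?thesis
      by (rule std_section_cong[OF manifold op]) (use V \<sigma> transition_rep in auto)
  qed
  then show "smooth_section G V \<sigma>"
    using \<sigma> glued_section_iff by blast
next
  fix p c c' assume c: "c \<in> fibre G p" "c' \<in> fibre G p"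
  note j = some_index[of p]
  show "fadd G p c c' \<in> fibre G p"
    unfolding glued_add[OF j c] by (intro cls_fibre j std_fibre_add rep_fibre c)
  fix i assume i: "p \<in> U i"
  show "glue_rep i p (fadd G p c c') = fadd C p (glue_rep i p c) (glue_rep i p c')"
    using rep_cls_self[OF i std_fibre_add[OF rep_fibre[OF i c(1)] rep_fibre[OF i c(2)]]]
    by (simp add: glued_add[OF i c])
next
  fix p x c assume c: "c \<in> fibre G p"
  note j = some_index[of p]
  show "fscale G p x c \<in> fibre G p"
    unfolding glued_scale[OF j c] by (intro cls_fibre j std_fibre_scaleR rep_fibre c)
  fix i assume i: "p \<in> U i"
  show "glue_rep i p (fscale G p x c) = fscale C p x (glue_rep i p c)"
    using rep_cls_self[OF i std_fibre_scaleR[OF rep_fibre[OF i c]]]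
    by (simp add: glued_scale[OF i c])
next
  show "bracket G \<sigma> \<sigma>' p \<in> fibre G p"
    if "smooth_section G UNIV \<sigma>" "smooth_section G UNIV \<sigma>'" for \<sigma> \<sigma>' p
    using glued_bracket(1)[OF that some_index] .
next
  show "smooth_section G V \<sigma> \<longleftrightarrow> (\<forall>p\<in>V. \<sigma> p \<in> fibre G p) \<and>
      (\<forall>i. smooth_section C (V \<inter> U i) (\<lambda>p. glue_rep i p (\<sigma> p)))" for V \<sigma>
    by (rule glued_section_iff)
next
  show "smooth_section C V \<sigma>'"
    if "open V" "smooth_section C V \<sigma>" "\<And>p. p \<in> V \<Longrightarrow> \<sigma> p = \<sigma>' p" for V \<sigma> \<sigma>'
    by (rule std_section_cong[OF manifold that])
next
  show "smooth_section C V' \<sigma>" if "smooth_section C V \<sigma>" "V' \<subseteq> V" for V V' \<sigma>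
    by (rule std_section_subset[OF that])
qed (use manifold cover std_courant_algebroid rep_bij glued_anchor glued_pairing glued_bracket(2)
    in simp_all)

section \<open>The connection of the glued Courant algebroid\<close>

lemma cls_operations:
  assumes "p \<in> U i" "e \<in> std_fibre A p"
  shows "e' \<in> std_fibre A p \<Longrightarrow> fadd G p (cls i p e) (cls i p e') = cls i p (e + e')"
    and "fscale G p x (cls i p e) = cls i p (x *\<^sub>R e)"
    and "anchor G p (cls i p e) = fst e"
    and "e' \<in> std_fibre A p \<Longrightarrow> pairing G p (cls i p e) (cls i p e') = std_pairing ip e e'"
  using assms
  by (simp_all add: glued_add[OF assms(1)] glued_scale[OF assms(1)] glued_anchor[OF assms(1)]
      glued_pairing[OF assms(1)] cls_fibre rep_cls_self)

lemma local_splitting_std_fibre: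
  "p \<in> U i \<Longrightarrow> v \<in> tangent_space A p \<Longrightarrow> local_splitting ip (obj D i) p v \<in> std_fibre A p"
  by (rule local_splitting_fibre[OF ip_bilinear object])

lemma local_ker_splitting_std_fibre:
  "p \<in> U i \<Longrightarrow> local_ker_splitting ip (obj D i) p a \<in> std_fibre A p"
  by (rule local_ker_splitting_fibre[OF ip_bilinear object])

lemma glued_splitting_eq:
  assumes "p \<in> U i" "v \<in> tangent_space A p"
  shows "glued_splitting A ip U D p v = cls i p (local_splitting ip (obj D i) p v)"
proof -
  let ?j = "some_index U p"
  note j = some_index[of p]
  have "glued_splitting A ip U D p v = cls ?j p (local_splitting ip (obj D ?j) p v)"
    by (simp add: glued_splitting_def local_splitting_def Let_def split: prod.splits)
  also have "\<dots> = cls i p (T i ?j p (local_splitting ip (obj D ?j) p v))"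
    by (rule cls_transition[OF j assms(1) local_splitting_std_fibre[OF j assms(2)], symmetric])
  also have "T i ?j p (local_splitting ip (obj D ?j) p v) = local_splitting ip (obj D i) p v"
    by (rule tc_morphism_local_splitting[OF transition])
      (use assms j local_splitting_std_fibre in auto)
  finally show ?thesis .
qed

section \<open>The kernel of the anchor, its orthogonal complement and their quotient\<close>

definition coset :: "'i \<Rightarrow> 'm \<Rightarrow> 'g \<Rightarrow> ('i \<times> 'm \<times> ('m, 'g) std) set set"
  where "coset i p a = {cls i p (0, a, \<eta>) | \<eta>. \<eta> \<in> cotangent_space A p}"

lemma ker_std_fibre: "(0, a, \<eta>) \<in> std_fibre A p \<longleftrightarrow> \<eta> \<in> cotangent_space A p"
  by (simp add: std_fibre_iff zero_in_tangent_space)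

lemma anchor_ker_eq:
  assumes "p \<in> U i"
  shows "anchor_ker G p = {cls i p (0, a, \<xi>) | a \<xi>. \<xi> \<in> cotangent_space A p}"
proof (intro set_eqI iffI)
  fix c assume "c \<in> anchor_ker G p"
  then have c: "c \<in> fibre G p" "anchor G p c = 0"
    by (auto simp: anchor_ker_def)
  then obtain v a \<xi> where e: "(v, a, \<xi>) \<in> std_fibre A p" "c = cls i p (v, a, \<xi>)"
    by (metis assms fibre_cases prod_cases3)
  then show "c \<in> {cls i p (0, a, \<xi>) | a \<xi>. \<xi> \<in> cotangent_space A p}"
    using c(2) cls_operations(3)[OF assms e(1)] by (auto simp: std_fibre_iff)
next
  fix c assume "c \<in> {cls i p (0, a, \<xi>) | a \<xi>. \<xi> \<in> cotangent_space A p}"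
  then obtain a \<xi> where "\<xi> \<in> cotangent_space A p" "c = cls i p (0, a, \<xi>)"
    by blast
  then show "c \<in> anchor_ker G p"
    using cls_fibre[OF assms, of "(0, a, \<xi>)"] cls_operations(3)[OF assms, of "(0, a, \<xi>)"]
    by (simp add: anchor_ker_def ker_std_fibre)
qed

text \<open>Covectors separate tangent vectors because the standard pairing is nondegenerate:
  \<open>(v, 0, 0)\<close> pairs with any element to half the value of its covector on
  \<open>v\<close>.\<close>

lemma tangent_vector_eq_0:
  assumes v: "v \<in> tangent_space A p" and 0: "\<And>\<eta>. \<eta> \<in> cotangent_space A p \<Longrightarrow> \<eta> v = 0"
  shows "v = 0"
proof -
  have "(v, 0, 0) = fscale C p 0 (v, 0 :: 'g, 0)"
  proof (rule courant_algebroid_nondegenerate[OF std_courant_algebroid some_index])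
    show "(v, 0, 0) \<in> fibre C p"
      using v by (simp add: std_fibre_iff lin_maps_zero)
    fix e' :: "('m, 'g) std" assume "e' \<in> fibre C p"
    then show "pairing C p (v, 0, 0) e' = 0"
      using 0 by (cases e') (auto simp: std_fibre_iff std_pairing_def bilinear_lzero[OF ip_bilinear])
  qed
  then show ?thesis by simp
qed

lemma anchor_ker_perp_eq:
  assumes "p \<in> U i"
  shows "anchor_ker_perp G p = {cls i p (0, 0, \<xi>) | \<xi>. \<xi> \<in> cotangent_space A p}"
proof (intro set_eqI iffI)
  fix c assume "c \<in> anchor_ker_perp G p"
  then have c: "c \<in> fibre G p" and perp: "\<And>k. k \<in> anchor_ker G p \<Longrightarrow> pairing G p c k = 0"
    by (auto simp: anchor_ker_perp_def)
  obtain v a \<xi> where e: "(v, a, \<xi>) \<in> std_fibre A p" "c = cls i p (v, a, \<xi>)"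
    using c by (metis assms fibre_cases prod_cases3)
  have *: "std_pairing ip (v, a, \<xi>) (0, b, \<eta>) = 0" if "\<eta> \<in> cotangent_space A p" for b \<eta>
    using perp[of "cls i p (0, b, \<eta>)"] that cls_operations(4)[OF assms e(1), of "(0, b, \<eta>)"]
    by (auto simp: anchor_ker_eq[OF assms] ker_std_fibre e(2))
  have "\<xi> 0 = 0"
    using e(1) lin_maps_at_zero by (auto simp: std_fibre_iff)
  \<comment> \<open>Pairing with the kernel sees only \<open>v\<close> and \<open>a\<close>. Taking
    \<open>\<eta>\<close> to be 0 isolates \<open>a\<close>, and taking \<open>b\<close> to be 0
    isolates \<open>v\<close>.\<close>
  then have **: "1/2 * \<eta> v + ip a b = 0" if "\<eta> \<in> cotangent_space A p" for b \<eta>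
    using *[OF that, of b] by (simp add: std_pairing_def)
  have "a = 0"
    using **[OF lin_maps_zero] by (intro ip_nondegenerate) simp
  moreover have "v = 0"
  proof (rule tangent_vector_eq_0)
    show "\<eta> v = 0" if "\<eta> \<in> cotangent_space A p" for \<eta>
      using **[OF that, of 0] by (simp add: bilinear_rzero[OF ip_bilinear])
  qed (use e(1) in \<open>simp add: std_fibre_iff\<close>)
  ultimately show "c \<in> {cls i p (0, 0, \<xi>) | \<xi>. \<xi> \<in> cotangent_space A p}"
    using e by (auto simp: std_fibre_iff)
next
  fix c assume "c \<in> {cls i p (0, 0, \<xi>) | \<xi>. \<xi> \<in> cotangent_space A p}"
  then obtain \<xi> where \<xi>: "\<xi> \<in> cotangent_space A p" "c = cls i p (0, 0, \<xi>)"
    by blast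
  have "pairing G p c k = 0" if k: "k \<in> anchor_ker G p" for k
  proof -
    obtain a \<eta> where "\<eta> \<in> cotangent_space A p" "k = cls i p (0, a, \<eta>)"
      using k by (auto simp: anchor_ker_eq[OF assms])
    then show ?thesis
      using cls_operations(4)[OF assms, of "(0, 0, \<xi>)" "(0, a, \<eta>)"] \<xi>
      by (simp add: ker_std_fibre std_pairing_kernel bilinear_lzero[OF ip_bilinear])
  qed
  then show "c \<in> anchor_ker_perp G p"
    using \<xi> cls_fibre[OF assms, of "(0, 0, \<xi>)"] by (simp add: anchor_ker_perp_def ker_std_fibre)
qed

text \<open>The orthogonal complement is the cotangent part, so a coset fixes the Lie algebra
  component and lets the covector range freely; translation by \<open>\<xi>\<close> permutes the
  covectors.\<close>

lemma quot_proj_cls: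
  assumes i: "p \<in> U i" and \<xi>: "\<xi> \<in> cotangent_space A p"
  shows "quot_proj G p (cls i p (0, a, \<xi>)) = coset i p a"
proof -
  have add: "fadd G p (cls i p (0, a, \<xi>)) (cls i p (0, 0, \<eta>)) = cls i p (0, a, \<xi> + \<eta>)"
    if "\<eta> \<in> cotangent_space A p" for \<eta>
    using cls_operations(1)[OF i, of "(0, a, \<xi>)" "(0, 0, \<eta>)"] \<xi> that by (simp add: ker_std_fibre)
  show ?thesis
  proof (intro set_eqI iffI)
    fix c assume "c \<in> quot_proj G p (cls i p (0, a, \<xi>))"
    then obtain \<eta> where "\<eta> \<in> cotangent_space A p" "c = cls i p (0, a, \<xi> + \<eta>)"
      using add by (auto simp: quot_proj_def anchor_ker_perp_eq[OF i])
    then show "c \<in> coset i p a"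
      using lin_maps_add[OF \<xi>] by (auto simp: coset_def)
  next
    fix c assume "c \<in> coset i p a"
    then obtain \<eta> where \<eta>: "\<eta> \<in> cotangent_space A p" "c = cls i p (0, a, \<eta>)"
      by (auto simp: coset_def)
    have "\<eta> - \<xi> \<in> cotangent_space A p"
      by (rule lin_maps_diff[OF \<eta>(1) \<xi>])
    with add[OF this] \<eta>(2) show "c \<in> quot_proj G p (cls i p (0, a, \<xi>))"
      by (auto simp: quot_proj_def anchor_ker_perp_eq[OF i] intro!: exI[of _ "cls i p (0, 0, \<eta> - \<xi>)"])
  qed
qed

lemma quot_fibre_eq:
  assumes "p \<in> U i"
  shows "quot_fibre G p = range (coset i p)"
proof -
  have "coset i p a \<in> quot_proj G p ` anchor_ker G p" for a
  proof (rule image_eqI)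
    show "coset i p a = quot_proj G p (cls i p (0, a, 0))"
      by (rule quot_proj_cls[OF assms lin_maps_zero, symmetric])
    show "cls i p (0, a, 0) \<in> anchor_ker G p"
      using lin_maps_zero unfolding anchor_ker_eq[OF assms] by blast
  qed
  then show ?thesis
    using quot_proj_cls[OF assms] by (auto simp: quot_fibre_def anchor_ker_eq[OF assms])
qed

text \<open>This gives the definite description in \<open>glued_ker_splitting\<close> a value: over
  a chart every coset contains exactly one class whose covector component is 0.\<close>

lemma cls_mem_coset:
  assumes i: "p \<in> U i"
  shows "cls i p (0, b, 0) \<in> coset i p a \<longleftrightarrow> b = a"
proof
  assume "cls i p (0, b, 0) \<in> coset i p a"
  then obtain \<eta> where \<eta>: "\<eta> \<in> cotangent_space A p" "cls i p (0, b, 0) = cls i p (0, a, \<eta>)"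
    by (auto simp: coset_def)
  have "(0, b, 0) \<in> std_fibre A p" "(0, a, \<eta>) \<in> std_fibre A p"
    using \<eta>(1) by (simp_all add: ker_std_fibre lin_maps_zero)
  then have "(0, b, 0) = (0 :: 'm tvec, a, \<eta>)"
    using rep_cls_self[OF i] \<eta>(2) by metis
  then show "b = a"
    by blast
qed (auto simp: coset_def lin_maps_zero)

lemma glued_ker_splitting_coset:
  assumes i: "p \<in> U i"
  shows "glued_ker_splitting A ip U D p (coset i p a) = cls i p (local_ker_splitting ip (obj D i) p a)"
proof -
  let ?j = "some_index U p"
  note j = some_index[of p]
  have def: "glued_ker_splitting A ip U D p (coset ?j p b) = cls ?j p (local_ker_splitting ip (obj D ?j) p b)"
    for b
    by (simp add: glued_ker_splitting_def local_ker_splitting_def Let_def cls_mem_coset[OF j]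
        split: prod.splits)
  obtain b \<zeta> where \<zeta>: "\<zeta> \<in> cotangent_space A p"
    and T: "\<And>\<eta>. \<eta> \<in> cotangent_space A p \<Longrightarrow> T ?j i p (0, a, \<eta>) = (0, b, \<zeta> + \<eta>)"
    and T_ker: "T ?j i p (local_ker_splitting ip (obj D i) p a) = local_ker_splitting ip (obj D ?j) p b"
    by (rule tc_morphism_local_ker_splitting[OF transition[of ?j i] IntI[OF j i] ip_bilinear
          tc_object_forms(1)[OF object j] tc_object_forms(1)[OF object i]]) blast
  \<comment> \<open>The case of \<open>\<eta>\<close> equal to 0. The covector
    \<open>\<zeta>\<close> disappears in the quotient, so \<open>a\<close> in chart \<open>i\<close>
    and \<open>b\<close> in the chosen chart name the same coset.\<close>
  have "cls i p (0, a, 0) = cls ?j p (0, b, \<zeta>)"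
    using cls_transition[OF i j, of "(0, a, 0)"] T[OF lin_maps_zero]
    by (simp add: ker_std_fibre lin_maps_zero)
  then have "coset i p a = coset ?j p b"
    using quot_proj_cls[OF i lin_maps_zero, of a] quot_proj_cls[OF j \<zeta>, of b] by simp
  then show ?thesis
    using def[of b] T_ker cls_transition[OF i j local_ker_splitting_std_fibre[OF i, of a]] by simp
qed

lemma anchor_ker_cases:
  assumes i: "p \<in> U i" and c: "c \<in> anchor_ker G p"
  obtains a \<xi> where "\<xi> \<in> cotangent_space A p" "c = cls i p (0, a, \<xi>)"
    "glue_rep i p c = (0, a, \<xi>)" "quot_proj G p c = coset i p a"
proof -
  obtain a \<xi> where "\<xi> \<in> cotangent_space A p" "c = cls i p (0, a, \<xi>)"
    using c by (auto simp: anchor_ker_eq[OF i])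
  then show ?thesis
    using that quot_proj_cls[OF i] rep_cls_self[OF i, of "(0, a, \<xi>)"] by (simp add: ker_std_fibre)
qed

lemma glued_splitting_smooth:
  assumes V: "open V" and X: "smooth_vector_field A V X"
  shows "smooth_section G V (\<lambda>p. glued_splitting A ip U D p (X p))"
  unfolding glued_section_iff
proof (intro conjI ballI allI)
  have X_tangent: "X p \<in> tangent_space A p" if "p \<in> V" for p
    using X that by (simp add: smooth_vector_field_def)
  show "glued_splitting A ip U D p (X p) \<in> fibre G p" if "p \<in> V" for p
    using cls_fibre[OF some_index local_splitting_std_fibre[OF some_index X_tangent[OF that]]]
      glued_splitting_eq[OF some_index X_tangent[OF that]]
    by simp
  fix i
  have op: "open (V \<inter> U i)"
    using V open_U by blast
  have "smooth_section C (V \<inter> U i) (\<lambda>p. local_splitting ip (obj D i) p (X p))"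
    by (rule local_splitting_smooth[OF ip_bilinear object manifold std_courant_algebroid op])
      (use smooth_vector_field_subset[OF X] in auto)
  then show "smooth_section C (V \<inter> U i) (\<lambda>p. glue_rep i p (glued_splitting A ip U D p (X p)))"
    by (rule std_section_cong[OF manifold op])
      (use X_tangent glued_splitting_eq[where i = i] rep_cls_self local_splitting_std_fibre in simp)
qed

text \<open>In a chart the projection only forgets the covector. The Lie algebra component is a
  component of the smooth representative, so the local kernel splitting is applied to a smooth
  map.\<close>

lemma glued_ker_splitting_smooth:
  assumes V: "open V" and e: "smooth_section G V e" and ker: "\<And>p. p \<in> V \<Longrightarrow> e p \<in> anchor_ker G p"
  shows "smooth_section G V (\<lambda>p. glued_ker_splitting A ip U D p (quot_proj G p (e p)))"
  unfolding glued_section_iff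
proof (intro conjI ballI allI)
  have eq: "glued_ker_splitting A ip U D p (quot_proj G p (e p))
      = cls i p (local_ker_splitting ip (obj D i) p (fst (snd (glue_rep i p (e p)))))"
    if "p \<in> V" "p \<in> U i" for p i
    by (rule anchor_ker_cases[OF that(2) ker[OF that(1)]])
      (simp add: glued_ker_splitting_coset[OF that(2)])
  show "glued_ker_splitting A ip U D p (quot_proj G p (e p)) \<in> fibre G p" if "p \<in> V" for p
    unfolding eq[OF that some_index]
    by (rule cls_fibre[OF some_index local_ker_splitting_std_fibre[OF some_index]])
  fix i
  have op: "open (V \<inter> U i)"
    using V open_U by blast
  have "smooth_map_on A (V \<inter> U i) (\<lambda>p. fst (snd (glue_rep i p (e p))))"
    using e by (simp add: glued_section_iff std_section_iff)
  then have "smooth_section C (V \<inter> U i)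
      (\<lambda>p. local_ker_splitting ip (obj D i) p (fst (snd (glue_rep i p (e p)))))"
    by (rule local_ker_splitting_smooth[OF ip_bilinear object manifold std_courant_algebroid op
          Int_lower2])
  then show "smooth_section C (V \<inter> U i)
      (\<lambda>p. glue_rep i p (glued_ker_splitting A ip U D p (quot_proj G p (e p))))"
    by (rule std_section_cong[OF manifold op])
      (use eq[where i = i] rep_cls_self local_ker_splitting_std_fibre in simp)
qed

lemma glued_connection:
  "courant_connection A UNIV G (glued_splitting A ip U D) (glued_ker_splitting A ip U D)"
  unfolding courant_connection_def transitive_courant_algebroid_def
proof (intro conjI ballI allI impI; (elim conjE)?)
  show "courant_algebroid A UNIV G"
    by (rule glued_courant_algebroid)
next
  fix p :: 'm
  let ?i = "some_index U p"
  note i = some_index[of p]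
  note spl = local_splitting_std_fibre[OF i]
  have s: "glued_splitting A ip U D p v \<in> fibre G p" "anchor G p (glued_splitting A ip U D p v) = v"
    if "v \<in> tangent_space A p" for v
    using cls_fibre[OF i spl[OF that]] cls_operations(3)[OF i spl[OF that]]
    by (simp_all add: glued_splitting_eq[OF i that] local_splitting_def split: prod.splits)
  show "anchor G p ` fibre G p = tangent_space A p"
  proof
    show "anchor G p ` fibre G p \<subseteq> tangent_space A p"
      using courant_algebroid_anchor(1)[OF glued_courant_algebroid UNIV_I] by blast
    show "tangent_space A p \<subseteq> anchor G p ` fibre G p"
      \<comment> \<open>Transitivity comes from the splitting itself: \<open>v\<close> is the anchor
        of its image under the splitting.\<close>
      using s by (metis image_eqI subsetI)
  qed
  fix v assume v: "v \<in> tangent_space A p"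
  show "glued_splitting A ip U D p v \<in> fibre G p" "anchor G p (glued_splitting A ip U D p v) = v"
    using s[OF v] .
  show "glued_splitting A ip U D p (c *\<^sub>R v) = fscale G p c (glued_splitting A ip U D p v)" for c
    using cls_operations(2)[OF i spl[OF v]] local_splitting_linear(2)[OF ip_bilinear object i v v]
    by (simp add: glued_splitting_eq[OF i] v tangent_space_scaleR)
  fix w assume w: "w \<in> tangent_space A p"
  show "glued_splitting A ip U D p (v + w)
      = fadd G p (glued_splitting A ip U D p v) (glued_splitting A ip U D p w)"
    using cls_operations(1)[OF i spl[OF v] spl[OF w]]
      local_splitting_linear(1)[OF ip_bilinear object i v w]
    by (simp add: glued_splitting_eq[OF i] v w tangent_space_add)
  show "pairing G p (glued_splitting A ip U D p v) (glued_splitting A ip U D p w) = 0"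
    using cls_operations(4)[OF i spl[OF v] spl[OF w]]
      local_splitting_isotropic[OF object ip_symmetric i]
    by (simp add: glued_splitting_eq[OF i] v w)
next
  fix p :: 'm and K assume K: "K \<in> quot_fibre G p"
  let ?i = "some_index U p"
  note i = some_index[of p]
  obtain a where a: "K = coset ?i p a"
    using K by (auto simp: quot_fibre_eq[OF i])
  \<comment> \<open>The kernel splitting keeps the Lie algebra component, which is all that the
    projection sees.\<close>
  obtain \<zeta> where \<zeta>: "local_ker_splitting ip (obj D ?i) p a = (0, a, \<zeta>)" "\<zeta> \<in> cotangent_space A p"
    using local_ker_splitting_std_fibre[OF i, of a]
    by (auto simp: local_ker_splitting_def std_fibre_iff split: prod.splits)
  show "glued_ker_splitting A ip U D p K \<in> anchor_ker G p"
    using \<zeta> by (auto simp: a glued_ker_splitting_coset[OF i] anchor_ker_eq[OF i])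
  show "quot_proj G p (glued_ker_splitting A ip U D p K) = K"
    using \<zeta> quot_proj_cls[OF i] by (simp add: a glued_ker_splitting_coset[OF i])
  fix v assume v: "v \<in> tangent_space A p"
  show "pairing G p (glued_ker_splitting A ip U D p K) (glued_splitting A ip U D p v) = 0"
    using cls_operations(4)[OF i local_ker_splitting_std_fibre[OF i] local_splitting_std_fibre[OF i v]]
      local_splittings_orthogonal[OF ip_bilinear object i v]
    by (simp add: a glued_ker_splitting_coset[OF i] glued_splitting_eq[OF i v])
next
  fix p :: 'm and e assume e: "e \<in> anchor_ker G p"
  let ?i = "some_index U p"
  note i = some_index[of p]
  note ker = local_ker_splitting_std_fibre[OF i]
  obtain a \<xi> where a: "\<xi> \<in> cotangent_space A p" "e = cls ?i p (0, a, \<xi>)" "quot_proj G p e = coset ?i p a"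
    using anchor_ker_cases[OF i e] by metis
  have "fscale G p c e = cls ?i p (0, c *\<^sub>R a, c *\<^sub>R \<xi>)" for c
    using cls_operations(2)[OF i, of "(0, a, \<xi>)"] a by (simp add: ker_std_fibre)
  then have "quot_proj G p (fscale G p c e) = coset ?i p (c *\<^sub>R a)" for c
    using quot_proj_cls[OF i lin_maps_scaleR[OF a(1)]] by simp
  then show "glued_ker_splitting A ip U D p (quot_proj G p (fscale G p c e))
      = fscale G p c (glued_ker_splitting A ip U D p (quot_proj G p e))" for c
    using cls_operations(2)[OF i ker]
    by (simp add: a(3) glued_ker_splitting_coset[OF i] local_ker_splitting_linear(2)[OF ip_bilinear])
  fix e' assume e': "e' \<in> anchor_ker G p"
  obtain b \<eta> where b: "\<eta> \<in> cotangent_space A p" "e' = cls ?i p (0, b, \<eta>)" "quot_proj G p e' = coset ?i p b"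
    using anchor_ker_cases[OF i e'] by metis
  have "fadd G p e e' = cls ?i p (0, a + b, \<xi> + \<eta>)"
    using cls_operations(1)[OF i, of "(0, a, \<xi>)" "(0, b, \<eta>)"] a b by (simp add: ker_std_fibre)
  then have "quot_proj G p (fadd G p e e') = coset ?i p (a + b)"
    using quot_proj_cls[OF i lin_maps_add[OF a(1) b(1)]] by simp
  then show "glued_ker_splitting A ip U D p (quot_proj G p (fadd G p e e'))
      = fadd G p (glued_ker_splitting A ip U D p (quot_proj G p e))
        (glued_ker_splitting A ip U D p (quot_proj G p e'))"
    using cls_operations(1)[OF i ker ker]
    by (simp add: a(3) b(3) glued_ker_splitting_coset[OF i] local_ker_splitting_linear(1)[OF ip_bilinear])
next
  show "smooth_section G V (\<lambda>p. glued_splitting A ip U D p (X p))"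
    if "open V" "smooth_vector_field A V X" for V X
    using that by (rule glued_splitting_smooth)
  show "smooth_section G V (\<lambda>p. glued_ker_splitting A ip U D p (quot_proj G p (e p)))"
    if "open V" "smooth_section G V e" "\<forall>p\<in>V. e p \<in> anchor_ker G p" for V e
    using glued_ker_splitting_smooth[OF that(1,2)] that(3) by blast
qed

end

section \<open>The glued isomorphism\<close>

text \<open>The first conjunct says that \<open>F\<close> is obtained by gluing the local matrices.
  As every element of a fibre is such a class, it determines \<open>F\<close> on all fibres.\<close>

theorem proposition4p6:
  fixes A :: "('m::{t2_space, second_countable_topology}, 'e::real_normed_vector) atlas"
    and lb :: "'g::real_vector \<Rightarrow> 'g \<Rightarrow> 'g"
    and ip :: "'g \<Rightarrow> 'g \<Rightarrow> real"
    and U :: "'i \<Rightarrow> 'm set"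
    and D' D :: "('i, 'm, 'g) tc_data"
    and \<Lambda> :: "'i \<Rightarrow> 'm \<Rightarrow> ('m, 'g) std \<Rightarrow> ('m, 'g) std"
  assumes "quadratic_lie_algebra lb ip"
    and "smooth_manifold A"
    and "open_cover U"
    and "transitive_courant_data A lb ip U D'"
    and "transitive_courant_data A lb ip U D"
    and "tc_data_morphism A lb ip U D' D \<Lambda>"
  shows "\<exists>F. (\<forall>i. \<forall>p\<in>U i. \<forall>e\<in>std_fibre A p.
        F p (glue_class A U D' i p e) = glue_class A U D i p (\<Lambda> i p e)) \<and>
      connection_preserving_isomorphism A UNIV
        (glued_courant A lb ip U D') (glued_splitting A ip U D') (glued_ker_splitting A ip U D')
        (glued_courant A lb ip U D) (glued_splitting A ip U D) (glued_ker_splitting A ip U D) F"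
proof -
  interpret D': glued_data A lb ip U D'
    using assms by unfold_locales
  interpret D: glued_data A lb ip U D
    using assms by unfold_locales
  have mor: "tc_morphism A lb ip (U i) (obj D' i) (obj D i) (\<Lambda> i)" for i
    using assms(6) by (simp add: tc_data_morphism_def)
  have comm: "D.T i j p (\<Lambda> j p e) = \<Lambda> i p (D'.T i j p e)"
    if "p \<in> U i" "p \<in> U j" "e \<in> std_fibre A p" for i j p e
    using assms(6) that by (simp add: tc_data_morphism_def)
  have iso: "courant_isomorphism A (U i) D.C D.C (\<Lambda> i)" for i
    using tc_morphism_isomorphism[OF mor] .
  have "bij_betw (\<Lambda> i p) (std_fibre A p) (std_fibre A p)" if "p \<in> U i" for i p
    using iso[of i] that by (simp add: courant_isomorphism_def bundle_isomorphism_def)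
  then have \<Lambda>: "\<Lambda> i p e \<in> std_fibre A p" if "p \<in> U i" "e \<in> std_fibre A p" for i p e
    using that bij_betwE by blast
  \<comment> \<open>The index is chosen pointwise, as for the glued operations; \<open>F_rep\<close>
    shows that any other index gives the same value.\<close>
  define F where "F p c = (let i = some_index U p in D.cls i p (\<Lambda> i p (glue_rep i p c)))" for p c
  have F_rep: "F p c = D.cls i p (\<Lambda> i p (glue_rep i p c))"
    if i: "p \<in> U i" and c: "c \<in> fibre D'.G p" for i p c
  proof -
    let ?j = "some_index U p"
    note j = D.some_index[of p] and r = D'.rep_fibre[OF D.some_index c]
    have "F p c = D.cls i p (D.T i ?j p (\<Lambda> ?j p (glue_rep ?j p c)))"
      using D.cls_transition[OF j i \<Lambda>[OF j r]] by (simp add: F_def Let_def)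
    then show ?thesis
      using comm[OF i j r] D'.transition_rep[OF j i c] by simp
  qed
  have F_cls: "F p (D'.cls i p e) = D.cls i p (\<Lambda> i p e)" if "p \<in> U i" "e \<in> std_fibre A p" for i p e
    using F_rep[OF that(1) D'.cls_fibre[OF that]] D'.rep_cls_self[OF that] by simp
  have "courant_isomorphism A UNIV D'.G D.G F"
  proof (rule courant_gluing_isomorphism[OF D.courant_gluing_axioms D'.courant_gluing_axioms iso])
    fix p c assume c: "c \<in> fibre D'.G p"
    show "F p c \<in> fibre D.G p"
      unfolding F_rep[OF D.some_index c]
      by (intro D.cls_fibre \<Lambda> D'.rep_fibre D.some_index c)
    show "glue_rep i p (F p c) = \<Lambda> i p (glue_rep i p c)" if "p \<in> U i" for i
      unfolding F_rep[OF that c] by (intro D.rep_cls_self \<Lambda> D'.rep_fibre that c)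
  qed
  moreover have "F p (glued_splitting A ip U D' p v) = glued_splitting A ip U D p v"
    if v: "v \<in> tangent_space A p" for p v
  proof -
    note i = D.some_index[of p]
    note spl = D'.local_splitting_std_fibre[OF i v]
    show ?thesis
      using F_cls[OF i spl] tc_morphism_local_splitting[OF mor i v spl]
      by (simp add: D.glued_splitting_eq[OF i v] D'.glued_splitting_eq[OF i v])
  qed
  moreover have "F p (glued_ker_splitting A ip U D' p K) = glued_ker_splitting A ip U D p (F p ` K)"
    if K: "K \<in> quot_fibre D'.G p" for p K
  proof -
    let ?i = "some_index U p"
    note i = D.some_index[of p]
    obtain a where a: "K = D'.coset ?i p a"
      using K by (auto simp: D'.quot_fibre_eq[OF i])
    \<comment> \<open>The isomorphism carries the coset of \<open>a\<close> to that of
      \<open>b\<close>, because the shift \<open>\<zeta>\<close> is the same for all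
      covectors.\<close>
    obtain b \<zeta> where \<zeta>: "\<zeta> \<in> cotangent_space A p"
      and L: "\<And>\<eta>. \<eta> \<in> cotangent_space A p \<Longrightarrow> \<Lambda> ?i p (0, a, \<eta>) = (0, b, \<zeta> + \<eta>)"
      and L_ker: "\<Lambda> ?i p (local_ker_splitting ip (obj D' ?i) p a) = local_ker_splitting ip (obj D ?i) p b"
      by (rule tc_morphism_local_ker_splitting[OF mor i D.ip_bilinear
            tc_object_forms(1)[OF D.object i] tc_object_forms(1)[OF D'.object i]]) blast
    have F: "F p (D'.cls ?i p (0, a, \<eta>)) = D.cls ?i p (0, b, \<zeta> + \<eta>)"
      if "\<eta> \<in> cotangent_space A p" for \<eta>
      using F_cls[OF i, of "(0, a, \<eta>)"] L[OF that] that by (simp add: D.ker_std_fibre)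
    \<comment> \<open>The kernel splitting of the target is applied to this image, so the image must
      be an entire coset and not merely lie in one.\<close>
    have "F p ` D'.coset ?i p a = D.coset ?i p b"
    proof (intro set_eqI iffI)
      fix c assume "c \<in> F p ` D'.coset ?i p a"
      then show "c \<in> D.coset ?i p b"
        using F lin_maps_add[OF \<zeta>] by (auto simp: D.coset_def D'.coset_def)
    next
      fix c assume "c \<in> D.coset ?i p b"
      then obtain \<eta> where \<eta>: "\<eta> \<in> cotangent_space A p" "c = D.cls ?i p (0, b, \<eta>)"
        by (auto simp: D.coset_def)
      \<comment> \<open>The preimage has to undo the shift by \<open>\<zeta>\<close>.\<close>
      have "\<eta> - \<zeta> \<in> cotangent_space A p"
        by (rule lin_maps_diff[OF \<eta>(1) \<zeta>])
      with F[OF this] \<eta>(2) show "c \<in> F p ` D'.coset ?i p a"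
        by (auto simp: D'.coset_def intro!: image_eqI[of _ _ "D'.cls ?i p (0, a, \<eta> - \<zeta>)"])
    qed
    then show ?thesis
      using F_cls[OF i D'.local_ker_splitting_std_fibre[OF i, of a]] L_ker
      by (simp add: a D.glued_ker_splitting_coset[OF i] D'.glued_ker_splitting_coset[OF i])
  qed
  ultimately have "connection_preserving_isomorphism A UNIV
      D'.G (glued_splitting A ip U D') (glued_ker_splitting A ip U D')
      D.G (glued_splitting A ip U D) (glued_ker_splitting A ip U D) F"
    using D.glued_connection D'.glued_connection
    by (simp add: connection_preserving_isomorphism_def)
  then show ?thesis
    using F_cls by blast
qed

end
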